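(* Let $X,Z,U,Y$ be Hilbert spaces, $E\in L(X,Z)$, $B\in L(U,Z)$, $C\in L(X,Y)$, let $A:X\supseteq D(A)\to Z$ be closed and densely defined, and let $t_f>0$. Assume that there are $M>0$ and $\omega<0$ such that $\{\lambda\in\mathbb{C}:\operatorname{Re}\lambda>\omega\}\subseteq\rho(E,A)$ and $$\|(A-\lambda E)^{-1}E\|\le\frac{M}{\lambda-\omega}\quad\text{for all real }\lambda>\omega,$$ that the associated degenerate semigroup $T$ is exponentially stable, and that the transfer function $s\mapsto C(sE-A)^{-1}B$ is bounded on the open right half-plane. Let $\mathcal{Q}\in L^\infty([0,t_f],L(Y))$, $\mathcal{R}\in L^\infty([0,t_f],L(U))$ be pointwise (a.e.) self-adjoint and let $\mathcal{N}\in L^\infty([0,t_f],L(Y,U))$. Let $\Psi$ be the output map and $\mathbb{F}$ the input-output operator of the system, let $$J(u,x_0)=\int_0^{t_f}\left\langle\begin{pmatrix}y(t)\\ u(t)\end{pmatrix},\begin{pmatrix}\mathcal{Q}(t)&\mathcal{N}(t)^*\\ \mathcal{N}(t)&\mathcal{R}(t)\end{pmatrix}\begin{pmatrix}y(t)\\ u(t)\end{pmatrix}\right\rangle_{Y\times U}\mathrm{d}t,\qquad y=\Psi x_0+\mathbb{F}u,$$ and assume that the Popov operator $$\mathfrak{R}:=\mathcal{R}+\mathcal{N}\mathbb{F}+\mathbb{F}^*\mathcal{N}^*+\mathbb{F}^*\mathcal{Q}\mathbb{F}\in L(L^2([0,t_f],U))$$ is coercive, i.e. there exists $\varepsilon>0$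 with $\langle u,\mathfrak{R}u\rangle\ge\varepsilon\|u\|^2$ for all $u\in L^2([0,t_f],U)$. Then for all $x_0\in X$ $$\min_{u\in L^2([0,t_f],U)}J(u,x_0)=\langle x_0,\mathcal{P}x_0\rangle_X,$$ where $\mathcal{P}=\mathcal{P}^*\in L(X)$ is the Riccati operator $$\mathcal{P}=\Psi^*\mathcal{Q}\Psi-\Psi^*(\mathcal{Q}\mathbb{F}+\mathcal{N}^* )\mathfrak{R}^{-1}(\mathbb{F}^*\mathcal{Q}+\mathcal{N})\Psi,$$ and the unique minimizer is $$u^{\rm opt}(t)=-\bigl(\mathfrak{R}^{-1}(\mathbb{F}^*\mathcal{Q}+\mathcal{N})\Psi x_0\bigr)(t)\quad\text{for a.e. }t\in[0,t_f].$$
   Context: The underlying system is $\frac{\mathrm d}{\mathrm dt}Ex(t)=Ax(t)+Bu(t)$, $Ex(0)=Ex_0$, $y(t)=Cx(t)$. The resolvent set of the pair is $\rho(E,A):=\{\lambda\in\mathbb{C}:\lambda E-A:D(A)\to Z\text{ is bijective}\}$; since $\omega<0$, $0\in\rho(E,A)$, so $A$ is boundedly invertible. Functions $\mathcal{Q},\mathcal{R},\mathcal{N}$ are identified with the corresponding multiplication operators on $L^2$. Degenerate semigroup. Put $R_r(\lambda):=(A-\lambda E)^{-1}E\in L(X)$. Under the growth bound, $X=X_K\dotplus X_R$ with closed subspaces $X_K=\ker R_r(\lambda)$, $X_R=\overline{\operatorname{ran}R_r(\lambda)}$ independent of $\lambda$. Let $P\in L(X)$ be the projection with $\operatorname{ran}P=X_R$,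 $\ker P=X_K$. The operator $A_R$ on $X_R$ is defined by $\operatorname{graph}A_R=\{(R_r(\lambda)x,x+\lambda R_r(\lambda)x):x\in X_R\}$ (independent of $\lambda$), so $A_R^{-1}=A^{-1}E|_{X_R}$. It is a standing assumption that $A_R$ generates a $C_0$-semigroup $(T_R(t))_{t\ge0}$ on $X_R$; the associated degenerate semigroup is $T(t):=T_R(t)P$, and it is exponentially stable if $\|T(t)\|\le M'e^{-\delta t}$ for all $t\ge0$ with some $M',\delta>0$. Extrapolation. $X_{R,-1}$ is the completion of $X_R$ with respect to $\|(\lambda I-A_R)^{-1}\cdot\|_{X_R}$ (any $\lambda$ in the resolvent set of $A_R$); $A_R$ extends to a bounded operator $X_R\to X_{R,-1}$, again denoted $A_R$ below, and $T_R$ extends to a $C_0$-semigroup $T_{R,-1}$ on $X_{R,-1}$. Output map and input-output operator. Put $\hat B_1:=PA^{-1}B\in L(U,X_R)$ and $\hat B_0:=(I-P)A^{-1}B\in L(U,X_K)$. Then $\Psi:X\to L^2([0,t_f],Y)$, $(\Psi x_0)(t):=CT(t)x_0$, and $\mathbb{F}:L^2([0,t_f],U)\to L^2([0,t_f],Y)$ is $$(\mathbb{F}u)(t):=C\int_0^tT_{R,-1}(t-s)A_R\hat B_1u(s)\,\mathrm{d}s-C\hat B_0u(t).$$ This formula is understood for smooth $u$ (e.g. $u\in H^1([0,t_f],U)$, for which the integral takes values in $X_R$), and $\mathbb{F}$ denotes its unique bounded extension to $L^2([0,t_f],U)$, which exists because the transfer function is bounded on the right half-plane. *)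

theory Defs
  imports "HOL-Analysis.Analysis" "HOL-Library.Complex_Order"
begin

section \<open>Complex Hilbert spaces\<close>

class complex_vector = real_vector +
  fixes scaleC :: "complex \<Rightarrow> 'a \<Rightarrow> 'a"  (infixr "*\<^sub>C" 75)
  assumes scaleC_add_right: "c *\<^sub>C (x + y) = c *\<^sub>C x + c *\<^sub>C y"
    and scaleC_add_left: "(c + d) *\<^sub>C x = c *\<^sub>C x + d *\<^sub>C x"
    and scaleC_scaleC: "c *\<^sub>C d *\<^sub>C x = (c * d) *\<^sub>C x"
    and scaleR_eq_scaleC: "r *\<^sub>R x = complex_of_real r *\<^sub>C x"

class complex_normed_vector = complex_vector + real_normed_vector +
  assumes norm_scaleC: "norm (c *\<^sub>C x) = cmod c * norm x"

class complex_banach = complex_normed_vector + banach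

text \<open>The inner product is conjugate linear in the first argument. The order on \<^typ>\<open>complex\<close>
  is the one of \<^theory>\<open>HOL-Library.Complex_Order\<close>, so \<^prop>\<open>a \<le> (b::complex)\<close> says in
  particular that \<^prop>\<open>Im a = Im b\<close>.\<close>

class complex_hilbert = complex_banach +
  fixes cinner :: "'a \<Rightarrow> 'a \<Rightarrow> complex"
  assumes cinner_commute: "cinner x y = cnj (cinner y x)"
    and cinner_add_left: "cinner (x + y) z = cinner x z + cinner y z"
    and cinner_scaleC_left: "cinner (c *\<^sub>C x) y = cnj c * cinner x y"
    and cinner_ge_zero: "0 \<le> cinner x x"
    and cinner_eq_zero_iff: "cinner x x = 0 \<longleftrightarrow> x = 0"
    and norm_eq_sqrt_cinner: "norm x = sqrt (cmod (cinner x x))"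

instantiation complex :: complex_hilbert
begin

definition "scaleC c (x::complex) = c * x"
definition "cinner x (y::complex) = cnj x * y"

instance
  by standard
    (auto simp: scaleC_complex_def cinner_complex_def algebra_simps scaleR_conv_of_real
      norm_mult less_eq_complex_def simp flip: power2_eq_square)

end

definition csubspace :: "'a::complex_vector set \<Rightarrow> bool" where
  "csubspace V \<longleftrightarrow> 0 \<in> V \<and> (\<forall>x\<in>V. \<forall>y\<in>V. x + y \<in> V) \<and> (\<forall>c. \<forall>x\<in>V. c *\<^sub>C x \<in> V)"

definition clinear_on :: "'a set \<Rightarrow> ('a::complex_vector \<Rightarrow> 'b::complex_vector) \<Rightarrow> bool" where
  "clinear_on V f \<longleftrightarrow>
     (\<forall>x\<in>V. \<forall>y\<in>V. f (x + y) = f x + f y) \<and> (\<forall>c. \<forall>x\<in>V. f (c *\<^sub>C x) = c *\<^sub>C f x)"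

definition bounded_on :: "'a set \<Rightarrow> ('a::real_normed_vector \<Rightarrow> 'b::real_normed_vector) \<Rightarrow> bool" where
  "bounded_on V f \<longleftrightarrow> (\<exists>K. \<forall>x\<in>V. norm (f x) \<le> K * norm x)"

definition bounded_clinear ::
    "('a::complex_normed_vector \<Rightarrow> 'b::complex_normed_vector) \<Rightarrow> bool" where
  "bounded_clinear f \<longleftrightarrow> clinear_on UNIV f \<and> bounded_on UNIV f"

text \<open>Hilbert space adjoint of \<^term>\<open>G\<close>, mapping \<^term>\<open>V\<close> into \<^term>\<open>W\<close>, with respect to given
  inner products. It is used for Hilbert space types and for the spaces \<open>L\<^sup>2\<close> below, whose elements
  are functions, so that there values are determined up to equality almost everywhere.\<close>

definition adjoint_wrt ::
    "'a set \<Rightarrow> ('a \<Rightarrow> 'a \<Rightarrow> complex) \<Rightarrow> 'b set \<Rightarrow> ('b \<Rightarrow> 'b \<Rightarrow> complex) \<Rightarrow> ('a \<Rightarrow> 'b) \<Rightarrow> 'b \<Rightarrow> 'a" where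
  "adjoint_wrt V ipV W ipW G =
     (SOME H. (\<forall>w\<in>W. H w \<in> V) \<and> (\<forall>v\<in>V. \<forall>w\<in>W. ipW (G v) w = ipV v (H w)))"

definition cadjoint :: "('a::complex_hilbert \<Rightarrow> 'b::complex_hilbert) \<Rightarrow> 'b \<Rightarrow> 'a" where
  "cadjoint = adjoint_wrt UNIV cinner UNIV cinner"

definition selfadjoint :: "('a::complex_hilbert \<Rightarrow> 'a) \<Rightarrow> bool" where
  "selfadjoint S \<longleftrightarrow> (\<forall>x y. cinner (S x) y = cinner x (S y))"


section \<open>Vector-valued function spaces on \<open>[0, T]\<close>\<close>

text \<open>Strong (Bochner) measurability. The library's Bochner integral is restricted to second
  countable spaces, whereas the Hilbert spaces here, and the spaces of bounded operators between
  them, need not be separable. Elements of the function spaces are functions; they are to be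
  identified if they agree almost everywhere.\<close>

definition strongly_measurable :: "real \<Rightarrow> (real \<Rightarrow> 'a::real_normed_vector) \<Rightarrow> bool" where
  "strongly_measurable T f \<longleftrightarrow>
     (\<exists>s. (\<forall>n::nat. simple_function (lebesgue_on {0..T}) (s n)) \<and>
          (AE t in lebesgue_on {0..T}. (\<lambda>n. s n t) \<longlonglongrightarrow> f t))"

definition L2 :: "real \<Rightarrow> (real \<Rightarrow> 'a::real_normed_vector) set" where
  "L2 T = {f. strongly_measurable T f \<and> integrable (lebesgue_on {0..T}) (\<lambda>t. (norm (f t))\<^sup>2)}"

definition L2_cinner :: "real \<Rightarrow> (real \<Rightarrow> 'a::complex_hilbert) \<Rightarrow> (real \<Rightarrow> 'a) \<Rightarrow> complex" where
  "L2_cinner T f g = (\<integral>t. cinner (f t) (g t) \<partial>lebesgue_on {0..T})"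

definition L2_norm :: "real \<Rightarrow> (real \<Rightarrow> 'a::real_normed_vector) \<Rightarrow> real" where
  "L2_norm T f = sqrt (\<integral>t. (norm (f t))\<^sup>2 \<partial>lebesgue_on {0..T})"

text \<open>\<open>H\<^sup>1([0, T])\<close>, represented by absolutely continuous functions. The Henstock--Kurzweil integral of
  a function in \<open>L\<^sup>2\<close> coincides with its Bochner integral.\<close>

definition H1 :: "real \<Rightarrow> (real \<Rightarrow> 'a::real_normed_vector) set" where
  "H1 T = {u. \<exists>v\<in>L2 T. \<forall>t\<in>{0..T}. (v has_integral (u t - u 0)) {0..t}}"

text \<open>\<open>L\<^sup>\<infinity>([0, T], L(V, W))\<close>: essentially bounded functions that are Bochner measurable with respect to
  the operator norm. The type \<^typ>\<open>'a \<Rightarrow>\<^sub>L 'b\<close> consists of real-linear operators, hence the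
  additional requirement of complex linearity.\<close>

definition Linf_op ::
    "real \<Rightarrow> (real \<Rightarrow> ('a::complex_normed_vector \<Rightarrow>\<^sub>L 'b::complex_normed_vector)) set" where
  "Linf_op T = {Q. strongly_measurable T Q \<and>
     (\<exists>K. AE t in lebesgue_on {0..T}. norm (Q t) \<le> K) \<and>
     (AE t in lebesgue_on {0..T}. clinear_on UNIV (blinfun_apply (Q t)))}"

definition bounded_L2_op ::
    "real \<Rightarrow> ((real \<Rightarrow> 'a::complex_normed_vector) \<Rightarrow> real \<Rightarrow> 'b::complex_normed_vector) \<Rightarrow> bool" where
  "bounded_L2_op T G \<longleftrightarrow>
     (\<forall>f\<in>L2 T. G f \<in> L2 T) \<and>
     (\<forall>f\<in>L2 T. \<forall>g\<in>L2 T. AE t in lebesgue_on {0..T}. G (\<lambda>s. f s + g s) t = G f t + G g t) \<and>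
     (\<forall>c. \<forall>f\<in>L2 T. AE t in lebesgue_on {0..T}. G (\<lambda>s. c *\<^sub>C f s) t = c *\<^sub>C G f t) \<and>
     (\<exists>K. \<forall>f\<in>L2 T. L2_norm T (G f) \<le> K * L2_norm T f)"

definition L2_inverse ::
    "real \<Rightarrow> ((real \<Rightarrow> 'a::real_normed_vector) \<Rightarrow> real \<Rightarrow> 'b) \<Rightarrow> (real \<Rightarrow> 'b) \<Rightarrow> real \<Rightarrow> 'a" where
  "L2_inverse T G f = (SOME g. g \<in> L2 T \<and> (AE t in lebesgue_on {0..T}. G g t = f t))"


section \<open>Operator pencils\<close>

text \<open>An unbounded operator is a function \<^term>\<open>A\<close> together with its domain \<^term>\<open>D\<close>.\<close>

definition closed_densely_defined ::
    "'a::complex_normed_vector set \<Rightarrow> ('a \<Rightarrow> 'b::complex_normed_vector) \<Rightarrow> bool" where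
  "closed_densely_defined D A \<longleftrightarrow>
     csubspace D \<and> clinear_on D A \<and> closed ((\<lambda>x. (x, A x)) ` D) \<and> closure D = UNIV"

definition pencil_resolvent_set ::
    "('a::complex_vector \<Rightarrow> 'b::complex_vector) \<Rightarrow> 'a set \<Rightarrow> ('a \<Rightarrow> 'b) \<Rightarrow> complex set" where
  "pencil_resolvent_set E D A = {l. bij_betw (\<lambda>x. l *\<^sub>C E x - A x) D UNIV}"

definition right_resolvent ::
    "('a::complex_vector \<Rightarrow> 'b::complex_vector) \<Rightarrow> 'a set \<Rightarrow> ('a \<Rightarrow> 'b) \<Rightarrow> complex \<Rightarrow> 'a \<Rightarrow> 'a" where
  "right_resolvent E D A l x = inv_into D (\<lambda>x. A x - l *\<^sub>C E x) (E x)"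

definition transfer_function ::
    "('x::complex_vector \<Rightarrow> 'z::complex_vector) \<Rightarrow> 'x set \<Rightarrow> ('x \<Rightarrow> 'z) \<Rightarrow> ('u \<Rightarrow> 'z) \<Rightarrow> ('x \<Rightarrow> 'y)
      \<Rightarrow> complex \<Rightarrow> 'u \<Rightarrow> 'y" where
  "transfer_function E D A B C s v = C (inv_into D (\<lambda>x. s *\<^sub>C E x - A x) (B v))"

definition X_K ::
    "('a::complex_vector \<Rightarrow> 'b::complex_vector) \<Rightarrow> 'a set \<Rightarrow> ('a \<Rightarrow> 'b) \<Rightarrow> complex \<Rightarrow> 'a set" where
  "X_K E D A l = {x. right_resolvent E D A l x = 0}"

definition X_R ::
    "('a::complex_normed_vector \<Rightarrow> 'b::complex_vector) \<Rightarrow> 'a set \<Rightarrow> ('a \<Rightarrow> 'b) \<Rightarrow> complex \<Rightarrow> 'a set" where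
  "X_R E D A l = closure (range (right_resolvent E D A l))"

definition proj_R ::
    "('a::complex_normed_vector \<Rightarrow> 'b::complex_vector) \<Rightarrow> 'a set \<Rightarrow> ('a \<Rightarrow> 'b) \<Rightarrow> complex \<Rightarrow> 'a \<Rightarrow> 'a" where
  "proj_R E D A l x = (THE y. y \<in> X_R E D A l \<and> x - y \<in> X_K E D A l)"

definition A_R_graph ::
    "('a::complex_normed_vector \<Rightarrow> 'b::complex_vector) \<Rightarrow> 'a set \<Rightarrow> ('a \<Rightarrow> 'b) \<Rightarrow> complex \<Rightarrow> ('a \<times> 'a) set" where
  "A_R_graph E D A l =
     (\<lambda>x. (right_resolvent E D A l x, x + l *\<^sub>C right_resolvent E D A l x)) ` X_R E D A l"


section \<open>Semigroups and extrapolation on a closed subspace\<close>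

definition C0_semigroup_on :: "'a set \<Rightarrow> (real \<Rightarrow> 'a::complex_normed_vector \<Rightarrow> 'a) \<Rightarrow> bool" where
  "C0_semigroup_on V S \<longleftrightarrow>
     (\<forall>t\<ge>0. S t ` V \<subseteq> V \<and> clinear_on V (S t) \<and> bounded_on V (S t)) \<and>
     (\<forall>x\<in>V. S 0 x = x) \<and>
     (\<forall>s\<ge>0. \<forall>t\<ge>0. \<forall>x\<in>V. S (s + t) x = S s (S t x)) \<and>
     (\<forall>x\<in>V. ((\<lambda>t. S t x) \<longlongrightarrow> x) (at_right 0))"

definition generator_graph ::
    "'a set \<Rightarrow> (real \<Rightarrow> 'a::complex_normed_vector \<Rightarrow> 'a) \<Rightarrow> ('a \<times> 'a) set" where
  "generator_graph V S =
     {(x, y). x \<in> V \<and> y \<in> V \<and> ((\<lambda>h. (1 / h) *\<^sub>R (S h x - x)) \<longlongrightarrow> y) (at_right 0)}"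

definition graph_resolvent_set ::
    "'a::complex_vector set \<Rightarrow> ('a \<times> 'a) set \<Rightarrow> complex set" where
  "graph_resolvent_set V G = {m. bij_betw (\<lambda>(x, y). m *\<^sub>C x - y) G V}"

definition graph_resolvent :: "('a::complex_vector \<times> 'a) set \<Rightarrow> complex \<Rightarrow> 'a \<Rightarrow> 'a" where
  "graph_resolvent G m z = fst (inv_into G (\<lambda>(x, y). m *\<^sub>C x - y) z)"

text \<open>\<^term>\<open>j\<close> realises the completion of \<^term>\<open>V\<close> with respect to the norm
  \<open>\<parallel>(m I - G)\<^sup>-\<^sup>1 \<cdot>\<parallel>\<close>: it is isometric for this norm with values in a Banach space, so that the
  completion (unique up to isometric isomorphism) is \<^term>\<open>closure (j ` V)\<close>.\<close>

definition extrapolation_embedding ::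
    "'a::complex_normed_vector set \<Rightarrow> ('a \<times> 'a) set \<Rightarrow> complex \<Rightarrow> ('a \<Rightarrow> 'w::complex_banach) \<Rightarrow> bool" where
  "extrapolation_embedding V G m j \<longleftrightarrow>
     m \<in> graph_resolvent_set V G \<and> clinear_on V j \<and>
     (\<forall>x\<in>V. norm (j x) = norm (graph_resolvent G m x))"

definition continuous_ext ::
    "'a::topological_space set \<Rightarrow> ('a \<Rightarrow> 'b::t2_space) \<Rightarrow> 'a \<Rightarrow> 'b" where
  "continuous_ext S f x = Lim (inf (nhds x) (principal S)) f"

definition extrapolated_generator ::
    "('a::complex_normed_vector \<times> 'a) set \<Rightarrow> ('a \<Rightarrow> 'w::complex_banach) \<Rightarrow> 'a \<Rightarrow> 'w" where
  "extrapolated_generator G j = continuous_ext (Domain G) (\<lambda>x. j (THE y. (x, y) \<in> G))"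

definition extrapolated_semigroup ::
    "'a set \<Rightarrow> (real \<Rightarrow> 'a::complex_normed_vector \<Rightarrow> 'a) \<Rightarrow> ('a \<Rightarrow> 'w::complex_banach)
      \<Rightarrow> real \<Rightarrow> 'w \<Rightarrow> 'w" where
  "extrapolated_semigroup V S j t = continuous_ext (j ` V) (\<lambda>w. j (S t (inv_into V j w)))"


section \<open>The system\<close>

text \<open>Throughout, \<^term>\<open>l\<close> is the (immaterial) point of the resolvent set used to define
  \<^const>\<open>X_K\<close>, \<^const>\<open>X_R\<close> and \<^const>\<open>A_R_graph\<close>, \<^term>\<open>S\<close> is the semigroup on \<^const>\<open>X_R\<close>, and
  \<^term>\<open>j\<close> is the embedding of \<^const>\<open>X_R\<close> into its extrapolation space.\<close>

definition degenerate_semigroup ::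
    "('x::complex_normed_vector \<Rightarrow> 'z::complex_vector) \<Rightarrow> 'x set \<Rightarrow> ('x \<Rightarrow> 'z) \<Rightarrow> complex
      \<Rightarrow> (real \<Rightarrow> 'x \<Rightarrow> 'x) \<Rightarrow> real \<Rightarrow> 'x \<Rightarrow> 'x" where
  "degenerate_semigroup E D A l S t x = S t (proj_R E D A l x)"

definition exponentially_stable :: "(real \<Rightarrow> 'x::real_normed_vector \<Rightarrow> 'x) \<Rightarrow> bool" where
  "exponentially_stable T \<longleftrightarrow>
     (\<exists>M>0. \<exists>d>0. \<forall>t\<ge>0. \<forall>x. norm (T t x) \<le> M * exp (- d * t) * norm x)"

definition output_map ::
    "('x::complex_normed_vector \<Rightarrow> 'z::complex_vector) \<Rightarrow> 'x set \<Rightarrow> ('x \<Rightarrow> 'z) \<Rightarrow> ('x \<Rightarrow> 'y) \<Rightarrow> complex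
      \<Rightarrow> (real \<Rightarrow> 'x \<Rightarrow> 'x) \<Rightarrow> 'x \<Rightarrow> real \<Rightarrow> 'y" where
  "output_map E D A C l S x t = C (degenerate_semigroup E D A l S t x)"

definition B1_hat ::
    "('x::complex_normed_vector \<Rightarrow> 'z::complex_vector) \<Rightarrow> 'x set \<Rightarrow> ('x \<Rightarrow> 'z) \<Rightarrow> ('u \<Rightarrow> 'z) \<Rightarrow> complex
      \<Rightarrow> 'u \<Rightarrow> 'x" where
  "B1_hat E D A B l v = proj_R E D A l (inv_into D A (B v))"

definition B0_hat ::
    "('x::complex_normed_vector \<Rightarrow> 'z::complex_vector) \<Rightarrow> 'x set \<Rightarrow> ('x \<Rightarrow> 'z) \<Rightarrow> ('u \<Rightarrow> 'z) \<Rightarrow> complex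
      \<Rightarrow> 'u \<Rightarrow> 'x" where
  "B0_hat E D A B l v = inv_into D A (B v) - proj_R E D A l (inv_into D A (B v))"

text \<open>For \<^term>\<open>u\<close> in \<^const>\<open>H1\<close> the integral, taken in the extrapolation space, lies in the image of
  \<^const>\<open>X_R\<close>, from where it is pulled back before \<^term>\<open>C\<close> is applied.\<close>

definition io_formula ::
    "('x::complex_normed_vector \<Rightarrow> 'z::complex_vector) \<Rightarrow> 'x set \<Rightarrow> ('x \<Rightarrow> 'z) \<Rightarrow> ('u \<Rightarrow> 'z)
      \<Rightarrow> ('x \<Rightarrow> 'y::complex_vector) \<Rightarrow> complex \<Rightarrow> (real \<Rightarrow> 'x \<Rightarrow> 'x) \<Rightarrow> ('x \<Rightarrow> 'w::complex_banach)
      \<Rightarrow> (real \<Rightarrow> 'u) \<Rightarrow> real \<Rightarrow> 'y" where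
  "io_formula E D A B C l S j u t =
     C (inv_into (X_R E D A l) j
          (integral {0..t} (\<lambda>s. extrapolated_semigroup (X_R E D A l) S j (t - s)
             (extrapolated_generator (A_R_graph E D A l) j (B1_hat E D A B l (u s))))))
     - C (B0_hat E D A B l (u t))"

definition io_extension ::
    "real \<Rightarrow> ('x::complex_normed_vector \<Rightarrow> 'z::complex_vector) \<Rightarrow> 'x set \<Rightarrow> ('x \<Rightarrow> 'z)
      \<Rightarrow> ('u::complex_normed_vector \<Rightarrow> 'z) \<Rightarrow> ('x \<Rightarrow> 'y::complex_normed_vector) \<Rightarrow> complex
      \<Rightarrow> (real \<Rightarrow> 'x \<Rightarrow> 'x) \<Rightarrow> ('x \<Rightarrow> 'w::complex_banach)
      \<Rightarrow> ((real \<Rightarrow> 'u) \<Rightarrow> real \<Rightarrow> 'y) \<Rightarrow> bool" where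
  "io_extension T E D A B C l S j F \<longleftrightarrow>
     bounded_L2_op T F \<and>
     (\<forall>u\<in>H1 T. AE t in lebesgue_on {0..T}. F u t = io_formula E D A B C l S j u t)"

text \<open>The bounded extension is unique (up to equality almost everywhere) by density of \<^const>\<open>H1\<close> in
  \<^const>\<open>L2\<close>. It exists if the transfer function is bounded on the right half-plane; as usual for
  partial operations, the function is set to 0 otherwise.\<close>

definition io_operator ::
    "real \<Rightarrow> ('x::complex_normed_vector \<Rightarrow> 'z::complex_vector) \<Rightarrow> 'x set \<Rightarrow> ('x \<Rightarrow> 'z)
      \<Rightarrow> ('u::complex_normed_vector \<Rightarrow> 'z) \<Rightarrow> ('x \<Rightarrow> 'y::complex_normed_vector) \<Rightarrow> complex
      \<Rightarrow> (real \<Rightarrow> 'x \<Rightarrow> 'x) \<Rightarrow> ('x \<Rightarrow> 'w::complex_banach)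
      \<Rightarrow> (real \<Rightarrow> 'u) \<Rightarrow> real \<Rightarrow> 'y" where
  "io_operator T E D A B C l S j =
     (if \<exists>F. io_extension T E D A B C l S j F then SOME F. io_extension T E D A B C l S j F
      else (\<lambda>u t. 0))"


section \<open>The optimal control problem\<close>

text \<open>In the following, \<^term>\<open>Psi\<close> and \<^term>\<open>F\<close> are the output map and the input-output operator.\<close>

definition L2_adjoint ::
    "real \<Rightarrow> ((real \<Rightarrow> 'a::complex_hilbert) \<Rightarrow> real \<Rightarrow> 'b::complex_hilbert) \<Rightarrow> (real \<Rightarrow> 'b) \<Rightarrow> real \<Rightarrow> 'a" where
  "L2_adjoint T = adjoint_wrt (L2 T) (L2_cinner T) (L2 T) (L2_cinner T)"

definition output_adjoint ::
    "real \<Rightarrow> ('x::complex_hilbert \<Rightarrow> real \<Rightarrow> 'y::complex_hilbert) \<Rightarrow> (real \<Rightarrow> 'y) \<Rightarrow> 'x" where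
  "output_adjoint T = adjoint_wrt UNIV cinner (L2 T) (L2_cinner T)"

definition cost ::
    "real \<Rightarrow> (real \<Rightarrow> 'y::complex_hilbert \<Rightarrow>\<^sub>L 'y) \<Rightarrow> (real \<Rightarrow> 'u::complex_hilbert \<Rightarrow>\<^sub>L 'u)
      \<Rightarrow> (real \<Rightarrow> 'y \<Rightarrow>\<^sub>L 'u) \<Rightarrow> ('x \<Rightarrow> real \<Rightarrow> 'y) \<Rightarrow> ((real \<Rightarrow> 'u) \<Rightarrow> real \<Rightarrow> 'y)
      \<Rightarrow> (real \<Rightarrow> 'u) \<Rightarrow> 'x \<Rightarrow> complex" where
  "cost T Q R N Psi F u x =
     (let y = (\<lambda>t. Psi x t + F u t)
      in \<integral>t. cinner (y t) (Q t (y t) + cadjoint (N t) (u t)) + cinner (u t) (N t (y t) + R t (u t))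
           \<partial>lebesgue_on {0..T})"

definition popov ::
    "real \<Rightarrow> (real \<Rightarrow> 'y::complex_hilbert \<Rightarrow>\<^sub>L 'y) \<Rightarrow> (real \<Rightarrow> 'u::complex_hilbert \<Rightarrow>\<^sub>L 'u)
      \<Rightarrow> (real \<Rightarrow> 'y \<Rightarrow>\<^sub>L 'u) \<Rightarrow> ((real \<Rightarrow> 'u) \<Rightarrow> real \<Rightarrow> 'y) \<Rightarrow> (real \<Rightarrow> 'u) \<Rightarrow> real \<Rightarrow> 'u" where
  "popov T Q R N F u = (\<lambda>t.
     R t (u t) + N t (F u t) + L2_adjoint T F (\<lambda>s. cadjoint (N s) (u s)) t
     + L2_adjoint T F (\<lambda>s. Q s (F u s)) t)"

text \<open>\<open>\<RR>\<^sup>-\<^sup>1 (F\<^sup>* Q + N) Psi x\<close>, where \<open>\<RR>\<close> is the Popov operator.\<close>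

definition feedback ::
    "real \<Rightarrow> (real \<Rightarrow> 'y::complex_hilbert \<Rightarrow>\<^sub>L 'y) \<Rightarrow> (real \<Rightarrow> 'u::complex_hilbert \<Rightarrow>\<^sub>L 'u)
      \<Rightarrow> (real \<Rightarrow> 'y \<Rightarrow>\<^sub>L 'u) \<Rightarrow> ('x \<Rightarrow> real \<Rightarrow> 'y) \<Rightarrow> ((real \<Rightarrow> 'u) \<Rightarrow> real \<Rightarrow> 'y)
      \<Rightarrow> 'x \<Rightarrow> real \<Rightarrow> 'u" where
  "feedback T Q R N Psi F x =
     L2_inverse T (popov T Q R N F)
       (\<lambda>t. L2_adjoint T F (\<lambda>s. Q s (Psi x s)) t + N t (Psi x t))"

definition riccati ::
    "real \<Rightarrow> (real \<Rightarrow> 'y::complex_hilbert \<Rightarrow>\<^sub>L 'y) \<Rightarrow> (real \<Rightarrow> 'u::complex_hilbert \<Rightarrow>\<^sub>L 'u)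
      \<Rightarrow> (real \<Rightarrow> 'y \<Rightarrow>\<^sub>L 'u) \<Rightarrow> ('x::complex_hilbert \<Rightarrow> real \<Rightarrow> 'y) \<Rightarrow> ((real \<Rightarrow> 'u) \<Rightarrow> real \<Rightarrow> 'y)
      \<Rightarrow> 'x \<Rightarrow> 'x" where
  "riccati T Q R N Psi F x =
     output_adjoint T Psi (\<lambda>t. Q t (Psi x t))
     - (let v = feedback T Q R N Psi F x
        in output_adjoint T Psi (\<lambda>t. Q t (F v t) + cadjoint (N t) (v t)))"

end

(* Completing the square: with b = (F* Q + N) Psi x and v solving (Popov operator) v = b, the cost of u is
   <Psi x, Q Psi x> - <v, Popov v> + <u + v, Popov (u + v)>, so coercivity makes u = -v the unique
   minimiser. All adjoints and the inverse of the Popov operator come from one Riesz representation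
   theorem for complete semi-inner products on a subspace; applied to the Popov form it yields the
   inverse. Of the input-output operator only its boundedness on L2 enters.

   That Psi is linear and bounded rests on the splitting of X into X_K and X_R. Let J_k be -r times the
   right resolvent at r = k + 2. These operators are uniformly bounded and converge strongly to the
   identity on X_R, so the sum of the two spaces is direct and closed; it is dense because the adjoints
   of J_k converge weakly to the identity on the closed range of the adjoint of the resolvent, which
   contains the orthogonal complement of X_K, but vanish on the complement of X_R. *)

theory Submission
  imports Defs "HOL-Library.Function_Algebras"
begin

section \<open>Semi-inner products\<close>

text \<open>Functions take values in Hilbert spaces that may be non-separable, so measurability
  means being an a.e. limit of simple functions, and completeness of \<open>L2\<close> is built from
  that. Operators on \<open>L2\<close> are additive only almost everywhere, and adjoints and the
  inverse are chosen by \<open>SOME\<close>, so their pointwise linearity is out of reach. The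
  optimisation part therefore pairs everything with a test element and computes with numbers. By
  coercivity and boundedness the seminorm of the Popov form is equivalent to that of
  \<open>L2\<close>, which is why Riesz applies to it. The Riccati operator is handled through
  \<open>cinner z (riccati x)\<close>, which equals
  \<open>ip (Psi z) (Q Psi x) - form (v z) (v x)\<close>; symmetry is visible there, and a symmetric
  map defined everywhere is linear. In the splitting, \<open>\<omega> < 0\<close> bounds the
  resolvent at real r > 0 by M / r, hence -r times it by M. Linearity of the projection follows from
  uniqueness of the components; the bound on \<open>Psi\<close> is read off the exponential estimate
  for the semigroup composed with the projection.\<close>

instantiation "fun" :: (type, real_vector) real_vector
begin
definition "r *\<^sub>R f = (\<lambda>x. r *\<^sub>R f x)"
instance by standard (auto simp: scaleR_fun_def fun_eq_iff algebra_simps)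
end

text \<open>With the pointwise structure \<open>L2 T\<close> is a \<open>csubspace\<close> of a
  \<open>complex_vector\<close> type, so that one locale covers it together with Hilbert space types
  and their subspaces.\<close>

instantiation "fun" :: (type, complex_vector) complex_vector
begin
definition "c *\<^sub>C f = (\<lambda>x. c *\<^sub>C f x)"
instance
  by standard (auto simp: scaleR_fun_def scaleC_fun_def fun_eq_iff scaleC_add_right scaleC_add_left
    scaleC_scaleC scaleR_eq_scaleC)
end

lemma scaleC_minus_one: "(-1) *\<^sub>C x = - (x::'a::complex_vector)"
  using scaleR_eq_scaleC[of "-1" x] by simp

lemma scaleC_zero_left [simp]: "0 *\<^sub>C x = (0::'a::complex_vector)"
  using scaleR_eq_scaleC[of 0 x] by simp

lemma scaleC_zero_right [simp]: "c *\<^sub>C 0 = (0::'a::complex_vector)"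
  using scaleC_add_right[of c 0 0] by simp

lemma scaleC_minus_right: "c *\<^sub>C (- x) = - (c *\<^sub>C (x::'a::complex_vector))"
  using scaleC_add_right[of c x "-x"] by (simp add: eq_neg_iff_add_eq_0 add.commute)

lemma scaleC_diff_right: "c *\<^sub>C (x - y) = c *\<^sub>C x - c *\<^sub>C (y::'a::complex_vector)"
  using scaleC_add_right[of c x "-y"] by (simp add: scaleC_minus_right)

lemma csubspaceD:
  assumes "csubspace V"
  shows csubspace_zero: "0 \<in> V"
    and csubspace_add: "x \<in> V \<Longrightarrow> y \<in> V \<Longrightarrow> x + y \<in> V"
    and csubspace_scaleC: "x \<in> V \<Longrightarrow> c *\<^sub>C x \<in> V"
  using assms unfolding csubspace_def by auto

lemma csubspace_uminus: "csubspace V \<Longrightarrow> x \<in> V \<Longrightarrow> - x \<in> V"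
  using csubspace_scaleC[of V x "-1"] by (simp add: scaleC_minus_one)

lemma csubspace_diff: "csubspace V \<Longrightarrow> x \<in> V \<Longrightarrow> y \<in> V \<Longrightarrow> x - y \<in> V"
  using csubspace_add[of V x "- y"] csubspace_uminus[of V y] by simp

lemma csubspace_scaleR: "csubspace V \<Longrightarrow> x \<in> V \<Longrightarrow> r *\<^sub>R x \<in> V"
  using csubspace_scaleC[of V x r] by (simp add: scaleR_eq_scaleC)

lemma clinear_onD:
  assumes "clinear_on V f"
  shows clinear_on_add: "x \<in> V \<Longrightarrow> y \<in> V \<Longrightarrow> f (x + y) = f x + f y"
    and clinear_on_scaleC: "x \<in> V \<Longrightarrow> f (c *\<^sub>C x) = c *\<^sub>C f x"
  using assms unfolding clinear_on_def by auto

lemma clinear_on_diff: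
  assumes "clinear_on V f" "csubspace V" "x \<in> V" "y \<in> V"
  shows "f (x - y) = f x - f y"
proof -
  have "f (- y) = - f y" using clinear_on_scaleC[OF assms(1,4), of "-1"] by (simp add: scaleC_minus_one)
  then show ?thesis
    using clinear_on_add[OF assms(1,3) csubspace_uminus[OF assms(2,4)]] by simp
qed

lemma csubspace_UNIV [simp]: "csubspace UNIV"
  by (simp add: csubspace_def)

text \<open>The spaces \<open>L\<^sup>2\<close> consist of functions rather than of classes of functions, so definiteness is
  not assumed.\<close>

locale semi_inner =
  fixes V :: "'a::complex_vector set" and ip :: "'a \<Rightarrow> 'a \<Rightarrow> complex"
  assumes csubspace: "csubspace V"
    and ip_add_left: "\<And>x y z. x \<in> V \<Longrightarrow> y \<in> V \<Longrightarrow> z \<in> V \<Longrightarrow> ip (x + y) z = ip x z + ip y z"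
    and ip_scaleC_left: "\<And>c x y. x \<in> V \<Longrightarrow> y \<in> V \<Longrightarrow> ip (c *\<^sub>C x) y = cnj c * ip x y"
    and ip_commute: "\<And>x y. x \<in> V \<Longrightarrow> y \<in> V \<Longrightarrow> ip x y = cnj (ip y x)"
    and ip_nonneg: "\<And>x. x \<in> V \<Longrightarrow> 0 \<le> Re (ip x x)"
begin

lemmas closed_rules [simp, intro] = csubspaceD[OF csubspace] csubspace_uminus[OF csubspace]
  csubspace_diff[OF csubspace] csubspace_scaleR[OF csubspace]

definition q :: "'a \<Rightarrow> real" where "q x = Re (ip x x)"

lemma q_nonneg [simp]: "x \<in> V \<Longrightarrow> 0 \<le> q x"
  by (simp add: q_def ip_nonneg)

lemma Im_ip_self [simp]: "x \<in> V \<Longrightarrow> Im (ip x x) = 0"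
  using ip_commute[of x x] by (simp add: complex_eq_iff)

lemma ip_self: "x \<in> V \<Longrightarrow> ip x x = of_real (q x)"
  by (simp add: q_def complex_eq_iff)

lemma ip_add_right: "x \<in> V \<Longrightarrow> y \<in> V \<Longrightarrow> z \<in> V \<Longrightarrow> ip z (x + y) = ip z x + ip z y"
  using ip_commute[of z] by (simp add: ip_add_left)

lemma ip_scaleC_right: "x \<in> V \<Longrightarrow> y \<in> V \<Longrightarrow> ip y (c *\<^sub>C x) = c * ip y x"
  using ip_commute[of y] by (simp add: ip_scaleC_left)

lemma ip_scaleR_left: "x \<in> V \<Longrightarrow> y \<in> V \<Longrightarrow> ip (r *\<^sub>R x) y = of_real r * ip x y"
  by (simp add: scaleR_eq_scaleC ip_scaleC_left)

lemma ip_scaleR_right: "x \<in> V \<Longrightarrow> y \<in> V \<Longrightarrow> ip y (r *\<^sub>R x) = of_real r * ip y x"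
  by (simp add: scaleR_eq_scaleC ip_scaleC_right)

lemma ip_minus_left: "x \<in> V \<Longrightarrow> y \<in> V \<Longrightarrow> ip (- x) y = - ip x y"
  using ip_scaleC_left[of x y "-1"] by (simp add: scaleC_minus_one)

lemma ip_minus_right: "x \<in> V \<Longrightarrow> y \<in> V \<Longrightarrow> ip y (- x) = - ip y x"
  using ip_scaleC_right[of x y "-1"] by (simp add: scaleC_minus_one)

lemma ip_diff_left: "x \<in> V \<Longrightarrow> y \<in> V \<Longrightarrow> z \<in> V \<Longrightarrow> ip (x - y) z = ip x z - ip y z"
  using ip_add_left[of x "-y" z] by (simp add: ip_minus_left)

lemma ip_diff_right: "x \<in> V \<Longrightarrow> y \<in> V \<Longrightarrow> z \<in> V \<Longrightarrow> ip z (x - y) = ip z x - ip z y"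
  using ip_add_right[of x "-y" z] by (simp add: ip_minus_right)

lemmas ip_simps = ip_add_left ip_add_right ip_scaleC_left ip_scaleC_right ip_scaleR_left
  ip_scaleR_right ip_minus_left ip_minus_right ip_diff_left ip_diff_right

lemma Re_ip_commute: "x \<in> V \<Longrightarrow> y \<in> V \<Longrightarrow> Re (ip y x) = Re (ip x y)"
  using ip_commute[of y x] by simp

lemma q_add: "x \<in> V \<Longrightarrow> y \<in> V \<Longrightarrow> q (x + y) = q x + 2 * Re (ip x y) + q y"
  by (simp add: q_def ip_simps Re_ip_commute)

lemma q_diff: "x \<in> V \<Longrightarrow> y \<in> V \<Longrightarrow> q (x - y) = q x - 2 * Re (ip x y) + q y"
  by (simp add: q_def ip_simps Re_ip_commute)

lemma q_scaleR: "x \<in> V \<Longrightarrow> q (r *\<^sub>R x) = r\<^sup>2 * q x"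
  by (simp add: q_def ip_simps power2_eq_square)

lemma q_scaleC: "x \<in> V \<Longrightarrow> q (c *\<^sub>C x) = (cmod c)\<^sup>2 * q x"
  unfolding cmod_power2 by (simp add: q_def ip_simps power2_eq_square algebra_simps)

text \<open>The quadratic polynomial t -> q (x + t y) is nonnegative. Since \<open>q y\<close> may
  vanish for nonzero y, the degenerate case is separate: an affine function bounded below has slope
  zero.\<close>

lemma Re_ip_le: 
  assumes "x \<in> V" "y \<in> V"
  shows "Re (ip x y) \<le> sqrt (q x) * sqrt (q y)"
proof -
  have quad: "0 \<le> q x + 2 * t * Re (ip x y) + t\<^sup>2 * q y" for t
    using q_nonneg[of "x + t *\<^sub>R y"] assms by (simp add: q_add q_scaleR ip_simps)
  have "(Re (ip x y))\<^sup>2 \<le> q x * q y"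
  proof (cases "q y = 0")
    case True
    have "Re (ip x y) = 0"
    proof (rule ccontr)
      assume "Re (ip x y) \<noteq> 0"
      \<comment> \<open>At this t the affine function takes the value -1.\<close>
      then show False using quad[of "- (q x + 1) / (2 * Re (ip x y))"] True by (simp add: field_simps)
    qed
    with True show ?thesis by simp
  next
    case False
    then have "q y > 0" using q_nonneg[OF assms(2)] by simp
    then show ?thesis using quad[of "- Re (ip x y) / q y"] 
      by (simp add: power2_eq_square field_simps)
  qed
  then have "\<bar>Re (ip x y)\<bar> \<le> sqrt (q x * q y)"
    by (metis real_sqrt_abs real_sqrt_le_iff)
  then show ?thesis by (simp add: real_sqrt_mult)
qed

lemma Cauchy_Schwarz:
  assumes "x \<in> V" "y \<in> V"
  shows "cmod (ip x y) \<le> sqrt (q x) * sqrt (q y)"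
proof (cases "ip x y = 0")
  case True then show ?thesis using assms by simp
next
  case False
  \<comment> \<open>A phase that makes the product real; \<open>ip\<close> is conjugate linear on
    the left, so c itself and not its conjugate multiplies x.\<close>
  define c where "c = ip x y / cmod (ip x y)"
  have c: "cmod c = 1" using False by (simp add: c_def norm_divide)
  have "ip (c *\<^sub>C x) y = cmod (ip x y)"
    using assms False complex_norm_square[of "ip x y"]
    by (simp add: ip_simps c_def power2_eq_square mult.commute divide_eq_eq)
  then have "cmod (ip x y) = Re (ip (c *\<^sub>C x) y)" by simp
  also have "\<dots> \<le> sqrt (q x) * sqrt (q y)"
    using Re_ip_le[of "c *\<^sub>C x" y] assms c by (simp add: q_scaleC)
  finally show ?thesis .
qed

lemma q_triangle:
  assumes "x \<in> V" "y \<in> V"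
  shows "sqrt (q (x + y)) \<le> sqrt (q x) + sqrt (q y)"
proof (rule real_le_lsqrt)
  show "q (x + y) \<le> (sqrt (q x) + sqrt (q y))\<^sup>2"
    using assms Re_ip_le[OF assms] by (simp add: q_add power2_sum)
qed (use assms in auto)

end

text \<open>Completeness is phrased through the squared seminorm rather than a topology of the type;
  limits are determined only up to vectors of seminorm zero.\<close>

locale semi_hilbert = semi_inner +
  assumes complete: "\<And>s. (\<And>n::nat. s n \<in> V) \<Longrightarrow>
      (\<And>e. e > 0 \<Longrightarrow> \<exists>N. \<forall>m\<ge>N. \<forall>n\<ge>N. Re (ip (s m - s n) (s m - s n)) < e) \<Longrightarrow>
      \<exists>h\<in>V. (\<lambda>n. Re (ip (s n - h) (s n - h))) \<longlonglongrightarrow> 0"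
begin

text \<open>The representing vector minimises \<open>q v - 2 Re (\<phi> v)\<close>; minimising sequences are Cauchy by the
  parallelogram law.\<close>

lemma riesz:
  assumes add: "\<And>x y. x \<in> V \<Longrightarrow> y \<in> V \<Longrightarrow> \<phi> (x + y) = \<phi> x + \<phi> y"
    and scale: "\<And>c x. x \<in> V \<Longrightarrow> \<phi> (c *\<^sub>C x) = cnj c * \<phi> x"
    and bound: "\<And>x. x \<in> V \<Longrightarrow> cmod (\<phi> x) \<le> K * sqrt (q x)"
  shows "\<exists>h\<in>V. \<forall>v\<in>V. \<phi> v = ip v h"
proof -
  define f where "f v = q v - 2 * Re (\<phi> v)" for v
  have scaleR: "\<phi> (r *\<^sub>R x) = of_real r * \<phi> x" if "x \<in> V" for r x
    using that by (simp add: scaleR_eq_scaleC scale)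
  have diff: "\<phi> (x - y) = \<phi> x - \<phi> y" if "x \<in> V" "y \<in> V" for x y
    using that add[of x "-y"] scale[of y "-1"] by (simp add: scaleC_minus_one)
  have lower: "- K\<^sup>2 \<le> f v" if "v \<in> V" for v
  proof -
    have "Re (\<phi> v) \<le> K * sqrt (q v)"
      using bound[OF that] complex_Re_le_cmod[of "\<phi> v"] by linarith
    moreover have "0 \<le> (sqrt (q v) - K)\<^sup>2" by simp
    ultimately show ?thesis using that unfolding f_def power2_diff by (simp add: algebra_simps)
  qed
  define I where "I = Inf (f ` V)"
  have bdd: "bdd_below (f ` V)" using lower by (auto intro!: bdd_belowI[of _ "- K\<^sup>2"])
  have I_le: "I \<le> f v" if "v \<in> V" for v
    unfolding I_def using bdd that by (auto intro: cInf_lower)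
  have "\<exists>v\<in>V. f v < I + inverse (Suc n)" for n
    using cInf_lessD[of "f ` V" "I + inverse (Suc n)"] closed_rules(1) unfolding I_def
    by (metis image_iff image_is_empty empty_iff less_add_same_cancel1 inverse_positive_iff_positive of_nat_0_less_iff zero_less_Suc)
  then obtain s where s: "\<And>n. s n \<in> V" "\<And>n. f (s n) < I + inverse (Suc n)" by metis
  have par: "q (x - y) = 2 * f x + 2 * f y - 4 * f ((1/2) *\<^sub>R (x + y))" if "x \<in> V" "y \<in> V" for x y
    using that by (simp add: f_def q_diff q_add q_scaleR scaleR add ip_simps power2_eq_square field_simps)
  have qs: "q (s m - s n) \<le> 2 * inverse (Suc m) + 2 * inverse (Suc n)" for m n
    using par[of "s m" "s n"] s[of m] s[of n] I_le[of "(1/2) *\<^sub>R (s m + s n)"] by simp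
  have "\<exists>h\<in>V. (\<lambda>n. Re (ip (s n - h) (s n - h))) \<longlonglongrightarrow> 0"
  proof (rule complete)
    fix e :: real assume "e > 0"
    then obtain N where N: "inverse (real (Suc N)) < e / 4"
      using reals_Archimedean[of "e/4"] by auto
    have "q (s m - s n) < e" if "m \<ge> N" "n \<ge> N" for m n
    proof -
      have "inverse (real (Suc m)) \<le> inverse (real (Suc N))" "inverse (real (Suc n)) \<le> inverse (real (Suc N))"
        using that by (auto intro!: le_imp_inverse_le)
      then show ?thesis using qs[of m n] N by linarith
    qed
    then show "\<exists>N. \<forall>m\<ge>N. \<forall>n\<ge>N. Re (ip (s m - s n) (s m - s n)) < e"
      unfolding q_def by blast
  qed (rule s)
  then obtain h where h: "h \<in> V" and lim: "(\<lambda>n. q (s n - h)) \<longlonglongrightarrow> 0" by (auto simp: q_def)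
  \<comment> \<open>The minimising sequence converges only in the seminorm; continuity of f with
    respect to it, made explicit by error terms in \<open>sqrt (q (s n - h))\<close>, carries the
    infimum over to h.\<close>
  have fh: "f h \<le> I"
  proof (rule tendsto_le)
    have *: "f h \<le> f (s n) + 2 * sqrt (q h) * sqrt (q (s n - h)) + 2 * K * sqrt (q (s n - h))" for n
    proof -
      have "q (s n) = q h + 2 * Re (ip h (s n - h)) + q (s n - h)"
        using q_add[of h "s n - h"] s h by simp
      moreover have "- Re (ip h (s n - h)) \<le> sqrt (q h) * sqrt (q (s n - h))"
        using Cauchy_Schwarz[of h "s n - h"] abs_Re_le_cmod[of "ip h (s n - h)"] s h by simp
      moreover have "Re (\<phi> (s n)) - Re (\<phi> h) \<le> K * sqrt (q (s n - h))"
        using bound[of "s n - h"] abs_Re_le_cmod[of "\<phi> (s n - h)"] s h by (simp add: diff)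
      moreover have "q (s n - h) \<ge> 0" using s h by simp
      ultimately show ?thesis unfolding f_def by argo
    qed
    then have "f h \<le> I + inverse (Suc n) + 2 * sqrt (q h) * sqrt (q (s n - h)) + 2 * K * sqrt (q (s n - h))" for n
      using s(2)[of n] *[of n] by linarith
    then show "\<forall>\<^sub>F n in sequentially. f h \<le> I + inverse (Suc n) + 2 * sqrt (q h) * sqrt (q (s n - h)) + 2 * K * sqrt (q (s n - h))"
      by simp
    have "(\<lambda>n. sqrt (q (s n - h))) \<longlonglongrightarrow> 0" using tendsto_real_sqrt[OF lim] by simp
    then have "(\<lambda>n. I + inverse (Suc n) + 2 * sqrt (q h) * sqrt (q (s n - h)) + 2 * K * sqrt (q (s n - h)))
       \<longlonglongrightarrow> I + 0 + 2 * sqrt (q h) * 0 + 2 * K * 0"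
      by (intro tendsto_intros LIMSEQ_inverse_real_of_nat)
    then show "(\<lambda>n. I + inverse (Suc n) + 2 * sqrt (q h) * sqrt (q (s n - h)) + 2 * K * sqrt (q (s n - h))) \<longlonglongrightarrow> I"
      by simp
  qed auto
  \<comment> \<open>First variation: f (h + t v) - f h is a quadratic in t with linear coefficient 2
    d that stays nonnegative, so d must vanish.\<close>
  have re: "Re (\<phi> v) = Re (ip v h)" if v: "v \<in> V" for v
  proof (rule ccontr)
    assume ne: "Re (\<phi> v) \<noteq> Re (ip v h)"
    define d where "d = Re (ip v h) - Re (\<phi> v)"
    have quad: "0 \<le> 2 * t * d + t\<^sup>2 * q v" for t
    proof -
      have "f (h + t *\<^sub>R v) = f h + 2 * t * d + t\<^sup>2 * q v"
        using h v by (simp add: f_def q_add q_scaleR add scaleR ip_simps d_def Re_ip_commute[of h v] algebra_simps)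
      then show ?thesis using I_le[of "h + t *\<^sub>R v"] fh h v by simp
    qed
    have d: "d * d > 0" using ne by (auto simp: d_def zero_less_mult_iff)
    show False
    proof (cases "q v = 0")
      case True
      then show False using quad[of "- d"] d by simp
    next
      case False
      then have "q v > 0" using q_nonneg[OF v] by linarith
      then have "2 * (- d / q v) * d + (- d / q v)\<^sup>2 * q v = - (d * d / q v)"
        by (simp add: power2_eq_square field_simps)
      moreover have "d * d / q v > 0" using d \<open>q v > 0\<close> by simp
      ultimately show False using quad[of "- d / q v"] by linarith
    qed
  qed
  have "\<phi> v = ip v h" if v: "v \<in> V" for v
  proof (rule complex_eqI)
    show "Im (\<phi> v) = Im (ip v h)"
      \<comment> \<open>Both sides are conjugate linear in v, so the real part at i v is the
        imaginary part at v.\<close>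
      using re[of "\<i> *\<^sub>C v"] v h by (simp add: scale ip_simps)
  qed (rule re[OF v])
  then show ?thesis using h by blast
qed

text \<open>Riesz is applied for each w separately. Linearity of G is demanded only after pairing
  with w, because an operator on \<open>L2\<close> is additive merely almost everywhere while inner
  products ignore null sets.\<close>

lemma adjoint_exists:
  assumes W: "semi_inner W ipW"
    and maps: "\<And>v. v \<in> V \<Longrightarrow> G v \<in> W"
    and add: "\<And>x y w. x \<in> V \<Longrightarrow> y \<in> V \<Longrightarrow> w \<in> W \<Longrightarrow> ipW (G (x + y)) w = ipW (G x) w + ipW (G y) w"
    and scale: "\<And>c x w. x \<in> V \<Longrightarrow> w \<in> W \<Longrightarrow> ipW (G (c *\<^sub>C x)) w = cnj c * ipW (G x) w"
    and bound: "\<And>x. x \<in> V \<Longrightarrow> sqrt (semi_inner.q ipW (G x)) \<le> K * sqrt (q x)"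
  shows "(\<forall>w\<in>W. adjoint_wrt V ip W ipW G w \<in> V) \<and>
    (\<forall>v\<in>V. \<forall>w\<in>W. ipW (G v) w = ip v (adjoint_wrt V ip W ipW G w))"
proof -
  interpret W: semi_inner W ipW by (rule W)
  have "\<exists>h\<in>V. \<forall>v\<in>V. ipW (G v) w = ip v h" if w: "w \<in> W" for w
  proof (rule riesz)
    fix x assume x: "x \<in> V"
    have "cmod (ipW (G x) w) \<le> sqrt (W.q (G x)) * sqrt (W.q w)"
      using W.Cauchy_Schwarz[OF maps[OF x] w] .
    also have "\<dots> \<le> K * sqrt (q x) * sqrt (W.q w)"
      by (intro mult_right_mono bound x) (use w in simp)
    finally show "cmod (ipW (G x) w) \<le> K * sqrt (W.q w) * sqrt (q x)" by (simp add: ac_simps)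
  qed (use add scale w in auto)
  then obtain H where "\<forall>w\<in>W. H w \<in> V \<and> (\<forall>v\<in>V. ipW (G v) w = ip v (H w))" by metis
  then have "\<exists>H. (\<forall>w\<in>W. H w \<in> V) \<and> (\<forall>v\<in>V. \<forall>w\<in>W. ipW (G v) w = ip v (H w))" by blast
  then show ?thesis unfolding adjoint_wrt_def by (rule someI_ex)
qed

end

section \<open>Hilbert space types and adjoints of bounded operators\<close>

lemma cinner_self: "cinner x x = of_real ((norm x)\<^sup>2)" for x :: "'a::complex_hilbert"
  using cinner_ge_zero[of x] norm_eq_sqrt_cinner[of x]
  by (simp add: less_eq_complex_def complex_eq_iff cmod_def)

lemma semi_hilbert_closed:
  fixes W :: "'a::complex_hilbert set"
  assumes W: "csubspace W" "closed W"
  shows "semi_hilbert W cinner"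
proof
  fix s :: "nat \<Rightarrow> 'a"
  assume s: "\<And>n. s n \<in> W"
    and c: "\<And>e. e > 0 \<Longrightarrow> \<exists>N. \<forall>m\<ge>N. \<forall>n\<ge>N. Re (cinner (s m - s n) (s m - s n)) < e"
  have "Cauchy s"
  proof (rule CauchyI)
    fix e :: real assume "e > 0"
    then obtain N where "\<forall>m\<ge>N. \<forall>n\<ge>N. (norm (s m - s n))\<^sup>2 < e\<^sup>2"
      using c[of "e\<^sup>2"] by (auto simp: cinner_self)
    then show "\<exists>N. \<forall>m\<ge>N. \<forall>n\<ge>N. norm (s m - s n) < e"
      using \<open>e > 0\<close> by (intro exI[of _ N]) (auto intro: power2_less_imp_less)
  qed
  then obtain h where h: "s \<longlonglongrightarrow> h" using Cauchy_convergent convergent_def by blast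
  have "h \<in> W" using W(2) s h closed_sequentially by blast
  moreover have "(\<lambda>n. (norm (s n - h))\<^sup>2) \<longlonglongrightarrow> 0\<^sup>2"
    using h by (intro tendsto_power tendsto_norm_zero) (simp add: LIM_zero_iff)
  ultimately show "\<exists>h\<in>W. (\<lambda>n. Re (cinner (s n - h) (s n - h))) \<longlonglongrightarrow> 0"
    by (auto simp: cinner_self)
qed (use W in \<open>auto simp: cinner_add_left cinner_scaleC_left cinner_self intro: cinner_commute\<close>)

interpretation ch: semi_hilbert UNIV "cinner :: 'a::complex_hilbert \<Rightarrow> 'a \<Rightarrow> complex"
  rewrites "semi_inner.q (cinner :: 'a::complex_hilbert \<Rightarrow> 'a \<Rightarrow> complex) = (\<lambda>x. (norm x)\<^sup>2)"
proof -
  show *: "semi_hilbert UNIV (cinner :: 'a::complex_hilbert \<Rightarrow> 'a \<Rightarrow> complex)"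
    by (rule semi_hilbert_closed) auto
  show "semi_inner.q (cinner :: 'a::complex_hilbert \<Rightarrow> 'a \<Rightarrow> complex) = (\<lambda>x. (norm x)\<^sup>2)"
    using semi_inner.q_def[OF semi_hilbert.axioms(1)[OF *]] by (auto simp: cinner_self)
qed

lemma q_cinner [simp]: "semi_inner.q cinner x = (norm x)\<^sup>2" for x :: "'a::complex_hilbert"
  using semi_inner.q_def[OF ch.semi_inner_axioms, of x] by (simp add: cinner_self)

lemmas cinner_simps = ch.ip_simps[simplified]

lemma norm_cinner_le: "cmod (cinner x y) \<le> norm x * norm y" for x y :: "'a::complex_hilbert"
  using ch.Cauchy_Schwarz[of x y] by simp

lemma bounded_bilinear_cinner: "bounded_bilinear (cinner :: 'a::complex_hilbert \<Rightarrow> 'a \<Rightarrow> complex)"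
  by standard (auto simp: cinner_simps scaleR_conv_of_real intro!: exI[of _ 1] norm_cinner_le)

lemma cinner_zero_left [simp]: "cinner 0 y = 0" and cinner_zero_right [simp]: "cinner y 0 = 0"
  for y :: "'a::complex_hilbert"
  using bounded_bilinear.zero_left[OF bounded_bilinear_cinner]
    bounded_bilinear.zero_right[OF bounded_bilinear_cinner] by auto

lemma cinner_eqI:
  fixes x y :: "'a::complex_hilbert"
  assumes "\<And>z. cinner z x = cinner z y"
  shows "x = y"
  using assms[of "x - y"] cinner_eq_zero_iff[of "x - y"] by (simp add: cinner_simps)

text \<open>The projection of x is the Riesz representative, within W, of v -> <v, x>.\<close>

lemma orthogonal_projection:
  fixes W :: "'a::complex_hilbert set"
  assumes "csubspace W" "closed W"
  shows "\<exists>w\<in>W. \<forall>v\<in>W. cinner v (x - w) = 0"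
proof -
  interpret W: semi_hilbert W cinner using assms by (rule semi_hilbert_closed)
  have "\<exists>h\<in>W. \<forall>v\<in>W. cinner v x = cinner v h"
    by (rule W.riesz[where K = "norm x"])
       (auto simp: cinner_simps W.q_def cinner_self norm_cinner_le mult.commute)
  then show ?thesis by (auto simp: cinner_simps)
qed

lemma bounded_clinearE:
  assumes "bounded_clinear f"
  obtains K where "K \<ge> 0" "\<And>x. norm (f x) \<le> K * norm x"
proof -
  from assms obtain K where K: "\<And>x. norm (f x) \<le> K * norm x"
    unfolding bounded_clinear_def bounded_on_def by auto
  have "norm (f x) \<le> max K 0 * norm x" for x
    using K[of x] mult_right_mono[of K "max K 0" "norm x"] by simp
  with that[of "max K 0"] show ?thesis by auto
qed

lemma bounded_clinear_simps:
  assumes "bounded_clinear f"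
  shows bounded_clinear_add: "f (x + y) = f x + f y"
    and bounded_clinear_scaleC: "f (c *\<^sub>C x) = c *\<^sub>C f x"
    and bounded_clinear_diff: "f (x - y) = f x - f y"
  using assms clinear_on_diff[of UNIV f x y] unfolding bounded_clinear_def clinear_on_def by auto

lemma bounded_clinear_bounded_linear:
  assumes "bounded_clinear f" shows "bounded_linear f"
proof -
  obtain K where "\<And>x. norm (f x) \<le> K * norm x" using bounded_clinearE[OF assms] by blast
  then show ?thesis
    by (intro bounded_linear_intro[where K = K])
       (auto simp: bounded_clinear_simps[OF assms] scaleR_eq_scaleC mult.commute)
qed

lemma cadjoint:
  fixes G :: "'a::complex_hilbert \<Rightarrow> 'b::complex_hilbert"
  assumes "bounded_clinear G"
  shows "cinner (G v) w = cinner v (cadjoint G w)"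
proof -
  obtain K where K: "K \<ge> 0" "\<And>x. norm (G x) \<le> K * norm x" using bounded_clinearE[OF assms] by blast
  show ?thesis
    using ch.adjoint_exists[OF ch.semi_inner_axioms, of G K] K
    by (auto simp: cadjoint_def bounded_clinear_simps[OF assms] cinner_simps)
qed

text \<open>Test with the vector itself: |G* w|^2 = <G G* w, w> <= K |G* w| |w|, then cancel |G*
  w|.\<close>

lemma norm_cadjoint_le:
  fixes G :: "'a::complex_hilbert \<Rightarrow> 'b::complex_hilbert"
  assumes "bounded_clinear G" and K: "\<And>x. norm (G x) \<le> K * norm x" and "K \<ge> 0"
  shows "norm (cadjoint G w) \<le> K * norm w"
proof -
  let ?a = "cadjoint G w"
  have "of_real ((norm ?a)\<^sup>2) = cinner (G ?a) w"
    by (simp only: cadjoint[OF assms(1)] cinner_self)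
  then have "(norm ?a)\<^sup>2 = cmod (cinner (G ?a) w)"
    by (metis abs_of_nonneg norm_of_real zero_le_power2)
  also have "\<dots> \<le> K * norm ?a * norm w"
    by (rule order_trans[OF norm_cinner_le mult_right_mono[OF K]]) simp
  finally have *: "norm ?a * norm ?a \<le> norm ?a * (K * norm w)" by (simp add: power2_eq_square ac_simps)
  show ?thesis
  proof (cases "norm ?a = 0")
    case True
    then show ?thesis using \<open>K \<ge> 0\<close> by simp
  next
    case False
    then show ?thesis using * by (simp only: mult_le_cancel_left) auto
  qed
qed

lemma cadjoint_diff:
  fixes G H :: "'a::complex_hilbert \<Rightarrow> 'b::complex_hilbert"
  assumes "bounded_clinear G" "bounded_clinear H" "bounded_clinear (\<lambda>x. G x - H x)"
  shows "cadjoint (\<lambda>x. G x - H x) w = cadjoint G w - cadjoint H w"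
  by (rule cinner_eqI) (simp add: cinner_simps flip: assms[THEN cadjoint])

lemma cadjoint_diff_right:
  fixes G :: "'a::complex_hilbert \<Rightarrow> 'b::complex_hilbert"
  assumes "bounded_clinear G"
  shows "cadjoint G (v - w) = cadjoint G v - cadjoint G w"
  by (rule cinner_eqI) (simp add: cinner_simps flip: assms[THEN cadjoint])

section \<open>Strong measurability\<close>

lemma complete_measure_lebesgue_on:
  assumes "S \<in> sets lebesgue"
  shows "complete_measure (lebesgue_on S)"
proof
  fix A B assume "B \<subseteq> A" "A \<in> null_sets (lebesgue_on S)"
  then have "A \<subseteq> S" "A \<in> null_sets lebesgue" using assms by (auto simp: null_sets_restrict_space)
  then have "B \<in> null_sets (lebesgue_on S)"
    using \<open>B \<subseteq> A\<close> assms completion.complete2[of B A lborel] by (auto simp: null_sets_restrict_space)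
  then show "B \<in> sets (lebesgue_on S)" by auto
qed

lemma (in complete_measure) borel_measurable_AE_cong:
  assumes f: "f \<in> borel_measurable M" and ae: "AE x in M. f x = g x"
  shows "g \<in> borel_measurable M"
proof (rule measurableI)
  fix B :: "'b set" assume B: "B \<in> sets borel"
  show "g -` B \<inter> space M \<in> sets M"
  proof (rule in_sets_AE)
    show "f -` B \<inter> space M \<in> sets M" using f B by (rule measurable_sets)
    show "AE x in M. (x \<in> f -` B \<inter> space M) = (x \<in> g -` B \<inter> space M)"
      using ae by eventually_elim auto
  qed auto
qed auto

lemma (in complete_measure) borel_measurable_AE_limit:
  fixes f :: "'a \<Rightarrow> 'b::{second_countable_topology, real_normed_vector}"
  assumes s: "\<And>n. s n \<in> borel_measurable M" and ae: "AE x in M. (\<lambda>n. s n x) \<longlonglongrightarrow> f x"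
  shows "f \<in> borel_measurable M"
proof -
  from ae obtain N where N: "{x \<in> space M. \<not> (\<lambda>n. s n x) \<longlonglongrightarrow> f x} \<subseteq> N"
    "N \<in> sets M" "emeasure M N = 0"
    by (rule AE_E)
  \<comment> \<open>Overwriting by 0 on the null set turns a.e. convergence into convergence
    everywhere; completeness of the measure undoes the change.\<close>
  define g where "g x = (if x \<in> N then 0 else f x)" for x
  have "g \<in> borel_measurable M"
  proof (rule borel_measurable_LIMSEQ_metric)
    show "(\<lambda>x. if x \<in> N then 0 else s n x) \<in> borel_measurable M" for n
      using s N(2) by (intro measurable_If_set) auto
    show "(\<lambda>n. if x \<in> N then 0 else s n x) \<longlonglongrightarrow> g x" if "x \<in> space M" for x
      using that N(1) by (auto simp: g_def)
  qed
  moreover have "AE x in M. g x = f x"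
    using AE_not_in[of N M] N by (auto simp: g_def null_sets_def)
  ultimately show ?thesis by (rule borel_measurable_AE_cong)
qed

abbreviation LM :: "real \<Rightarrow> real measure" where "LM T \<equiv> lebesgue_on {0..T}"

interpretation LM: complete_measure "LM T" for T
  by (rule complete_measure_lebesgue_on) simp

interpretation LM: finite_measure "LM T" for T
  by (rule finite_measure_lebesgue_on) simp

lemma simple_function_strongly_measurable:
  "simple_function (LM T) f \<Longrightarrow> strongly_measurable T f"
  unfolding strongly_measurable_def by (rule exI[of _ "\<lambda>n. f"]) auto

text \<open>A map applied to two simple functions gives a simple function, and joint continuity
  carries the limits along, so the argument works for non-separable value spaces.\<close>

lemma strongly_measurable_compose2:
  assumes "strongly_measurable T f" "strongly_measurable T g"
    and h: "continuous_on UNIV (\<lambda>p. h (fst p) (snd p))"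
  shows "strongly_measurable T (\<lambda>t. h (f t) (g t))"
proof -
  obtain a b where ab: "\<And>n::nat. simple_function (LM T) (a n)" "\<And>n::nat. simple_function (LM T) (b n)"
    and lim: "AE t in LM T. (\<lambda>n. a n t) \<longlonglongrightarrow> f t" "AE t in LM T. (\<lambda>n. b n t) \<longlonglongrightarrow> g t"
    using assms(1,2) unfolding strongly_measurable_def by blast
  have "AE t in LM T. (\<lambda>n. h (a n t) (b n t)) \<longlonglongrightarrow> h (f t) (g t)"
    using lim
  proof eventually_elim
    case (elim t)
    then have "(\<lambda>n. (a n t, b n t)) \<longlonglongrightarrow> (f t, g t)" by (rule tendsto_Pair)
    from continuous_on_tendsto_compose[OF h this] show ?case by simp
  qed
  then show ?thesis unfolding strongly_measurable_def
    using simple_function_compose2[OF ab, where h = h] by (intro exI[of _ "\<lambda>n t. h (a n t) (b n t)"]) auto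
qed

lemma strongly_measurable_compose:
  assumes "strongly_measurable T f" and h: "continuous_on UNIV h"
  shows "strongly_measurable T (\<lambda>t. h (f t))"
  by (rule strongly_measurable_compose2[OF assms(1,1), where h = "\<lambda>x y. h x"])
     (auto intro!: continuous_intros continuous_on_compose2[OF h])

lemma strongly_measurable_bilinear:
  assumes "strongly_measurable T f" "strongly_measurable T g" and h: "bounded_bilinear h"
  shows "strongly_measurable T (\<lambda>t. h (f t) (g t))"
  using assms(1,2)
  by (rule strongly_measurable_compose2) (intro bounded_bilinear.continuous_on[OF h] continuous_intros)

lemma strongly_measurable_add:
  "strongly_measurable T f \<Longrightarrow> strongly_measurable T g \<Longrightarrow> strongly_measurable T (\<lambda>t. f t + g t)"
  by (erule (1) strongly_measurable_compose2) (intro continuous_intros)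

lemma bounded_linear_scaleC: "bounded_linear (\<lambda>x::'a::complex_normed_vector. c *\<^sub>C x)"
  by (rule bounded_linear_intro[where K = "cmod c"])
     (auto simp: scaleC_add_right scaleR_eq_scaleC scaleC_scaleC mult.commute norm_scaleC)

lemma strongly_measurable_scaleC:
  "strongly_measurable T f \<Longrightarrow> strongly_measurable T (\<lambda>t. c *\<^sub>C (f t :: 'a::complex_normed_vector))"
  by (erule strongly_measurable_compose)
     (intro linear_continuous_on bounded_linear_scaleC)

text \<open>The bridge to Borel measurability. It is applied to real and complex quantities, namely
  norms and inner products, rather than to the vector-valued functions themselves.\<close>

lemma strongly_measurable_borel:
  fixes f :: "real \<Rightarrow> 'b::{second_countable_topology, real_normed_vector}"
  assumes "strongly_measurable T f"
  shows "f \<in> borel_measurable (LM T)"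
proof -
  obtain s where s: "\<And>n::nat. simple_function (LM T) (s n)"
    and lim: "AE t in LM T. (\<lambda>n. s n t) \<longlonglongrightarrow> f t"
    using assms unfolding strongly_measurable_def by blast
  from borel_measurable_simple_function[OF s] lim show ?thesis
    by (rule LM.borel_measurable_AE_limit)
qed

lemma strongly_measurable_norm:
  "strongly_measurable T f \<Longrightarrow> (\<lambda>t. norm (f t)) \<in> borel_measurable (LM T)"
  by (intro strongly_measurable_borel) (erule strongly_measurable_compose, intro continuous_intros)

lemma strongly_measurable_AE_cong:
  assumes "strongly_measurable T f" "AE t in LM T. f t = g t"
  shows "strongly_measurable T g"
proof -
  obtain s where s: "\<And>n::nat. simple_function (LM T) (s n)" and "AE t in LM T. (\<lambda>n. s n t) \<longlonglongrightarrow> f t"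
    using assms(1) unfolding strongly_measurable_def by blast
  then have "AE t in LM T. (\<lambda>n. s n t) \<longlonglongrightarrow> g t"
    using assms(2) by auto
  with s show ?thesis unfolding strongly_measurable_def by blast
qed

text \<open>Sampling f on a grid of width 1 / (n + 1) gives functions with finitely many
  values.\<close>

lemma continuous_strongly_measurable:
  assumes f: "continuous_on {0..T} f"
  shows "strongly_measurable T f"
proof -
  \<comment> \<open>Rounding t down to the grid; clipping to [0, T] keeps the sample point where f
    is continuous.\<close>
  define p where "p n t = max 0 (min T (\<lfloor>real (Suc n) * t\<rfloor> / Suc n))" for n t
  have simple: "simple_function (LM T) (p n)" for n
  proof (rule simple_function_borel_measurable)
    have "p n \<in> borel_measurable borel" unfolding p_def by measurable
    then have "p n \<in> borel_measurable lebesgue" by (intro measurable_completion) simp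
    then show "p n \<in> borel_measurable (LM T)" by (rule measurable_restrict_space1)
    have "p n ` space (LM T) \<subseteq> (\<lambda>k. max 0 (min T (real_of_int k / Suc n))) ` {0..\<lfloor>real (Suc n) * T\<rfloor>}"
      by (auto simp: p_def intro!: imageI floor_mono mult_left_mono)
    then show "finite (p n ` space (LM T))" by (rule finite_subset) simp
  qed
  have lim: "(\<lambda>n. p n t) \<longlonglongrightarrow> t" if "t \<in> {0..T}" for t
  proof -
    have "(\<lambda>n. real_of_int \<lfloor>real (Suc n) * t\<rfloor> / Suc n) \<longlonglongrightarrow> t"
    proof (rule real_tendsto_sandwich)
      show "(\<lambda>n. t - inverse (real (Suc n))) \<longlonglongrightarrow> t"
        using tendsto_diff[OF tendsto_const LIMSEQ_inverse_real_of_nat, of t] by simp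
      have "t - inverse (real (Suc n)) \<le> real_of_int \<lfloor>real (Suc n) * t\<rfloor> / Suc n" for n
      proof -
        have "real (Suc n) * t - 1 \<le> real_of_int \<lfloor>real (Suc n) * t\<rfloor>" by linarith
        then have "(real (Suc n) * t - 1) / Suc n \<le> real_of_int \<lfloor>real (Suc n) * t\<rfloor> / Suc n"
          by (rule divide_right_mono) simp
        then show ?thesis by (simp add: diff_divide_distrib inverse_eq_divide)
      qed
      then show "\<forall>\<^sub>F n in sequentially. t - inverse (real (Suc n)) \<le> real_of_int \<lfloor>real (Suc n) * t\<rfloor> / Suc n"
        by simp
      have "real_of_int \<lfloor>real (Suc n) * t\<rfloor> / Suc n \<le> t" for n
        using of_int_floor_le[of "real (Suc n) * t"] by (simp add: divide_le_eq mult.commute)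
      then show "\<forall>\<^sub>F n in sequentially. real_of_int \<lfloor>real (Suc n) * t\<rfloor> / Suc n \<le> t" by simp
    qed simp
    then have "(\<lambda>n. p n t) \<longlonglongrightarrow> max 0 (min T t)"
      unfolding p_def by (intro tendsto_max tendsto_min tendsto_const)
    then show ?thesis using that by simp
  qed
  have "(\<lambda>n. f (p n t)) \<longlonglongrightarrow> f t" if "t \<in> {0..T}" for t
    using that by (intro continuous_on_tendsto_compose[OF f lim]) (auto simp: p_def)
  then show ?thesis unfolding strongly_measurable_def
    using simple_function_compose1[OF simple, where g = f]
    by (intro exI[of _ "\<lambda>n t. f (p n t)"]) auto
qed

section \<open>The spaces of square integrable functions\<close>

lemma L2_strongly_measurable: "f \<in> L2 T \<Longrightarrow> strongly_measurable T f"
  and L2_integrable: "f \<in> L2 T \<Longrightarrow> integrable (LM T) (\<lambda>t. (norm (f t))\<^sup>2)"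
  by (auto simp: L2_def)

lemma L2I:
  assumes f: "strongly_measurable T f" and g: "integrable (LM T) g"
    and le: "AE t in LM T. (norm (f t))\<^sup>2 \<le> g t"
  shows "f \<in> L2 T"
proof -
  have "integrable (LM T) (\<lambda>t. (norm (f t))\<^sup>2)"
  proof (rule Bochner_Integration.integrable_bound[OF g])
    show "(\<lambda>t. (norm (f t))\<^sup>2) \<in> borel_measurable (LM T)"
      using strongly_measurable_norm[OF f] by measurable
    show "AE t in LM T. norm ((norm (f t))\<^sup>2) \<le> norm (g t)"
      using le by eventually_elim auto
  qed
  with f show ?thesis by (simp add: L2_def)
qed

lemma L2_bound:
  assumes f: "strongly_measurable T f" and g: "g \<in> L2 T"
    and le: "AE t in LM T. norm (f t) \<le> K * norm (g t)"
  shows "f \<in> L2 T"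
proof (rule L2I[OF f])
  show "integrable (LM T) (\<lambda>t. K\<^sup>2 * (norm (g t))\<^sup>2)" using L2_integrable[OF g] by simp
  show "AE t in LM T. (norm (f t))\<^sup>2 \<le> K\<^sup>2 * (norm (g t))\<^sup>2"
    using le by eventually_elim (simp add: power_mult_distrib[symmetric] power_mono)
qed

lemma L2_AE_cong: "f \<in> L2 T \<Longrightarrow> AE t in LM T. f t = g t \<Longrightarrow> g \<in> L2 T"
  by (rule L2_bound[of T g f 1]) (auto intro: strongly_measurable_AE_cong L2_strongly_measurable)

lemma L2_add: 
  assumes "f \<in> L2 T" "g \<in> L2 T"
  shows "(\<lambda>t. f t + g t) \<in> L2 T"
proof (rule L2I)
  show "strongly_measurable T (\<lambda>t. f t + g t)"
    using assms by (intro strongly_measurable_add L2_strongly_measurable)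
  show "integrable (LM T) (\<lambda>t. 2 * (norm (f t))\<^sup>2 + 2 * (norm (g t))\<^sup>2)"
    using assms[THEN L2_integrable] by simp
  show "AE t in LM T. (norm (f t + g t))\<^sup>2 \<le> 2 * (norm (f t))\<^sup>2 + 2 * (norm (g t))\<^sup>2"
  proof (rule AE_I2)
    fix t
    have "(norm (f t + g t))\<^sup>2 \<le> (norm (f t) + norm (g t))\<^sup>2"
      by (rule power_mono[OF norm_triangle_ineq]) simp
    also have "\<dots> \<le> 2 * (norm (f t))\<^sup>2 + 2 * (norm (g t))\<^sup>2"
      using sum_squares_bound[of "norm (f t)" "norm (g t)"] by (simp add: power2_sum)
    finally show "(norm (f t + g t))\<^sup>2 \<le> 2 * (norm (f t))\<^sup>2 + 2 * (norm (g t))\<^sup>2" .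
  qed
qed

lemma L2_scaleC: 
  fixes f :: "real \<Rightarrow> 'a::complex_normed_vector"
  assumes "f \<in> L2 T"
  shows "(\<lambda>t. c *\<^sub>C f t) \<in> L2 T"
  by (rule L2_bound[OF _ assms, of _ "cmod c"])
     (use assms in \<open>auto simp: norm_scaleC intro: strongly_measurable_scaleC L2_strongly_measurable\<close>)

lemma zero_L2: "(\<lambda>t. 0) \<in> L2 T"
  by (auto simp: L2_def intro: simple_function_strongly_measurable)

lemma csubspace_L2: "csubspace (L2 T :: (real \<Rightarrow> 'a::complex_normed_vector) set)"
  by (auto simp: csubspace_def plus_fun_def scaleC_fun_def zero_fun_def zero_L2 L2_add L2_scaleC)

lemma integrable_L2_cinner:
  fixes f g :: "real \<Rightarrow> 'a::complex_hilbert"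
  assumes "f \<in> L2 T" "g \<in> L2 T"
  shows "integrable (LM T) (\<lambda>t. cinner (f t) (g t))"
proof (rule Bochner_Integration.integrable_bound)
  show "integrable (LM T) (\<lambda>t. (norm (f t))\<^sup>2 + (norm (g t))\<^sup>2)"
    using assms[THEN L2_integrable] by simp
  show "(\<lambda>t. cinner (f t) (g t)) \<in> borel_measurable (LM T)"
    using assms by (intro strongly_measurable_borel strongly_measurable_bilinear[OF _ _ bounded_bilinear_cinner]
      L2_strongly_measurable)
  show "AE t in LM T. norm (cinner (f t) (g t)) \<le> norm ((norm (f t))\<^sup>2 + (norm (g t))\<^sup>2)"
  proof (rule AE_I2)
    fix t
    have "2 * (norm (f t) * norm (g t)) \<le> (norm (f t))\<^sup>2 + (norm (g t))\<^sup>2"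
      using sum_squares_bound[of "norm (f t)" "norm (g t)"] by simp
    then show "norm (cinner (f t) (g t)) \<le> norm ((norm (f t))\<^sup>2 + (norm (g t))\<^sup>2)"
      using norm_cinner_le[of "f t" "g t"] by simp
        (smt (verit) mult_nonneg_nonneg norm_ge_zero)
  qed
qed

lemma L2_cinner_AE_cong:
  fixes f g :: "real \<Rightarrow> 'a::complex_hilbert"
  assumes "f \<in> L2 T" "g \<in> L2 T" "AE t in LM T. f t = f' t" "AE t in LM T. g t = g' t"
  shows "L2_cinner T f' g' = L2_cinner T f g"
  unfolding L2_cinner_def
proof (rule integral_cong_AE)
  show "AE t in LM T. cinner (f' t) (g' t) = cinner (f t) (g t)" using assms(3,4) by auto
  show "(\<lambda>t. cinner (f' t) (g' t)) \<in> borel_measurable (LM T)"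
    using assms by (intro borel_measurable_integrable integrable_L2_cinner) (auto intro: L2_AE_cong)
qed (use assms in \<open>auto intro: borel_measurable_integrable integrable_L2_cinner\<close>)

lemma L2_cinner_self: "L2_cinner T f f = of_real (\<integral>t. (norm (f t))\<^sup>2 \<partial>LM T)"
  for f :: "real \<Rightarrow> 'a::complex_hilbert"
  by (simp add: L2_cinner_def cinner_self del: of_real_power)

lemma semi_inner_L2: "semi_inner (L2 T) (L2_cinner T :: (real \<Rightarrow> 'a::complex_hilbert) \<Rightarrow> _)"
proof
  fix f g h :: "real \<Rightarrow> 'a" and c
  assume [simp]: "f \<in> L2 T" "g \<in> L2 T"
  note [simp] = integrable_L2_cinner
  show "L2_cinner T (c *\<^sub>C f) g = cnj c * L2_cinner T f g"
    by (simp add: L2_cinner_def scaleC_fun_def cinner_simps)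
  have "L2_cinner T f g = (\<integral>t. cnj (cinner (g t) (f t)) \<partial>LM T)"
    unfolding L2_cinner_def by (rule Bochner_Integration.integral_cong[OF refl cinner_commute])
  then show "L2_cinner T f g = cnj (L2_cinner T g f)" by (simp add: L2_cinner_def)
  assume [simp]: "h \<in> L2 T"
  show "L2_cinner T (f + g) h = L2_cinner T f h + L2_cinner T g h"
    by (simp add: L2_cinner_def cinner_simps)
qed (auto simp: csubspace_L2 L2_cinner_self)

lemma q_L2: "semi_inner.q (L2_cinner T) f = (\<integral>t. (norm (f t))\<^sup>2 \<partial>LM T)"
  for f :: "real \<Rightarrow> 'a::complex_hilbert"
  by (simp add: semi_inner.q_def[OF semi_inner_L2] L2_cinner_self)

lemma L2_norm_eq: "L2_norm T f = sqrt (semi_inner.q (L2_cinner T) f)"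
  for f :: "real \<Rightarrow> 'a::complex_hilbert"
  by (simp add: q_L2 L2_norm_def)

lemma L2_norm_zero_AE:
  fixes f :: "real \<Rightarrow> 'a::real_normed_vector"
  assumes "f \<in> L2 T" "(\<integral>t. (norm (f t))\<^sup>2 \<partial>LM T) = 0"
  shows "AE t in LM T. f t = 0"
  using integral_nonneg_eq_0_iff_AE[OF L2_integrable[OF assms(1)]] assms(2) by simp

text \<open>The given simple functions converge a.e. but without domination. They are cut off
  against scalar simple functions that approximate the norm of f, which makes dominated convergence
  applicable.\<close>

lemma L2_simple_approx:
  fixes f :: "real \<Rightarrow> 'a::real_normed_vector"
  assumes f: "f \<in> L2 T" and "e > 0"
  obtains s where "simple_function (LM T) s" "s \<in> L2 T" "(\<integral>t. (norm (f t - s t))\<^sup>2 \<partial>LM T) < e"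
proof -
  obtain a where a: "\<And>n::nat. simple_function (LM T) (a n)" and lim: "AE t in LM T. (\<lambda>n. a n t) \<longlonglongrightarrow> f t"
    using L2_strongly_measurable[OF f] unfolding strongly_measurable_def by blast
  have nf: "(\<lambda>t. norm (f t)) \<in> borel_measurable (LM T)"
    using strongly_measurable_norm L2_strongly_measurable[OF f] .
  obtain b where "(\<forall>n. simple_function (LM T) (b n)) \<and>
    (\<forall>t\<in>space (LM T). (\<lambda>n. b n t) \<longlonglongrightarrow> norm (f t)) \<and>
    (\<forall>n. \<forall>t\<in>space (LM T). dist (b n t) 0 \<le> 2 * dist (norm (f t)) 0)"
    using borel_measurable_implies_sequence_metric[OF nf, of 0] by blast
  then have b: "\<And>n. simple_function (LM T) (b n)"
    "\<And>t. t \<in> space (LM T) \<Longrightarrow> (\<lambda>n. b n t) \<longlonglongrightarrow> norm (f t)"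
    "\<And>n t. t \<in> space (LM T) \<Longrightarrow> \<bar>b n t\<bar> \<le> 2 * norm (f t)"
    by (auto simp: dist_norm simp del: space_lebesgue_on)
  \<comment> \<open>\<open>b n\<close> is at most twice the norm of f, so \<open>s n\<close> is at
    most four times it. Where f t is nonzero, twice |b n t| minus the norm of a n t tends to the
    norm of f t, so the cut-off is eventually inactive.\<close>
  define s where "s n t = (if norm (a n t) \<le> 2 * \<bar>b n t\<bar> then a n t else 0)" for n t
  have simple: "simple_function (LM T) (s n)" for n
    unfolding s_def using simple_function_compose2[OF a b(1), where h = "\<lambda>x y. if norm x \<le> 2 * \<bar>y\<bar> then x else 0"] .
  have bound: "norm (s n t) \<le> 4 * norm (f t)" if "t \<in> space (LM T)" for n t
    using b(3)[OF that, of n] by (simp add: s_def)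
  have sL2: "s n \<in> L2 T" for n
    by (rule L2_bound[OF simple_function_strongly_measurable[OF simple] f AE_I2[OF bound]])
  have lims: "AE t in LM T. (\<lambda>n. s n t) \<longlonglongrightarrow> f t"
    using lim AE_space
  proof eventually_elim
    case (elim t)
    show ?case
    proof (cases "f t = 0")
      case True
      then have "s n t = 0" for n using bound[OF elim(2), of n] by simp
      then show ?thesis using True by simp
    next
      case False
      have "(\<lambda>n. 2 * \<bar>b n t\<bar> - norm (a n t)) \<longlonglongrightarrow> 2 * \<bar>norm (f t)\<bar> - norm (f t)"
        using elim b(2)[OF elim(2)] by (intro tendsto_intros)
      then have "\<forall>\<^sub>F n in sequentially. 2 * \<bar>b n t\<bar> - norm (a n t) > 0"
        using False by (intro order_tendstoD(1)) auto
      then have "\<forall>\<^sub>F n in sequentially. a n t = s n t"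
        by eventually_elim (auto simp: s_def)
      with elim(1) show ?thesis using tendsto_cong[of "\<lambda>n. a n t" "\<lambda>n. s n t"] by blast
    qed
  qed
  have meas: "strongly_measurable T (\<lambda>t. f t - s n t)" for n
    by (rule strongly_measurable_compose2[where h = "\<lambda>x y. x - y"])
       (auto intro!: L2_strongly_measurable f sL2 continuous_intros)
  have "(\<lambda>n. \<integral>t. (norm (f t - s n t))\<^sup>2 \<partial>LM T) \<longlonglongrightarrow> (\<integral>t. 0 \<partial>LM T)"
  proof (rule integral_dominated_convergence)
    \<comment> \<open>25 is the square of 1 + 4: the norm of f t - s n t is at most norm (f t) + 4
      norm (f t).\<close>
    show "integrable (LM T) (\<lambda>t. 25 * (norm (f t))\<^sup>2)" using L2_integrable[OF f] by simp
    show "(\<lambda>t. (norm (f t - s n t))\<^sup>2) \<in> borel_measurable (LM T)" for n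
      using strongly_measurable_norm[OF meas] by measurable
    show "AE t in LM T. (\<lambda>n. (norm (f t - s n t))\<^sup>2) \<longlonglongrightarrow> 0"
      using lims
    proof eventually_elim
      case (elim t)
      then have "(\<lambda>n. (norm (f t - s n t))\<^sup>2) \<longlonglongrightarrow> (norm (f t - f t))\<^sup>2" by (intro tendsto_intros)
      then show ?case by simp
    qed
    show "AE t in LM T. norm ((norm (f t - s n t))\<^sup>2) \<le> 25 * (norm (f t))\<^sup>2" for n
    proof (rule AE_I2)
      fix t assume "t \<in> space (LM T)"
      then have "norm (f t - s n t) \<le> 5 * norm (f t)"
        using norm_triangle_ineq4[of "f t" "s n t"] bound[of t n] by simp
      then have "(norm (f t - s n t))\<^sup>2 \<le> (5 * norm (f t))\<^sup>2" by (rule power_mono) simp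
      then show "norm ((norm (f t - s n t))\<^sup>2) \<le> 25 * (norm (f t))\<^sup>2" by (simp add: power_mult_distrib)
    qed
  qed simp
  then have "\<forall>\<^sub>F n in sequentially. (\<integral>t. (norm (f t - s n t))\<^sup>2 \<partial>LM T) < e"
    using \<open>e > 0\<close> by (intro order_tendstoD(2)) auto
  then obtain n where "(\<integral>t. (norm (f t - s n t))\<^sup>2 \<partial>LM T) < e"
    by (auto simp: eventually_sequentially)
  with that simple sL2 show ?thesis by blast
qed

lemma L2_diff: "f \<in> L2 T \<Longrightarrow> g \<in> L2 T \<Longrightarrow> (\<lambda>t. f t - g t :: 'a::complex_hilbert) \<in> L2 T"
  using csubspace_diff[OF csubspace_L2, of f T g] by (simp add: fun_diff_def)

text \<open>Square integrability of the limit has to be part of the conclusion, since the integral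
  of a non-integrable function is 0 and would bound nothing; hence the detour through the extended
  nonnegative integral.\<close>

lemma L2_Fatou:
  fixes f :: "real \<Rightarrow> 'a::real_normed_vector"
  assumes f: "strongly_measurable T f" and g: "\<And>n. g n \<in> L2 T"
    and lim: "AE t in LM T. (\<lambda>n. g n t) \<longlonglongrightarrow> f t"
    and bound: "\<forall>\<^sub>F n in sequentially. (\<integral>t. (norm (g n t))\<^sup>2 \<partial>LM T) \<le> C"
    and C: "C \<ge> 0"
  shows "f \<in> L2 T \<and> (\<integral>t. (norm (f t))\<^sup>2 \<partial>LM T) \<le> C"
proof -
  have nf: "(\<lambda>t. norm (f t)) \<in> borel_measurable (LM T)" by (rule strongly_measurable_norm[OF f])
  have ng: "(\<lambda>t. norm (g n t)) \<in> borel_measurable (LM T)" for n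
    by (rule strongly_measurable_norm[OF L2_strongly_measurable[OF g]])
  have "(\<integral>\<^sup>+t. ennreal ((norm (f t))\<^sup>2) \<partial>LM T) = (\<integral>\<^sup>+t. liminf (\<lambda>n. ennreal ((norm (g n t))\<^sup>2)) \<partial>LM T)"
    using lim
    by (intro nn_integral_cong_AE, eventually_elim)
       (intro lim_imp_Liminf[symmetric] tendsto_ennrealI tendsto_intros sequentially_bot)
  also have "\<dots> \<le> liminf (\<lambda>n. \<integral>\<^sup>+t. ennreal ((norm (g n t))\<^sup>2) \<partial>LM T)"
  proof (rule nn_integral_liminf)
    show "(\<lambda>t. ennreal ((norm (g n t))\<^sup>2)) \<in> borel_measurable (LM T)" for n
      using ng[of n] by measurable
  qed
  also have "\<dots> \<le> ennreal C"
  proof (rule Liminf_le)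
    show "\<forall>\<^sub>F n in sequentially. (\<integral>\<^sup>+t. ennreal ((norm (g n t))\<^sup>2) \<partial>LM T) \<le> ennreal C"
      using bound
    proof eventually_elim
      case (elim n)
      have "(\<integral>\<^sup>+t. ennreal ((norm (g n t))\<^sup>2) \<partial>LM T) = ennreal (\<integral>t. (norm (g n t))\<^sup>2 \<partial>LM T)"
        by (rule nn_integral_eq_integral[OF L2_integrable[OF g]]) simp
      then show ?case using elim by (simp add: ennreal_leI)
    qed
  qed simp
  finally have le: "(\<integral>\<^sup>+t. ennreal ((norm (f t))\<^sup>2) \<partial>LM T) \<le> ennreal C" .
  have int: "integrable (LM T) (\<lambda>t. (norm (f t))\<^sup>2)"
  proof (rule integrableI_bounded)
    show "(\<lambda>t. (norm (f t))\<^sup>2) \<in> borel_measurable (LM T)" using nf by measurable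
    show "(\<integral>\<^sup>+ t. ennreal (norm ((norm (f t))\<^sup>2)) \<partial>LM T) < \<infinity>"
      using le by (simp add: order_le_less_trans[OF _ ennreal_less_top])
  qed
  have "ennreal (\<integral>t. (norm (f t))\<^sup>2 \<partial>LM T) = (\<integral>\<^sup>+t. ennreal ((norm (f t))\<^sup>2) \<partial>LM T)"
    by (rule nn_integral_eq_integral[symmetric, OF int]) simp
  with le have "ennreal (\<integral>t. (norm (f t))\<^sup>2 \<partial>LM T) \<le> ennreal C" by simp
  with C have "(\<integral>t. (norm (f t))\<^sup>2 \<partial>LM T) \<le> C" by (simp only: ennreal_le_iff)
  with f int show ?thesis by (simp add: L2_def)
qed

text \<open>Markov's inequality and Borel-Cantelli. The squared increments have integral at most 9 /
  16^n; the set where they reach 1 / 4^n has measure at most 9 / 4^n, which is summable. Almost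
  every t is eventually outside these sets, where the increments are below 1 / 2^n and hence
  summable.\<close>

lemma L2_fast_Cauchy_AE_convergent:
  fixes g :: "nat \<Rightarrow> real \<Rightarrow> 'a::complex_hilbert"
  assumes g: "\<And>n. g n \<in> L2 T"
    and q: "\<And>n. sqrt (semi_inner.q (L2_cinner T) (g (Suc n) - g n)) \<le> 3 * (1/4)^n"
  shows "AE t in LM T. convergent (\<lambda>n. g n t)"
proof -
  define A where "A n = {t \<in> space (LM T). (norm (g (Suc n) t - g n t))\<^sup>2 \<ge> (1/4)^n}" for n
  have d: "(\<lambda>t. g (Suc n) t - g n t) \<in> L2 T" for n by (intro L2_diff g)
  have int: "(\<integral>t. (norm (g (Suc n) t - g n t))\<^sup>2 \<partial>LM T) \<le> 9 * (1/16)^n" for n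
  proof -
    have "sqrt (\<integral>t. (norm (g (Suc n) t - g n t))\<^sup>2 \<partial>LM T) \<le> 3 * (1/4)^n"
      using q[of n] by (simp add: q_L2)
    then have "(sqrt (\<integral>t. (norm (g (Suc n) t - g n t))\<^sup>2 \<partial>LM T))\<^sup>2 \<le> (3 * (1/4)^n)\<^sup>2"
      by (rule power_mono) simp
    moreover have "((1/4)^n)\<^sup>2 = (1/16::real)^n" by (simp add: power2_eq_square flip: power_mult_distrib)
    ultimately show ?thesis by (simp add: power_mult_distrib)
  qed
  have meas: "(\<lambda>t. norm (g (Suc n) t - g n t)) \<in> borel_measurable (LM T)" for n
    by (rule strongly_measurable_norm[OF L2_strongly_measurable[OF d]])
  have A: "A n \<in> sets (LM T)" for n
    unfolding A_def using meas[of n] by measurable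
  have "AE t in LM T. \<forall>\<^sub>F n in sequentially. t \<in> space (LM T) - A n"
  proof (rule borel_cantelli_AE1[OF A])
    show "emeasure (LM T) (A n) < \<infinity>" for n by (simp add: less_top[symmetric])
    show "summable (\<lambda>n. measure (LM T) (A n))"
    proof (rule summable_comparison_test')
      show "summable (\<lambda>n. 9 * (1/4)^n :: real)" by (intro summable_mult summable_geometric) simp
      have "measure (LM T) (A n) \<le> 9 * (1/4)^n" for n
      proof -
        have sq: "(1/16::real)^n = (1/4)^n * (1/4)^n" by (simp flip: power_mult_distrib)
        have "measure (LM T) (A n) \<le> (\<integral>t. (norm (g (Suc n) t - g n t))\<^sup>2 \<partial>LM T) / (1/4)^n"
          unfolding A_def
          by (rule integral_Markov_inequality_measure[OF L2_integrable[OF d], where A = "{}"]) auto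
        also have "\<dots> \<le> 9 * (1/16)^n / (1/4)^n" by (rule divide_right_mono[OF int]) simp
        also have "\<dots> = 9 * (1/4)^n" by (simp add: sq)
        finally show ?thesis .
      qed
      then show "norm (measure (LM T) (A n)) \<le> 9 * (1/4)^n" for n by simp
    qed
  qed
  then show ?thesis
  proof eventually_elim
    case (elim t)
    then obtain N where "\<And>n. n \<ge> N \<Longrightarrow> t \<in> space (LM T) - A n" by (auto simp: eventually_sequentially)
    then have N: "(norm (g (Suc n) t - g n t))\<^sup>2 \<le> ((1/2)^n)\<^sup>2" if "n \<ge> N" for n
    proof -
      have "(norm (g (Suc n) t - g n t))\<^sup>2 < (1/4)^n"
        using \<open>\<And>n. n \<ge> N \<Longrightarrow> t \<in> space (LM T) - A n\<close>[OF that] by (auto simp: A_def)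
      also have "(1/4::real)^n = ((1/2)^n)\<^sup>2"
        by (simp add: power2_eq_square flip: power_mult_distrib)
      finally show ?thesis by (rule less_imp_le)
    qed
    have "summable (\<lambda>n. g (Suc n) t - g n t)"
    proof (rule summable_comparison_test')
      show "summable (\<lambda>n. (1/2)^n :: real)" by (intro summable_geometric) simp
      show "norm (g (Suc n) t - g n t) \<le> (1/2)^n" if "n \<ge> N" for n
        by (rule power2_le_imp_le[OF N[OF that]]) simp
    qed
    then have "convergent (\<lambda>n. \<Sum>k<n. g (Suc k) t - g k t)" by (simp add: summable_iff_convergent)
    then have "convergent (\<lambda>n. g n t - g 0 t)" by (simp add: sum_lessThan_telescope[of "\<lambda>k. g k t"])
    then show ?case by (simp add: convergent_diff_const_right_iff)
  qed
qed

text \<open>Riesz--Fischer, run along simple functions: strong measurability of the limit is then immediate.\<close>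

lemma semi_hilbert_L2: "semi_hilbert (L2 T) (L2_cinner T :: (real \<Rightarrow> 'a::complex_hilbert) \<Rightarrow> _)"
proof -
  interpret semi_inner "L2 T" "L2_cinner T :: (real \<Rightarrow> 'a) \<Rightarrow> _" by (rule semi_inner_L2)
  show ?thesis
  proof
    fix s :: "nat \<Rightarrow> real \<Rightarrow> 'a"
    assume s: "\<And>n. s n \<in> L2 T"
      and c: "\<And>e. e > 0 \<Longrightarrow> \<exists>N. \<forall>m\<ge>N. \<forall>n\<ge>N. Re (L2_cinner T (s m - s n) (s m - s n)) < e"
    have "\<exists>N. \<forall>m\<ge>N. \<forall>n\<ge>N. sqrt (q (s m - s n)) < (1/4)^k" for k
    proof -
      obtain N where N: "\<forall>m\<ge>N. \<forall>n\<ge>N. q (s m - s n) < ((1/4)^k)\<^sup>2"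
        using c[of "((1/4)^k)\<^sup>2"] by (auto simp: q_def)
      have "sqrt (q (s m - s n)) < (1/4)^k" if "m \<ge> N" "n \<ge> N" for m n
        using N that real_sqrt_less_mono[of "q (s m - s n)" "((1/4)^k)\<^sup>2"] by simp
      then show ?thesis by blast
    qed
    then obtain N where N: "\<And>k m n. m \<ge> N k \<Longrightarrow> n \<ge> N k \<Longrightarrow> sqrt (q (s m - s n)) < (1/4)^k" by metis
    \<comment> \<open>Summing the N i makes both r k and r (k + 1) at least N k, as the comparison
      of consecutive terms requires.\<close>
    define r where "r k = (\<Sum>i\<le>k. N i)" for k
    have r: "r k \<ge> N k" for k unfolding r_def by (rule member_le_sum) auto
    have r': "r (Suc k) \<ge> N k" for k using r[of k] by (simp add: r_def)
    have "\<exists>g. simple_function (LM T) g \<and> g \<in> L2 T \<and> sqrt (q (s (r k) - g)) < (1/4)^k" for k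
    proof -
      obtain g where g: "simple_function (LM T) g" "g \<in> L2 T"
        "(\<integral>t. (norm (s (r k) t - g t))\<^sup>2 \<partial>LM T) < ((1/4)^k)\<^sup>2"
        by (rule L2_simple_approx[OF s, of "((1/4)^k)\<^sup>2" "r k"]) auto
      then show ?thesis using real_sqrt_less_mono[OF g(3)] by (auto simp: q_L2 intro!: exI[of _ g])
    qed
    then obtain g where simple: "\<And>k. simple_function (LM T) (g k)" and g: "\<And>k. g k \<in> L2 T"
      and sg: "\<And>k. sqrt (q (s (r k) - g k)) < (1/4)^k" by metis
    have sym: "q (x - y) = q (y - x)" if "x \<in> L2 T" "y \<in> L2 T" for x y
      using that by (simp add: q_diff Re_ip_commute)
    have tri: "sqrt (q (x - z)) \<le> sqrt (q (x - y)) + sqrt (q (y - z))"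
      if "x \<in> L2 T" "y \<in> L2 T" "z \<in> L2 T" for x y z
      using q_triangle[of "x - y" "y - z"] that by simp
    have step: "sqrt (q (g (Suc k) - g k)) \<le> 3 * (1/4)^k" for k
    proof -
      have "sqrt (q (g (Suc k) - g k)) \<le> sqrt (q (g (Suc k) - s (r (Suc k))))
          + (sqrt (q (s (r (Suc k)) - s (r k))) + sqrt (q (s (r k) - g k)))"
        by (rule order_trans[OF tri add_left_mono[OF tri]]) (auto intro!: s g)
      also have "\<dots> \<le> (1/4)^Suc k + ((1/4)^k + (1/4)^k)"
        using sg[of k] sg[of "Suc k"] N[OF r'[of k] r[of k]] sym[OF g[of "Suc k"] s[of "r (Suc k)"]]
        by (intro add_mono) auto
      also have "\<dots> \<le> 3 * (1/4)^k" by simp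
      finally show ?thesis .
    qed
    \<comment> \<open>Telescoping \<open>step\<close>: the sum of 3 / 4^i over k <= i < k + n is 4 /
      4^k - 4 / 4^(k + n).\<close>
    have dist: "sqrt (q (g (k + n) - g k)) \<le> 4 * (1/4)^k - 4 * (1/4)^(k + n)" for k n
    proof (induction n)
      case 0 then show ?case by (simp add: q_L2)
    next
      case (Suc n)
      have "sqrt (q (g (k + Suc n) - g k)) \<le> sqrt (q (g (Suc (k + n)) - g (k + n))) + sqrt (q (g (k + n) - g k))"
        using tri[of "g (k + Suc n)" "g (k + n)" "g k"] g by simp
      also have "\<dots> \<le> 3 * (1/4)^(k + n) + (4 * (1/4)^k - 4 * (1/4)^(k + n))"
        by (intro add_mono step Suc)
      finally show ?case by (simp add: fun_diff_def)
    qed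
    have conv: "AE t in LM T. convergent (\<lambda>n. g n t)"
      by (rule L2_fast_Cauchy_AE_convergent[OF g step])
    define f where "f t = lim (\<lambda>n. g n t)" for t
    have lim: "AE t in LM T. (\<lambda>n. g n t) \<longlonglongrightarrow> f t"
      using conv by eventually_elim (simp add: f_def convergent_LIMSEQ_iff)
    have f: "strongly_measurable T f"
      unfolding strongly_measurable_def using simple lim by blast
    \<comment> \<open>Fatou along n for fixed k transfers the uniform bound to f - g k, which gives
      both membership of f in \<open>L2\<close> and the rate of convergence.\<close>
    have fg: "(\<lambda>t. f t - g k t) \<in> L2 T \<and> (\<integral>t. (norm (f t - g k t))\<^sup>2 \<partial>LM T) \<le> (4 * (1/4)^k)\<^sup>2" for k
    proof (rule L2_Fatou[where g = "\<lambda>n t. g n t - g k t"])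
      show "strongly_measurable T (\<lambda>t. f t - g k t)"
        by (rule strongly_measurable_compose2[OF f L2_strongly_measurable[OF g], where h = "\<lambda>x y. x - y"])
          (intro continuous_intros)
      show "(\<lambda>t. g n t - g k t) \<in> L2 T" for n by (intro L2_diff g)
      show "AE t in LM T. (\<lambda>n. g n t - g k t) \<longlonglongrightarrow> f t - g k t"
        using lim by eventually_elim (intro tendsto_intros)
      have "(\<integral>t. (norm (g n t - g k t))\<^sup>2 \<partial>LM T) \<le> (4 * (1/4)^k)\<^sup>2" if "n \<ge> k" for n
      proof -
        have "sqrt (\<integral>t. (norm (g n t - g k t))\<^sup>2 \<partial>LM T) \<le> 4 * (1/4)^k - 4 * (1/4)^n"
          using dist[of k "n - k"] that by (simp add: q_L2)
        also have "\<dots> \<le> 4 * (1/4)^k" by simp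
        finally have "sqrt (\<integral>t. (norm (g n t - g k t))\<^sup>2 \<partial>LM T) \<le> 4 * (1/4)^k" .
        then show ?thesis by (rule sqrt_le_D)
      qed
      then show "\<forall>\<^sub>F n in sequentially. (\<integral>t. (norm (g n t - g k t))\<^sup>2 \<partial>LM T) \<le> (4 * (1/4)^k)\<^sup>2"
        by (auto simp: eventually_sequentially)
    qed simp
    have fL2: "f \<in> L2 T" using L2_add[OF conjunct1[OF fg[of 0]] g[of 0]] by simp
    have "sqrt (q (f - g k)) \<le> sqrt ((4 * (1/4)^k)\<^sup>2)" for k
      using conjunct2[OF fg[of k]] by (simp only: real_sqrt_le_iff) (simp add: q_L2)
    then have fg': "sqrt (q (f - g k)) \<le> 4 * (1/4)^k" for k
      unfolding real_sqrt_abs by (metis abs_of_nonneg zero_le_numeral zero_le_power mult_nonneg_nonneg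
        zero_le_divide_1_iff)
    \<comment> \<open>6 = 1 + 1 + 4: from s n to s (r k), from there to g k, and from g k to
      f.\<close>
    have final: "sqrt (q (s n - f)) \<le> 6 * (1/4)^k" if "n \<ge> r k" for n k
    proof -
      have "sqrt (q (s n - f)) \<le> sqrt (q (s n - s (r k))) + (sqrt (q (s (r k) - g k)) + sqrt (q (g k - f)))"
        by (rule order_trans[OF tri add_left_mono[OF tri]]) (auto intro!: s g fL2)
      also have "\<dots> \<le> (1/4)^k + ((1/4)^k + 4 * (1/4)^k)"
        using sg[of k] N[of k n "r k"] r[of k] that fg'[of k] sym[OF g[of k] fL2]
        by (intro add_mono) auto
      finally show ?thesis by simp
    qed
    have "(\<lambda>n. sqrt (q (s n - f))) \<longlonglongrightarrow> 0"
    proof (rule LIMSEQ_I)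
      fix e :: real assume "e > 0"
      then obtain k where k: "(1/4::real)^k < e / 6"
        using real_arch_pow_inv[of "e/6" "1/4"] by auto
      have "norm (sqrt (q (s n - f)) - 0) < e" if "n \<ge> r k" for n
        using final[OF that] k q_nonneg[of "s n - f"] s fL2 by simp
      then show "\<exists>n0. \<forall>n\<ge>n0. norm (sqrt (q (s n - f)) - 0) < e" by blast
    qed
    then have "(\<lambda>n. (sqrt (q (s n - f)))\<^sup>2) \<longlonglongrightarrow> 0\<^sup>2" by (rule tendsto_power)
    then have "(\<lambda>n. Re (L2_cinner T (s n - f) (s n - f))) \<longlonglongrightarrow> 0"
      using s fL2 by (simp add: q_def[symmetric])
    then show "\<exists>h\<in>L2 T. (\<lambda>n. Re (L2_cinner T (s n - h) (s n - h))) \<longlonglongrightarrow> 0"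
      using fL2 by blast
  qed
qed

section \<open>Multiplication operators and adjoints\<close>

lemma bounded_clinear_blinfun:
  "clinear_on UNIV (blinfun_apply G) \<Longrightarrow> bounded_clinear (blinfun_apply G)"
  unfolding bounded_clinear_def bounded_on_def using norm_blinfun by blast

lemma Linf_opE:
  assumes "Q \<in> Linf_op T"
  obtains K where "K \<ge> 0" "AE t in LM T. norm (Q t) \<le> K"
proof -
  from assms obtain K where "AE t in LM T. norm (Q t) \<le> K" by (auto simp: Linf_op_def)
  then have "AE t in LM T. norm (Q t) \<le> max K 0" by eventually_elim auto
  with that[of "max K 0"] show ?thesis by simp
qed

lemma Linf_op_bounded_clinear:
  "Q \<in> Linf_op T \<Longrightarrow> AE t in LM T. bounded_clinear (blinfun_apply (Q t))"
  by (auto simp: Linf_op_def intro: AE_mp bounded_clinear_blinfun)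

lemma Linf_op_L2:
  assumes Q: "Q \<in> Linf_op T" and f: "f \<in> L2 T"
  shows "(\<lambda>t. Q t (f t)) \<in> L2 T"
proof -
  obtain K where K: "AE t in LM T. norm (Q t) \<le> K" using Linf_opE[OF Q] by blast
  show ?thesis
  proof (rule L2_bound[OF _ f])
    show "strongly_measurable T (\<lambda>t. Q t (f t))"
      using Q L2_strongly_measurable[OF f]
      by (intro strongly_measurable_bilinear[OF _ _ bounded_bilinear_blinfun_apply]) (auto simp: Linf_op_def)
    show "AE t in LM T. norm (Q t (f t)) \<le> K * norm (f t)"
      using K by eventually_elim (rule order_trans[OF norm_blinfun mult_right_mono], auto)
  qed
qed

text \<open>The complex linear part of a real linear operator, obtained by averaging over
  conjugation with multiplication by i. It fixes complex linear operators and does not increase the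
  norm.\<close>

definition clpart :: "('a::complex_normed_vector \<Rightarrow>\<^sub>L 'b::complex_normed_vector) \<Rightarrow> 'a \<Rightarrow> 'b" where
  "clpart G x = (1/2) *\<^sub>R (G x - \<i> *\<^sub>C G (\<i> *\<^sub>C x))"

lemma clpart_clinear:
  assumes "clinear_on UNIV (blinfun_apply G)" shows "clpart G = blinfun_apply G"
proof
  fix x
  have "G x - \<i> *\<^sub>C G (\<i> *\<^sub>C x) = G x + G x"
    using assms by (simp add: clinear_on_def scaleC_scaleC scaleC_minus_one)
  then show "clpart G x = G x" by (simp add: clpart_def scaleR_add_right[symmetric] flip: scaleR_2)
qed

lemma norm_clpart_le: "norm (clpart G x) \<le> norm G * norm x"
proof -
  have "norm (G x - \<i> *\<^sub>C G (\<i> *\<^sub>C x)) \<le> norm (G x) + norm (G (\<i> *\<^sub>C x))"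
    by (rule order_trans[OF norm_triangle_ineq4]) (simp add: norm_scaleC)
  also have "\<dots> \<le> norm G * norm x + norm G * norm x"
    using norm_blinfun[of G x] norm_blinfun[of G "\<i> *\<^sub>C x"] by (intro add_mono) (auto simp: norm_scaleC)
  finally show ?thesis by (simp add: clpart_def mult.commute)
qed

lemma bounded_clinear_clpart: "bounded_clinear (clpart G)"
proof -
  have "clpart G (c *\<^sub>C x) = c *\<^sub>C clpart G x" for c x
  proof -
    \<comment> \<open>Reduces complex homogeneity to real linearity and compatibility with
      i.\<close>
    have c: "c *\<^sub>C y = Re c *\<^sub>R y + Im c *\<^sub>R (\<i> *\<^sub>C y)" for y :: "'d::complex_vector"
      by (simp add: scaleR_eq_scaleC scaleC_scaleC flip: scaleC_add_left)
         (metis complex_eq mult.commute)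
    have i: "\<i> *\<^sub>C r *\<^sub>R y = r *\<^sub>R \<i> *\<^sub>C y" "\<i> *\<^sub>C \<i> *\<^sub>C y = - y" for y :: "'d::complex_vector" and r
      by (simp_all add: scaleR_eq_scaleC scaleC_scaleC mult.commute scaleC_minus_one)
    show ?thesis
      unfolding clpart_def c[of x] c[of "(1/2) *\<^sub>R (G x - \<i> *\<^sub>C G (\<i> *\<^sub>C x))"]
      by (simp add: i scaleC_add_right scaleC_diff_right scaleC_minus_right blinfun.add_right blinfun.scaleR_right
          blinfun.minus_right blinfun.diff_right algebra_simps)
  qed
  moreover have "clpart G (x + y) = clpart G x + clpart G y" for x y
    by (simp add: clpart_def blinfun.add_right scaleC_add_right algebra_simps)
  ultimately show ?thesis
    using norm_clpart_le unfolding bounded_clinear_def clinear_on_def bounded_on_def by blast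
qed

lemma clpart_diff: "clpart G x - clpart H x = clpart (G - H) x"
  by (simp add: clpart_def blinfun.diff_left scaleC_diff_right algebra_simps)

text \<open>Approximating simple functions may take values that are only real linear; passing to complex
  linear parts repairs this.\<close>

lemma strongly_measurable_cadjoint:
  fixes N :: "real \<Rightarrow> 'a::complex_hilbert \<Rightarrow>\<^sub>L 'b::complex_hilbert"
  assumes N: "N \<in> Linf_op T" and u: "strongly_measurable T u"
  shows "strongly_measurable T (\<lambda>t. cadjoint (N t) (u t))"
proof -
  obtain a b where ab: "\<And>n::nat. simple_function (LM T) (a n)" "\<And>n::nat. simple_function (LM T) (b n)"
    and lim: "AE t in LM T. (\<lambda>n. a n t) \<longlonglongrightarrow> N t" "AE t in LM T. (\<lambda>n. b n t) \<longlonglongrightarrow> u t"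
    using N u unfolding strongly_measurable_def Linf_op_def by blast
  have "AE t in LM T. clinear_on UNIV (blinfun_apply (N t))" using N by (simp add: Linf_op_def)
  with lim have "AE t in LM T. (\<lambda>n. cadjoint (clpart (a n t)) (b n t)) \<longlonglongrightarrow> cadjoint (N t) (u t)"
  proof eventually_elim
    case (elim t)
    have le: "norm (cadjoint (clpart (a n t)) (b n t) - cadjoint (N t) (u t))
        \<le> norm (a n t) * norm (b n t - u t) + norm (a n t - N t) * norm (u t)" for n
    proof -
      \<comment> \<open>As \<open>N t\<close> equals its complex linear part, the error splits into
        one caused by \<open>b n t - u t\<close> and one caused by
        \<open>a n t - N t\<close>.\<close>
      have "cadjoint (clpart (a n t)) (b n t) - cadjoint (N t) (u t)
          = cadjoint (clpart (a n t)) (b n t - u t) + cadjoint (clpart (a n t - N t)) (u t)"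
        using cadjoint_diff[of "clpart (a n t)" "clpart (N t)" "u t"]
        by (simp add: cadjoint_diff_right bounded_clinear_clpart clpart_diff)
          (simp add: clpart_clinear[OF elim(3)])
      then show ?thesis
        by (simp only:) (intro norm_triangle_mono norm_cadjoint_le bounded_clinear_clpart norm_clpart_le norm_ge_zero)
    qed
    have "(\<lambda>n. norm (a n t) * norm (b n t - u t) + norm (a n t - N t) * norm (u t))
        \<longlonglongrightarrow> norm (N t) * norm (u t - u t) + norm (N t - N t) * norm (u t)"
      using elim by (intro tendsto_intros)
    then have "(\<lambda>n. norm (a n t) * norm (b n t - u t) + norm (a n t - N t) * norm (u t)) \<longlonglongrightarrow> 0"
      by simp
    then have "(\<lambda>n. cadjoint (clpart (a n t)) (b n t) - cadjoint (N t) (u t)) \<longlonglongrightarrow> 0"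
      by (rule Lim_null_comparison[OF always_eventually[OF allI[OF le]]])
    then show ?case by (simp add: LIM_zero_iff)
  qed
  then show ?thesis unfolding strongly_measurable_def
    using simple_function_compose2[OF ab, where h = "\<lambda>x y. cadjoint (clpart x) y"]
    by (intro exI[of _ "\<lambda>n t. cadjoint (clpart (a n t)) (b n t)"]) auto
qed

lemma cadjoint_Linf_op_L2:
  fixes N :: "real \<Rightarrow> 'a::complex_hilbert \<Rightarrow>\<^sub>L 'b::complex_hilbert"
  assumes N: "N \<in> Linf_op T" and u: "u \<in> L2 T"
  shows "(\<lambda>t. cadjoint (N t) (u t)) \<in> L2 T"
proof -
  obtain K where K: "K \<ge> 0" "AE t in LM T. norm (N t) \<le> K" using Linf_opE[OF N] by blast
  show ?thesis
  proof (rule L2_bound[OF strongly_measurable_cadjoint[OF N L2_strongly_measurable[OF u]] u])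
    show "AE t in LM T. norm (cadjoint (N t) (u t)) \<le> K * norm (u t)"
      using K(2) Linf_op_bounded_clinear[OF N]
    proof eventually_elim
      case (elim t)
      have "norm (N t x) \<le> K * norm x" for x
        using order_trans[OF norm_blinfun mult_right_mono[OF elim(1)]] by simp
      then show ?case by (intro norm_cadjoint_le elim K)
    qed
  qed
qed

lemma L2_cinner_cong_integrand:
  fixes f g :: "real \<Rightarrow> 'a::complex_hilbert" and f' g' :: "real \<Rightarrow> 'b::complex_hilbert"
  assumes "f \<in> L2 T" "g \<in> L2 T" "f' \<in> L2 T" "g' \<in> L2 T"
    and "AE t in LM T. cinner (f t) (g t) = cinner (f' t) (g' t)"
  shows "L2_cinner T f g = L2_cinner T f' g'"
  unfolding L2_cinner_def
  using assms by (intro integral_cong_AE borel_measurable_integrable integrable_L2_cinner)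

lemma L2_cinner_cadjoint:
  fixes N :: "real \<Rightarrow> 'a::complex_hilbert \<Rightarrow>\<^sub>L 'b::complex_hilbert"
  assumes N: "N \<in> Linf_op T" and "f \<in> L2 T" "u \<in> L2 T"
  shows "L2_cinner T (\<lambda>t. N t (f t)) u = L2_cinner T f (\<lambda>t. cadjoint (N t) (u t))"
proof (intro L2_cinner_cong_integrand Linf_op_L2 cadjoint_Linf_op_L2)
  show "AE t in LM T. cinner (N t (f t)) (u t) = cinner (f t) (cadjoint (N t) (u t))"
    using Linf_op_bounded_clinear[OF N] by eventually_elim (rule cadjoint)
qed (use assms in auto)

lemma L2_cinner_selfadjoint:
  fixes Q :: "real \<Rightarrow> 'a::complex_hilbert \<Rightarrow>\<^sub>L 'a"
  assumes Q: "Q \<in> Linf_op T" and "AE t in LM T. selfadjoint (Q t)" and "f \<in> L2 T" "g \<in> L2 T"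
  shows "L2_cinner T (\<lambda>t. Q t (f t)) g = L2_cinner T f (\<lambda>t. Q t (g t))"
proof (intro L2_cinner_cong_integrand Linf_op_L2)
  show "AE t in LM T. cinner (Q t (f t)) (g t) = cinner (f t) (Q t (g t))"
    using assms(2) by eventually_elim (simp add: selfadjoint_def)
qed (use assms in auto)

section \<open>Norm estimates and adjoints on \<open>L2\<close>\<close>

lemma L2_norm_Linf_op_le:
  fixes Q :: "real \<Rightarrow> 'a::complex_hilbert \<Rightarrow>\<^sub>L 'b::complex_hilbert"
  assumes Q: "Q \<in> Linf_op T" and f: "f \<in> L2 T" and K: "K \<ge> 0" "AE t in LM T. norm (Q t) \<le> K"
  shows "L2_norm T (\<lambda>t. Q t (f t)) \<le> K * L2_norm T f"
proof -
  have "(\<integral>t. (norm (Q t (f t)))\<^sup>2 \<partial>LM T) \<le> (\<integral>t. K\<^sup>2 * (norm (f t))\<^sup>2 \<partial>LM T)"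
  proof (rule integral_mono_AE)
    show "AE t in LM T. (norm (Q t (f t)))\<^sup>2 \<le> K\<^sup>2 * (norm (f t))\<^sup>2"
      using K(2)
    proof eventually_elim
      case (elim t)
      have "norm (Q t (f t)) \<le> K * norm (f t)"
        using order_trans[OF norm_blinfun mult_right_mono[OF elim]] by simp
      then show ?case by (simp add: power_mono flip: power_mult_distrib)
    qed
  qed (use L2_integrable[OF f] L2_integrable[OF Linf_op_L2[OF Q f]] in auto)
  then show ?thesis
    using K(1) real_sqrt_le_mono by (fastforce simp: L2_norm_def real_sqrt_mult)
qed

lemma L2_norm_nonneg: "0 \<le> L2_norm T f"
  by (simp add: L2_norm_def)

lemma L2_Cauchy_Schwarz:
  fixes f g :: "real \<Rightarrow> 'a::complex_hilbert"
  shows "f \<in> L2 T \<Longrightarrow> g \<in> L2 T \<Longrightarrow> cmod (L2_cinner T f g) \<le> L2_norm T f * L2_norm T g"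
  using semi_inner.Cauchy_Schwarz[OF semi_inner_L2, of f T g] by (simp add: L2_norm_eq)

lemma L2_cinner_add_left:
  fixes f g h :: "real \<Rightarrow> 'a::complex_hilbert"
  shows "f \<in> L2 T \<Longrightarrow> g \<in> L2 T \<Longrightarrow> h \<in> L2 T \<Longrightarrow>
    L2_cinner T (\<lambda>t. f t + g t) h = L2_cinner T f h + L2_cinner T g h"
  using semi_inner.ip_add_left[OF semi_inner_L2, of f T g h] by (simp add: plus_fun_def)

lemma L2_cinner_add_right:
  fixes f g h :: "real \<Rightarrow> 'a::complex_hilbert"
  shows "f \<in> L2 T \<Longrightarrow> g \<in> L2 T \<Longrightarrow> h \<in> L2 T \<Longrightarrow>
    L2_cinner T h (\<lambda>t. f t + g t) = L2_cinner T h f + L2_cinner T h g"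
  using semi_inner.ip_add_right[OF semi_inner_L2, of f T g h] by (simp add: plus_fun_def)

lemma L2_cinner_scaleC_left:
  fixes f h :: "real \<Rightarrow> 'a::complex_hilbert"
  shows "f \<in> L2 T \<Longrightarrow> h \<in> L2 T \<Longrightarrow> L2_cinner T (\<lambda>t. c *\<^sub>C f t) h = cnj c * L2_cinner T f h"
  using semi_inner.ip_scaleC_left[OF semi_inner_L2, of f T h c] by (simp add: scaleC_fun_def)

lemma L2_cinner_commute:
  fixes f g :: "real \<Rightarrow> 'a::complex_hilbert"
  shows "f \<in> L2 T \<Longrightarrow> g \<in> L2 T \<Longrightarrow> L2_cinner T f g = cnj (L2_cinner T g f)"
  by (rule semi_inner.ip_commute[OF semi_inner_L2])

lemma bounded_L2_opE:
  assumes "bounded_L2_op T F"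
  obtains K where "K \<ge> 0" "\<And>f. f \<in> L2 T \<Longrightarrow> L2_norm T (F f) \<le> K * L2_norm T f"
proof -
  from assms obtain K where K: "\<And>f. f \<in> L2 T \<Longrightarrow> L2_norm T (F f) \<le> K * L2_norm T f"
    unfolding bounded_L2_op_def by blast
  have "L2_norm T (F f) \<le> max K 0 * L2_norm T f" if "f \<in> L2 T" for f
    using K[OF that] mult_right_mono[of K "max K 0" "L2_norm T f"] L2_norm_nonneg[of T f] by simp
  with that[of "max K 0"] show ?thesis by auto
qed

lemma L2_adjoint:
  fixes F :: "(real \<Rightarrow> 'a::complex_hilbert) \<Rightarrow> real \<Rightarrow> 'b::complex_hilbert"
  assumes F: "bounded_L2_op T F"
  shows L2_adjoint_L2: "w \<in> L2 T \<Longrightarrow> L2_adjoint T F w \<in> L2 T"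
    and L2_cinner_adjoint: "v \<in> L2 T \<Longrightarrow> w \<in> L2 T \<Longrightarrow>
      L2_cinner T (F v) w = L2_cinner T v (L2_adjoint T F w)"
proof -
  obtain K where K: "\<And>f. f \<in> L2 T \<Longrightarrow> L2_norm T (F f) \<le> K * L2_norm T f"
    using bounded_L2_opE[OF F] by blast
  have maps: "F v \<in> L2 T" if "v \<in> L2 T" for v using F that by (simp add: bounded_L2_op_def)
  have "(\<forall>w\<in>L2 T. L2_adjoint T F w \<in> L2 T) \<and>
    (\<forall>v\<in>L2 T. \<forall>w\<in>L2 T. L2_cinner T (F v) w = L2_cinner T v (L2_adjoint T F w))"
    unfolding L2_adjoint_def
  proof (rule semi_hilbert.adjoint_exists[OF semi_hilbert_L2 semi_inner_L2, where K = K])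
    fix x y :: "real \<Rightarrow> 'a" and w :: "real \<Rightarrow> 'b" and c
    assume x: "x \<in> L2 T" and w: "w \<in> L2 T"
    have "AE t in LM T. F (\<lambda>s. c *\<^sub>C x s) t = c *\<^sub>C F x t"
      using F x unfolding bounded_L2_op_def by blast
    then have "L2_cinner T (F (\<lambda>s. c *\<^sub>C x s)) w = L2_cinner T (\<lambda>t. c *\<^sub>C F x t) w"
      by (rule L2_cinner_AE_cong[OF maps[OF L2_scaleC[OF x]] w _ AE_I2[OF refl], symmetric])
    then show "L2_cinner T (F (c *\<^sub>C x)) w = cnj c * L2_cinner T (F x) w"
      using x w by (simp add: scaleC_fun_def L2_cinner_scaleC_left maps)
    assume y: "y \<in> L2 T"
    have "AE t in LM T. F (\<lambda>s. x s + y s) t = F x t + F y t"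
      using F x y unfolding bounded_L2_op_def by blast
    then have "L2_cinner T (F (\<lambda>s. x s + y s)) w = L2_cinner T (\<lambda>t. F x t + F y t) w"
      by (rule L2_cinner_AE_cong[OF maps[OF L2_add[OF x y]] w _ AE_I2[OF refl], symmetric])
    then show "L2_cinner T (F (x + y)) w = L2_cinner T (F x) w + L2_cinner T (F y) w"
      using x y w by (simp add: plus_fun_def L2_cinner_add_left maps)
  qed (use K maps in \<open>auto simp: L2_norm_eq\<close>)
  then show "w \<in> L2 T \<Longrightarrow> L2_adjoint T F w \<in> L2 T"
    and "v \<in> L2 T \<Longrightarrow> w \<in> L2 T \<Longrightarrow> L2_cinner T (F v) w = L2_cinner T v (L2_adjoint T F w)"
    by blast+
qed

text \<open>Linearity of \<open>Psi\<close> is asked for times in [0, T] only: the semigroup behind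
  it is unspecified at negative times.\<close>

lemma output_adjoint:
  fixes Psi :: "'x::complex_hilbert \<Rightarrow> real \<Rightarrow> 'y::complex_hilbert"
  assumes L2: "\<And>x. Psi x \<in> L2 T"
    and add: "\<And>x y t. t \<in> {0..T} \<Longrightarrow> Psi (x + y) t = Psi x t + Psi y t"
    and scale: "\<And>c x t. t \<in> {0..T} \<Longrightarrow> Psi (c *\<^sub>C x) t = c *\<^sub>C Psi x t"
    and bound: "\<And>x. L2_norm T (Psi x) \<le> K * norm x"
    and w: "w \<in> L2 T"
  shows "L2_cinner T (Psi x) w = cinner x (output_adjoint T Psi w)"
proof -
  have "(\<forall>w\<in>L2 T. output_adjoint T Psi w \<in> UNIV) \<and>
    (\<forall>x\<in>UNIV. \<forall>w\<in>L2 T. L2_cinner T (Psi x) w = cinner x (output_adjoint T Psi w))"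
    unfolding output_adjoint_def
  proof (rule ch.adjoint_exists[OF semi_inner_L2, where K = K])
    fix x y :: 'x and c and w :: "real \<Rightarrow> 'y" assume w: "w \<in> L2 T"
    have "L2_cinner T (Psi (x + y)) w = L2_cinner T (\<lambda>t. Psi x t + Psi y t) w"
      by (rule L2_cinner_AE_cong[OF L2 w _ AE_I2[OF refl], symmetric]) (rule AE_I2, simp add: add)
    then show "L2_cinner T (Psi (x + y)) w = L2_cinner T (Psi x) w + L2_cinner T (Psi y) w"
      using w L2 by (simp add: L2_cinner_add_left)
    have "L2_cinner T (Psi (c *\<^sub>C x)) w = L2_cinner T (\<lambda>t. c *\<^sub>C Psi x t) w"
      by (rule L2_cinner_AE_cong[OF L2 w _ AE_I2[OF refl], symmetric]) (rule AE_I2, simp add: scale)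
    then show "L2_cinner T (Psi (c *\<^sub>C x)) w = cnj c * L2_cinner T (Psi x) w"
      using w L2 by (simp add: L2_cinner_scaleC_left)
  qed (use L2 bound in \<open>auto simp: L2_norm_eq\<close>)
  with w show ?thesis by blast
qed

section \<open>The linear-quadratic problem\<close>

text \<open>Quadratic minimisation detached from the pencil: the system enters through a bounded
  linear output map and a bounded operator on \<open>L2\<close>.\<close>

locale lq_problem =
  fixes T :: real
    and Psi :: "'x::complex_hilbert \<Rightarrow> real \<Rightarrow> 'y::complex_hilbert"
    and F :: "(real \<Rightarrow> 'u::complex_hilbert) \<Rightarrow> real \<Rightarrow> 'y"
    and Q :: "real \<Rightarrow> 'y \<Rightarrow>\<^sub>L 'y" and R :: "real \<Rightarrow> 'u \<Rightarrow>\<^sub>L 'u" and N :: "real \<Rightarrow> 'y \<Rightarrow>\<^sub>L 'u"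
    and K\<^sub>\<Psi> \<epsilon> :: real
  assumes Psi_L2 [simp]: "\<And>x. Psi x \<in> L2 T"
    and Psi_add: "\<And>x y t. t \<in> {0..T} \<Longrightarrow> Psi (x + y) t = Psi x t + Psi y t"
    and Psi_scaleC: "\<And>c x t. t \<in> {0..T} \<Longrightarrow> Psi (c *\<^sub>C x) t = c *\<^sub>C Psi x t"
    and Psi_bound: "\<And>x. L2_norm T (Psi x) \<le> K\<^sub>\<Psi> * norm x"
    and F: "bounded_L2_op T F"
    and Q: "Q \<in> Linf_op T" "AE t in LM T. selfadjoint (Q t)"
    and R: "R \<in> Linf_op T" "AE t in LM T. selfadjoint (R t)"
    and N: "N \<in> Linf_op T"
    and eps: "\<epsilon> > 0"
    and coercive: "\<And>u. u \<in> L2 T \<Longrightarrow>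
      complex_of_real (\<epsilon> * (L2_norm T u)\<^sup>2) \<le> L2_cinner T u (popov T Q R N F u)"
begin

lemma F_L2 [simp]: "u \<in> L2 T \<Longrightarrow> F u \<in> L2 T"
  using F by (simp add: bounded_L2_op_def)

lemmas mult_L2 [simp] = Linf_op_L2[OF Q(1)] Linf_op_L2[OF R(1)] Linf_op_L2[OF N]
  cadjoint_Linf_op_L2[OF N] L2_adjoint_L2[OF F] L2_add L2_scaleC

abbreviation ip where "ip \<equiv> L2_cinner T"
abbreviation popov_op where "popov_op \<equiv> popov T Q R N F"

lemma popov_L2 [simp]: "u \<in> L2 T \<Longrightarrow> popov_op u \<in> L2 T"
  unfolding popov_def by simp

definition form :: "(real \<Rightarrow> 'u) \<Rightarrow> (real \<Rightarrow> 'u) \<Rightarrow> complex" where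
  "form u v = ip u (popov_op v)"

lemma form_eq:
  assumes [simp]: "u \<in> L2 T" "v \<in> L2 T"
  shows "form u v = ip u (\<lambda>t. R t (v t)) + ip u (\<lambda>t. N t (F v t))
    + ip (F u) (\<lambda>t. cadjoint (N t) (v t)) + ip (F u) (\<lambda>t. Q t (F v t))"
  unfolding form_def popov_def by (simp add: L2_cinner_add_right L2_cinner_adjoint[OF F])

text \<open>The R and Q terms are Hermitian by themselves, the two N terms are conjugate to each
  other. With conjugate linearity in the first argument, inherited from \<open>ip\<close>, this
  yields linearity in the second, although \<open>popov_op\<close> is built from adjoints chosen by
  \<open>SOME\<close>.\<close>

lemma form_commute:
  assumes [simp]: "u \<in> L2 T" "v \<in> L2 T"
  shows "form u v = cnj (form v u)"
proof -
  have "ip u (\<lambda>t. R t (v t)) = cnj (ip v (\<lambda>t. R t (u t)))"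
    by (simp add: L2_cinner_selfadjoint[OF R, symmetric] L2_cinner_commute[of u])
  moreover have "ip (F u) (\<lambda>t. Q t (F v t)) = cnj (ip (F v) (\<lambda>t. Q t (F u t)))"
    by (simp add: L2_cinner_selfadjoint[OF Q, symmetric] L2_cinner_commute[of "F u"])
  moreover have "ip a (\<lambda>t. N t (F b t)) = cnj (ip (F b) (\<lambda>t. cadjoint (N t) (a t)))"
    if "a \<in> L2 T" "b \<in> L2 T" for a b
    using that by (simp add: L2_cinner_cadjoint[OF N, symmetric] L2_cinner_commute[of a])
  ultimately show ?thesis by (simp add: form_eq)
qed

text \<open>Upper counterpart of coercivity: it turns convergence in \<open>L2\<close> into
  convergence in the Popov form.\<close>

lemma form_bound: "\<exists>c. \<forall>u\<in>L2 T. Re (form u u) \<le> c * (L2_norm T u)\<^sup>2"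
proof -
  obtain KF where KF: "KF \<ge> 0" "\<And>u. u \<in> L2 T \<Longrightarrow> L2_norm T (F u) \<le> KF * L2_norm T u"
    using bounded_L2_opE[OF F] by blast
  obtain KQ KR KN where K: "KQ \<ge> 0" "AE t in LM T. norm (Q t) \<le> KQ"
      "KR \<ge> 0" "AE t in LM T. norm (R t) \<le> KR" "KN \<ge> 0" "AE t in LM T. norm (N t) \<le> KN"
    using Linf_opE[OF Q(1)] Linf_opE[OF R(1)] Linf_opE[OF N] by metis
  have "Re (form u u) \<le> (KR + KN * KF + KN * KF + KF * (KQ * KF)) * (L2_norm T u)\<^sup>2"
    if u [simp]: "u \<in> L2 T" for u
  proof -
    let ?n = "L2_norm T u"
    note le = L2_norm_Linf_op_le[OF Q(1) _ K(1,2)] L2_norm_Linf_op_le[OF R(1) _ K(3,4)]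
      L2_norm_Linf_op_le[OF N _ K(5,6)]
    have NF: "L2_norm T (\<lambda>t. N t (F u t)) \<le> KN * (KF * ?n)"
      by (rule order_trans[OF le(3) mult_left_mono[OF KF(2)]]) (auto simp: K)
    have QF: "L2_norm T (\<lambda>t. Q t (F u t)) \<le> KQ * (KF * ?n)"
      by (rule order_trans[OF le(1) mult_left_mono[OF KF(2)]]) (auto simp: K)
    have "cmod (ip u (\<lambda>t. R t (u t))) \<le> ?n * (KR * ?n)"
      by (rule order_trans[OF L2_Cauchy_Schwarz mult_left_mono[OF le(2)]]) (auto simp: L2_norm_nonneg)
    moreover have "cmod (ip u (\<lambda>t. N t (F u t))) \<le> ?n * (KN * (KF * ?n))"
      by (rule order_trans[OF L2_Cauchy_Schwarz mult_left_mono[OF NF]]) (auto simp: L2_norm_nonneg)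
    moreover have "cmod (ip (F u) (\<lambda>t. cadjoint (N t) (u t))) \<le> KN * (KF * ?n) * ?n"
      unfolding L2_cinner_cadjoint[OF N F_L2[OF u] u, symmetric]
      by (rule order_trans[OF L2_Cauchy_Schwarz mult_right_mono[OF NF]]) (auto simp: L2_norm_nonneg)
    moreover have "cmod (ip (F u) (\<lambda>t. Q t (F u t))) \<le> (KF * ?n) * (KQ * (KF * ?n))"
      by (rule order_trans[OF L2_Cauchy_Schwarz mult_mono[OF KF(2) QF]]) (auto simp: L2_norm_nonneg KF)
    moreover have "Re (form u u) \<le> cmod (ip u (\<lambda>t. R t (u t))) + cmod (ip u (\<lambda>t. N t (F u t)))
      + cmod (ip (F u) (\<lambda>t. cadjoint (N t) (u t))) + cmod (ip (F u) (\<lambda>t. Q t (F u t)))"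
      by (simp add: form_eq add_mono complex_Re_le_cmod)
    ultimately show ?thesis by (simp add: algebra_simps power2_eq_square)
  qed
  then show ?thesis by blast
qed

lemma form_coercive: "u \<in> L2 T \<Longrightarrow> \<epsilon> * (L2_norm T u)\<^sup>2 \<le> Re (form u u)"
  using coercive[of u] by (simp add: form_def less_eq_complex_def)

sublocale L: semi_hilbert "L2 T :: (real \<Rightarrow> 'u) set" ip
  by (rule semi_hilbert_L2)

lemma L_q: "L.q u = (L2_norm T u)\<^sup>2" if "u \<in> L2 T"
  using that by (simp add: L2_norm_eq)

text \<open>The two seminorms are equivalent: coercivity makes sequences that are Cauchy for the
  form Cauchy in \<open>L2\<close>, and the upper bound carries the \<open>L2\<close> limit back to
  the form.\<close>

sublocale form: semi_hilbert "L2 T :: (real \<Rightarrow> 'u) set" form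
proof
  obtain c where c: "\<And>u. u \<in> L2 T \<Longrightarrow> Re (form u u) \<le> c * (L2_norm T u)\<^sup>2"
    using form_bound by blast
  fix s :: "nat \<Rightarrow> real \<Rightarrow> 'u"
  assume s: "\<And>n. s n \<in> L2 T"
    and Cauchy: "\<And>e. e > 0 \<Longrightarrow> \<exists>N. \<forall>m\<ge>N. \<forall>n\<ge>N. Re (form (s m - s n) (s m - s n)) < e"
  have d: "x - y \<in> L2 T" if "x \<in> L2 T" "y \<in> L2 T" for x y :: "real \<Rightarrow> 'u"
    using that by (rule csubspace_diff[OF csubspace_L2])
  have "\<exists>h\<in>L2 T. (\<lambda>n. Re (ip (s n - h) (s n - h))) \<longlonglongrightarrow> 0"
  proof (rule L.complete[OF s])
    fix e :: real assume "e > 0"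
    then obtain M where M: "\<And>m n. m \<ge> M \<Longrightarrow> n \<ge> M \<Longrightarrow> Re (form (s m - s n) (s m - s n)) < \<epsilon> * e"
      using Cauchy[of "\<epsilon> * e"] eps by auto
    have "Re (ip (s m - s n) (s m - s n)) < e" if "m \<ge> M" "n \<ge> M" for m n
      using order_le_less_trans[OF form_coercive[OF d[OF s s]] M[OF that]] eps
      by (simp add: L.q_def[symmetric] L_q d s)
    then show "\<exists>M. \<forall>m\<ge>M. \<forall>n\<ge>M. Re (ip (s m - s n) (s m - s n)) < e" by blast
  qed
  then obtain h where h: "h \<in> L2 T" and lim: "(\<lambda>n. L.q (s n - h)) \<longlonglongrightarrow> 0"
    by (auto simp: L.q_def)
  have "(\<lambda>n. Re (form (s n - h) (s n - h))) \<longlonglongrightarrow> 0"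
  proof (rule real_tendsto_sandwich[where f = "\<lambda>_. 0"])
    show "(\<lambda>n. c * L.q (s n - h)) \<longlonglongrightarrow> 0" using tendsto_mult_right_zero[OF lim] .
    show "\<forall>\<^sub>F n in sequentially. Re (form (s n - h) (s n - h)) \<le> c * L.q (s n - h)"
      using c[OF d[OF s h]] by (simp add: L_q[OF d[OF s h]])
    have "0 \<le> Re (form (s n - h) (s n - h))" for n
      by (rule order_trans[OF _ form_coercive[OF d[OF s h]]]) (use eps in simp)
    then show "\<forall>\<^sub>F n in sequentially. 0 \<le> Re (form (s n - h) (s n - h))" by simp
  qed simp
  then show "\<exists>h\<in>L2 T. (\<lambda>n. Re (form (s n - h) (s n - h))) \<longlonglongrightarrow> 0" using h by blast
next
  fix u :: "real \<Rightarrow> 'u" assume "u \<in> L2 T"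
  then show "0 \<le> Re (form u u)"
    using order_trans[OF _ form_coercive[of u], of 0] eps by simp
next
  fix x y :: "real \<Rightarrow> 'u" and c assume xy: "x \<in> L2 T" "y \<in> L2 T"
  show "form x y = cnj (form y x)" by (rule form_commute[OF xy])
  show "form (c *\<^sub>C x) y = cnj c * form x y"
    unfolding form_def by (rule L.ip_scaleC_left[OF xy(1) popov_L2[OF xy(2)]])
  fix z :: "real \<Rightarrow> 'u" assume z: "z \<in> L2 T"
  show "form (x + y) z = form x z + form y z"
    unfolding form_def by (rule L.ip_add_left[OF xy popov_L2[OF z]])
qed (rule csubspace_L2)

text \<open>Lax-Milgram in the Hermitian case: Riesz for the Popov form, applied to w ->
  \<open>ip w f\<close>, gives a weak solution. The constant, the norm of f divided by
  \<open>sqrt \<epsilon>\<close>, comes from coercivity.\<close>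

lemma popov_inverse:
  assumes f: "f \<in> L2 T"
  shows "L2_inverse T popov_op f \<in> L2 T \<and> (AE t in LM T. popov_op (L2_inverse T popov_op f) t = f t)"
proof -
  have "\<exists>v\<in>L2 T. \<forall>w\<in>L2 T. ip w f = form w v"
  proof (rule form.riesz[where K = "L2_norm T f / sqrt \<epsilon>"])
    fix w :: "real \<Rightarrow> 'u" assume w: "w \<in> L2 T"
    have "sqrt \<epsilon> * L2_norm T w = sqrt (\<epsilon> * (L2_norm T w)\<^sup>2)"
      by (simp add: real_sqrt_mult L2_norm_nonneg)
    also have "\<dots> \<le> sqrt (form.q w)"
      using form_coercive[OF w] by (simp add: form.q_def)
    finally have "L2_norm T w \<le> sqrt (form.q w) / sqrt \<epsilon>"
      using eps by (simp add: pos_le_divide_eq mult.commute)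
    then show "cmod (ip w f) \<le> L2_norm T f / sqrt \<epsilon> * sqrt (form.q w)"
      using order_trans[OF L2_Cauchy_Schwarz[OF w f] mult_right_mono[OF _ L2_norm_nonneg[of T f]],
          of "sqrt (form.q w) / sqrt \<epsilon>"]
      by (simp add: mult.commute)
  qed (use f in \<open>auto simp: L.ip_add_left L.ip_scaleC_left\<close>)
  then obtain v where v: "v \<in> L2 T" "\<And>w. w \<in> L2 T \<Longrightarrow> ip w f = ip w (popov_op v)"
    by (auto simp: form_def)
  \<comment> \<open>Testing the weak equation with its own residual shows that the residual vanishes
    almost everywhere.\<close>
  define d where "d = popov_op v - f"
  have d: "d \<in> L2 T" unfolding d_def by (intro csubspace_diff[OF csubspace_L2] popov_L2 v f)
  have "ip d d = 0"
    using v(2)[OF d] L.ip_diff_right[of "popov_op v" f d] v(1) f d by (simp add: d_def[symmetric])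
  then have "(\<integral>t. (norm (d t))\<^sup>2 \<partial>LM T) = 0" by (simp add: L2_cinner_self del: of_real_power)
  from L2_norm_zero_AE[OF d this] have "AE t in LM T. popov_op v t = f t" by (simp add: d_def)
  with v(1) show ?thesis
    unfolding L2_inverse_def by (intro someI[of "\<lambda>g. g \<in> L2 T \<and> (AE t in LM T. popov_op g t = f t)" v]) simp
qed

section \<open>Feedback, cost and Riccati operator\<close>

abbreviation b :: "'x \<Rightarrow> real \<Rightarrow> 'u" where
  "b x \<equiv> \<lambda>t. L2_adjoint T F (\<lambda>s. Q s (Psi x s)) t + N t (Psi x t)"

abbreviation v :: "'x \<Rightarrow> real \<Rightarrow> 'u" where "v \<equiv> feedback T Q R N Psi F"

lemma v_L2 [simp]: "v x \<in> L2 T"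
  unfolding feedback_def by (rule conjunct1[OF popov_inverse]) simp

text \<open>The a.e. equation solved by the feedback, tested against w, with the adjoint of F moved
  over to F w; in this weak form it becomes an exact identity of numbers.\<close>

lemma form_v: 
  assumes [simp]: "w \<in> L2 T"
  shows "form w (v x) = ip (F w) (\<lambda>t. Q t (Psi x t)) + ip w (\<lambda>t. N t (Psi x t))"
proof -
  have "AE t in LM T. popov_op (v x) t = b x t"
    unfolding feedback_def by (rule conjunct2[OF popov_inverse]) simp
  then have "form w (v x) = ip w (b x)"
    unfolding form_def by (intro L2_cinner_AE_cong[symmetric]) auto
  then show ?thesis by (simp add: L2_cinner_add_right L2_cinner_adjoint[OF F])
qed

lemma cost_eq:
  assumes [simp]: "u \<in> L2 T"
  shows "cost T Q R N Psi F u x =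
    ip (Psi x) (\<lambda>t. Q t (Psi x t)) - form (v x) (v x) + form (u + v x) (u + v x)"
proof -
  let ?y = "\<lambda>t. Psi x t + F u t"
  have "cost T Q R N Psi F u x =
    ip ?y (\<lambda>t. Q t (?y t) + cadjoint (N t) (u t)) + ip u (\<lambda>t. N t (?y t) + R t (u t))"
    unfolding cost_def L2_cinner_def Let_def
    by (intro Bochner_Integration.integral_add integrable_L2_cinner) auto
  also have "\<dots> = ip (Psi x) (\<lambda>t. Q t (Psi x t)) + form u u + form u (v x)
      + (ip (Psi x) (\<lambda>t. Q t (F u t)) + ip (Psi x) (\<lambda>t. cadjoint (N t) (u t)))"
    by (simp add: blinfun.add_right L2_cinner_add_left L2_cinner_add_right form_eq[of u u] form_v)
  \<comment> \<open>The cross terms with \<open>Psi x\<close> on the left are conjugates of those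
    that make up \<open>form u (v x)\<close>, so together they equal \<open>form (v x) u\<close> and
    the square can be completed.\<close>
  also have "ip (Psi x) (\<lambda>t. Q t (F u t)) = cnj (ip (F u) (\<lambda>t. Q t (Psi x t)))"
    by (simp add: L2_cinner_selfadjoint[OF Q, symmetric] L2_cinner_commute[of "F u"])
  also have "ip (Psi x) (\<lambda>t. cadjoint (N t) (u t)) = cnj (ip u (\<lambda>t. N t (Psi x t)))"
    by (simp add: L2_cinner_cadjoint[OF N, symmetric] L2_cinner_commute[of u])
  also have "cnj (ip (F u) (\<lambda>t. Q t (Psi x t))) + cnj (ip u (\<lambda>t. N t (Psi x t))) = form (v x) u"
    by (simp add: form_commute[of "v x" u] form_v)
  finally show ?thesis by (simp add: form.ip_simps)
qed

lemma cinner_output_adjoint: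
  assumes "w \<in> L2 T"
  shows "cinner z (output_adjoint T Psi w) = ip (Psi z) w"
  by (rule output_adjoint[OF Psi_L2 _ _ Psi_bound assms, symmetric]) (rule Psi_add Psi_scaleC, assumption)+

text \<open>Tested with z, the chosen output adjoint disappears and the feedback enters through a
  Hermitian form. Symmetry, boundedness and linearity of the Riccati operator are all derived from
  this identity.\<close>

lemma cinner_riccati:
  "cinner z (riccati T Q R N Psi F x) = ip (Psi z) (\<lambda>t. Q t (Psi x t)) - form (v z) (v x)"
proof -
  have "cinner z (riccati T Q R N Psi F x) = ip (Psi z) (\<lambda>t. Q t (Psi x t))
    - ip (Psi z) (\<lambda>t. Q t (F (v x) t) + cadjoint (N t) (v x t))"
    by (simp add: riccati_def Let_def cinner_simps cinner_output_adjoint)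
  also have "ip (Psi z) (\<lambda>t. Q t (F (v x) t) + cadjoint (N t) (v x t)) =
    ip (\<lambda>t. Q t (Psi z t)) (F (v x)) + ip (\<lambda>t. N t (Psi z t)) (v x)"
    by (simp add: L2_cinner_add_right L2_cinner_selfadjoint[OF Q] L2_cinner_cadjoint[OF N])
  also have "\<dots> = cnj (form (v x) (v z))"
    by (simp add: form_v L2_cinner_commute[of "F (v x)"] L2_cinner_commute[of "v x"])
  finally show ?thesis by (simp add: form_commute[of "v z" "v x"])
qed

lemma riccati_selfadjoint: "selfadjoint (riccati T Q R N Psi F)"
  unfolding selfadjoint_def
proof (intro allI)
  fix x y
  have "ip (Psi y) (\<lambda>t. Q t (Psi x t)) = cnj (ip (Psi x) (\<lambda>t. Q t (Psi y t)))"
    by (simp add: L2_cinner_selfadjoint[OF Q, symmetric] L2_cinner_commute[of "Psi y"])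
  then have "cnj (cinner y (riccati T Q R N Psi F x)) = cinner x (riccati T Q R N Psi F y)"
    by (simp add: cinner_riccati form_commute[of "v y" "v x"])
  then show "cinner (riccati T Q R N Psi F x) y = cinner x (riccati T Q R N Psi F y)"
    using cinner_commute[of "riccati T Q R N Psi F x" y] by simp
qed

text \<open>The constant c controls w -> \<open>form w (v x)\<close>. With w = v x, coercivity
  bounds the norm of v x by c / \<open>\<epsilon>\<close> times that of x; then
  \<open>cinner_riccati\<close> is tested with z the Riccati image of x and one factor norm z is
  cancelled.\<close>

lemma riccati_bounded: "\<exists>c. \<forall>x. norm (riccati T Q R N Psi F x) \<le> c * norm x"
proof -
  obtain KF where KF: "KF \<ge> 0" "\<And>u. u \<in> L2 T \<Longrightarrow> L2_norm T (F u) \<le> KF * L2_norm T u"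
    using bounded_L2_opE[OF F] by blast
  obtain KQ KN where K: "KQ \<ge> 0" "AE t in LM T. norm (Q t) \<le> KQ"
      "KN \<ge> 0" "AE t in LM T. norm (N t) \<le> KN"
    using Linf_opE[OF Q(1)] Linf_opE[OF N] by metis
  \<comment> \<open>The absolute value, because the sign of the constant in \<open>Psi_bound\<close>
    is not prescribed.\<close>
  let ?KP = "\<bar>K\<^sub>\<Psi>\<bar>"
  define c where "c = KF * (KQ * ?KP) + KN * ?KP"
  have c: "c \<ge> 0" using KF K by (simp add: c_def)
  have P: "L2_norm T (Psi x) \<le> ?KP * norm x" for x
    using order_trans[OF Psi_bound mult_right_mono[of "K\<^sub>\<Psi>" "\<bar>K\<^sub>\<Psi>\<bar>" "norm x"]] by simp
  have QP: "L2_norm T (\<lambda>t. Q t (Psi x t)) \<le> KQ * (?KP * norm x)" for x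
    by (rule order_trans[OF L2_norm_Linf_op_le[OF Q(1) _ K(1,2)] mult_left_mono[OF P]]) (auto simp: K)
  have NP: "L2_norm T (\<lambda>t. N t (Psi x t)) \<le> KN * (?KP * norm x)" for x
    by (rule order_trans[OF L2_norm_Linf_op_le[OF N _ K(3,4)] mult_left_mono[OF P]]) (auto simp: K)
  have form_le: "cmod (form w (v x)) \<le> c * L2_norm T w * norm x" if [simp]: "w \<in> L2 T" for w x
  proof -
    have "cmod (ip (F w) (\<lambda>t. Q t (Psi x t))) \<le> (KF * L2_norm T w) * (KQ * (?KP * norm x))"
      by (rule order_trans[OF L2_Cauchy_Schwarz mult_mono[OF KF(2) QP]]) (auto simp: L2_norm_nonneg KF)
    moreover have "cmod (ip w (\<lambda>t. N t (Psi x t))) \<le> L2_norm T w * (KN * (?KP * norm x))"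
      by (rule order_trans[OF L2_Cauchy_Schwarz mult_left_mono[OF NP]]) (auto simp: L2_norm_nonneg)
    ultimately show ?thesis
      using norm_triangle_ineq[of "ip (F w) (\<lambda>t. Q t (Psi x t))" "ip w (\<lambda>t. N t (Psi x t))"]
      by (simp add: form_v c_def algebra_simps)
  qed
  have vx: "L2_norm T (v x) \<le> c / \<epsilon> * norm x" for x
  proof -
    have "\<epsilon> * (L2_norm T (v x))\<^sup>2 \<le> c * L2_norm T (v x) * norm x"
      using form_coercive[of "v x"] form_le[of "v x" x] complex_Re_le_cmod[of "form (v x) (v x)"] by simp
    then have *: "L2_norm T (v x) * (\<epsilon> * L2_norm T (v x)) \<le> L2_norm T (v x) * (c * norm x)"
      by (simp add: power2_eq_square ac_simps)
    have "\<epsilon> * L2_norm T (v x) \<le> c * norm x"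
    proof (cases "L2_norm T (v x) = 0")
      case False
      then have "L2_norm T (v x) > 0" using L2_norm_nonneg[of T "v x"] by simp
      with * show ?thesis by simp
    qed (use c in simp)
    then show ?thesis using eps by (simp add: field_simps)
  qed
  define c' where "c' = ?KP * (KQ * ?KP) + c * (c / \<epsilon>)"
  have "norm (riccati T Q R N Psi F x) \<le> c' * norm x" for x
  proof -
    let ?z = "riccati T Q R N Psi F x"
    have "cmod (ip (Psi ?z) (\<lambda>t. Q t (Psi x t))) \<le> (?KP * norm ?z) * (KQ * (?KP * norm x))"
      by (rule order_trans[OF L2_Cauchy_Schwarz mult_mono[OF P QP]]) (auto simp: L2_norm_nonneg)
    moreover have "cmod (form (v ?z) (v x)) \<le> c * (c / \<epsilon> * norm ?z) * norm x"
      by (rule order_trans[OF form_le mult_right_mono[OF mult_left_mono[OF vx]]]) (auto simp: c)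
    moreover have "(norm ?z)\<^sup>2 = cmod (cinner ?z ?z)"
      by (simp add: cinner_self norm_power)
    ultimately have "norm ?z * norm ?z \<le> norm ?z * (c' * norm x)"
      using norm_triangle_ineq4[of "ip (Psi ?z) (\<lambda>t. Q t (Psi x t))" "form (v ?z) (v x)"]
      by (simp add: cinner_riccati c'_def power2_eq_square algebra_simps)
    moreover have "c' \<ge> 0" using c eps K by (simp add: c'_def)
    ultimately show ?thesis by (cases "norm ?z = 0") auto
  qed
  then show ?thesis by blast
qed

text \<open>A symmetric map defined everywhere is linear: moved to the other side of the inner
  product, it leaves an expression linear in x. This avoids asking for linearity of the chosen
  adjoints and inverse.\<close>

lemma riccati_bounded_clinear: "bounded_clinear (riccati T Q R N Psi F)"
proof -
  have sym: "cinner z (riccati T Q R N Psi F x) = cinner (riccati T Q R N Psi F z) x" for x z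
    using riccati_selfadjoint by (simp add: selfadjoint_def)
  show ?thesis
    unfolding bounded_clinear_def clinear_on_def bounded_on_def
  proof (intro conjI ballI allI)
    show "riccati T Q R N Psi F (x + y) = riccati T Q R N Psi F x + riccati T Q R N Psi F y" for x y
      by (rule cinner_eqI) (simp add: cinner_simps sym)
    show "riccati T Q R N Psi F (c *\<^sub>C x) = c *\<^sub>C riccati T Q R N Psi F x" for c x
      by (rule cinner_eqI) (simp add: cinner_simps sym)
  qed (use riccati_bounded in blast)
qed

lemma neg_v_L2: "(\<lambda>t. - v x t) \<in> L2 T"
  using L2_scaleC[OF v_L2, of "-1" x] by (simp add: scaleC_minus_one)

lemma cost_neg_v:
  "cost T Q R N Psi F (\<lambda>t. - v x t) x = ip (Psi x) (\<lambda>t. Q t (Psi x t)) - form (v x) (v x)"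
proof -
  have "(\<lambda>t. - v x t) + v x = 0" by (simp add: fun_eq_iff)
  moreover have "form 0 0 = 0"
    using form.ip_scaleC_left[of "v x" "v x" 0] form.ip_scaleC_left[of "v x" 0 0] by simp
  ultimately show ?thesis by (simp add: cost_eq[OF neg_v_L2])
qed

text \<open>The surplus cost is real and nonnegative, which is what minimality in the order on
  \<open>complex\<close> demands: imaginary parts agree as well.\<close>

lemma cost_neg_v_le: 
  assumes "u \<in> L2 T"
  shows "cost T Q R N Psi F u x =
    cost T Q R N Psi F (\<lambda>t. - v x t) x + of_real (form.q (u + v x))"
  using assms form.closed_rules(2)[of u "v x"]
  by (simp add: cost_eq cost_neg_v form.ip_self[of "u + v x"] del: plus_fun_apply)

theorem optimal_control:
  "bounded_clinear (riccati T Q R N Psi F) \<and> selfadjoint (riccati T Q R N Psi F) \<and>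
    (\<forall>x\<^sub>0. let u_opt = (\<lambda>t. - v x\<^sub>0 t); J = (\<lambda>u. cost T Q R N Psi F u x\<^sub>0) in
       u_opt \<in> L2 T \<and>
       (\<forall>u\<in>L2 T. J u_opt \<le> J u) \<and>
       J u_opt = cinner x\<^sub>0 (riccati T Q R N Psi F x\<^sub>0) \<and>
       (\<forall>u\<in>L2 T. (\<forall>v\<in>L2 T. J u \<le> J v) \<longrightarrow> (AE t in LM T. u t = u_opt t)))"
  unfolding Let_def
proof (intro conjI allI ballI impI riccati_bounded_clinear riccati_selfadjoint neg_v_L2)
  fix x
  show "cost T Q R N Psi F (\<lambda>t. - v x t) x = cinner x (riccati T Q R N Psi F x)"
    by (simp add: cost_neg_v cinner_riccati)
  fix u :: "real \<Rightarrow> 'u" assume u: "u \<in> L2 T"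
  then have uv: "u + v x \<in> L2 T" by simp
  show "cost T Q R N Psi F (\<lambda>t. - v x t) x \<le> cost T Q R N Psi F u x"
    using form.q_nonneg[OF uv] by (simp add: cost_neg_v_le[OF u] less_eq_complex_def)
  assume "\<forall>w\<in>L2 T. cost T Q R N Psi F u x \<le> cost T Q R N Psi F w x"
  then have "cost T Q R N Psi F u x \<le> cost T Q R N Psi F (\<lambda>t. - v x t) x" using neg_v_L2 by blast
  then have "form.q (u + v x) \<le> 0" by (simp add: cost_neg_v_le[OF u] less_eq_complex_def)
  then have "\<epsilon> * (L2_norm T (u + v x))\<^sup>2 \<le> 0"
    using form_coercive[OF uv] by (simp add: form.q_def)
  then have "(L2_norm T (u + v x))\<^sup>2 = 0" using eps by (simp add: mult_le_0_iff)
  then have "(\<integral>t. (norm ((u + v x) t))\<^sup>2 \<partial>LM T) = 0" by (simp add: L2_norm_def)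
  from L2_norm_zero_AE[OF uv this] show "AE t in LM T. u t = - v x t"
    by eventually_elim (simp add: eq_neg_iff_add_eq_0)
qed

end

section \<open>Pseudo-resolvents\<close>

lemma csubspace_closure:
  fixes V :: "'a::complex_normed_vector set"
  assumes V: "csubspace V"
  shows "csubspace (closure V)"
  unfolding csubspace_def
proof (intro conjI ballI allI)
  show "0 \<in> closure V" using csubspace_zero[OF V] closure_subset by blast
  fix x assume "x \<in> closure V"
  then obtain a where a: "\<And>n. a n \<in> V" "a \<longlonglongrightarrow> x" by (auto simp: closure_sequential)
  have "(\<lambda>n. c *\<^sub>C a n) \<longlonglongrightarrow> c *\<^sub>C x" for c
    by (rule bounded_linear.tendsto[OF bounded_linear_scaleC a(2)])
  then show "c *\<^sub>C x \<in> closure V" for c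
    using csubspace_scaleC[OF V a(1)] unfolding closure_sequential
    by (intro exI[of _ "\<lambda>n. c *\<^sub>C a n"]) simp
  fix y assume "y \<in> closure V"
  then obtain b where b: "\<And>n. b n \<in> V" "b \<longlonglongrightarrow> y" by (auto simp: closure_sequential)
  show "x + y \<in> closure V"
    using csubspace_add[OF V a(1) b(1)] tendsto_add[OF a(2) b(2)]
    unfolding closure_sequential by (intro exI[of _ "\<lambda>n. a n + b n"]) simp
qed

text \<open>Abstracts the right resolvent (A - r E)^-1 E. With A - r E in place of r E - A the
  resolvent identity has the sign opposite to the usual one, whence the minus sign in
  \<open>J\<close>.\<close>

locale pseudo_resolvent =
  fixes Rs :: "complex \<Rightarrow> 'x::complex_hilbert \<Rightarrow> 'x" and M \<omega> :: real
  assumes M: "M > 0" and omega: "\<omega> < 0"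
    and add: "\<And>r x y. Re r > \<omega> \<Longrightarrow> Rs r (x + y) = Rs r x + Rs r y"
    and scaleC: "\<And>r c x. Re r > \<omega> \<Longrightarrow> Rs r (c *\<^sub>C x) = c *\<^sub>C Rs r x"
    and resolvent: "\<And>r s x. Re r > \<omega> \<Longrightarrow> Re s > \<omega> \<Longrightarrow> Rs r x - Rs s x = (r - s) *\<^sub>C Rs r (Rs s x)"
    and bound: "\<And>r x. r > \<omega> \<Longrightarrow> norm (Rs (of_real r) x) \<le> M / (r - \<omega>) * norm x"
begin

abbreviation K where "K r \<equiv> {x. Rs r x = 0}"
abbreviation Ran where "Ran r \<equiv> closure (range (Rs r))"

lemma diff: "Re r > \<omega> \<Longrightarrow> Rs r (x - y) = Rs r x - Rs r y"
  using add[of r x "-y"] scaleC[of r "-1" y] by (simp add: scaleC_minus_one)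

lemma zero: "Re r > \<omega> \<Longrightarrow> Rs r 0 = 0"
  using diff[of r 0 0] by simp

lemma clinear: "Re r > \<omega> \<Longrightarrow> clinear_on UNIV (Rs r)"
  by (auto simp: clinear_on_def add scaleC)

lemma K_subset:
  assumes "Re r > \<omega>" "Re s > \<omega>" shows "K r \<subseteq> K s"
proof
  fix x assume "x \<in> K r"
  then show "x \<in> K s" using resolvent[OF assms(2,1), of x] zero[OF assms(2)] by simp
qed

lemma K_eq: "Re r > \<omega> \<Longrightarrow> Re s > \<omega> \<Longrightarrow> K r = K s"
  using K_subset by blast

lemma range_subset:
  assumes "Re r > \<omega>" "Re s > \<omega>" shows "range (Rs r) \<subseteq> range (Rs s)"
proof
  fix y assume "y \<in> range (Rs r)"
  then obtain x where "y = Rs r x" by blast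
  then have "y = Rs s (x - (s - r) *\<^sub>C Rs r x)"
    using resolvent[OF assms(2,1), of x] assms by (simp add: diff scaleC algebra_simps)
  then show "y \<in> range (Rs s)" by blast
qed

lemma Ran_eq: "Re r > \<omega> \<Longrightarrow> Re s > \<omega> \<Longrightarrow> Ran r = Ran s"
  using range_subset by (metis subset_antisym)

lemma csubspace_range: 
  assumes "Re r > \<omega>" shows "csubspace (range (Rs r))"
  unfolding csubspace_def
proof (intro conjI ballI allI)
  show "0 \<in> range (Rs r)" using zero[OF assms] by (metis rangeI)
qed (auto simp flip: add[OF assms] scaleC[OF assms])

lemma csubspace_K: "Re r > \<omega> \<Longrightarrow> csubspace (K r)"
  by (auto simp: csubspace_def zero add scaleC)

section \<open>Approximations of the identity on the closed range\<close>

lemma omega_less [simp]: "\<omega> < 1" "\<omega> < real k + 2" "\<omega> < 2 + real k"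
  using omega by auto

lemma omega_simps: "Re 1 > \<omega>" "Re (of_nat k + 2) > \<omega>"
  by simp_all

lemma csubspace_Ran: "Re r > \<omega> \<Longrightarrow> csubspace (Ran r)"
  by (intro csubspace_closure csubspace_range)

lemma bounded_clinear_one: "bounded_clinear (Rs 1)"
  unfolding bounded_clinear_def bounded_on_def using clinear[of 1] bound[of 1]
  by (auto intro!: exI[of _ "M / (1 - \<omega>)"])

text \<open>Yosida-type approximations. The reference point for range and kernel is 1, so r = k + 2
  keeps r - 1 = k + 1 away from zero.\<close>

definition J :: "nat \<Rightarrow> 'x \<Rightarrow> 'x" where
  "J k x = - ((real k + 2) *\<^sub>R Rs (of_nat k + 2) x)"

lemma J_diff: "J k (x - y) = J k x - J k y"
  by (simp add: J_def diff algebra_simps)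

lemma J_K: "x \<in> K 1 \<Longrightarrow> J k x = 0"
  using K_eq[of 1 "of_nat k + 2"] by (auto simp: J_def)

lemma J_Ran: "J k x \<in> Ran 1"
proof -
  have "Rs (of_nat k + 2) x \<in> Ran 1"
    using range_subset[OF omega_simps(2,1), of k] closure_subset[of "range (Rs 1)"] by blast
  then show ?thesis unfolding J_def
    by (intro csubspace_uminus csubspace_scaleR csubspace_Ran omega_simps)
qed

text \<open>Negativity of \<open>\<omega>\<close> lets M / (r - \<open>\<omega>\<close>) be replaced
  by M / r, so that multiplication by r = k + 2 leaves the constant M, independent of k.\<close>

lemma norm_Rs_le: "norm (Rs (of_nat k + 2) x) \<le> M / (real k + 2) * norm x"
proof -
  have "norm (Rs (of_real (real k + 2)) x) \<le> M / (real k + 2 - \<omega>) * norm x"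
    by (rule bound) (use omega in simp)
  also have "\<dots> \<le> M / (real k + 2) * norm x"
    using M omega by (intro mult_right_mono divide_left_mono) auto
  finally show ?thesis by simp
qed

lemma norm_J_le: "norm (J k x) \<le> M * norm x"
proof -
  have "norm (J k x) = (real k + 2) * norm (Rs (of_nat k + 2) x)" by (simp add: J_def)
  also have "\<dots> \<le> (real k + 2) * (M / (real k + 2) * norm x)"
    by (intro mult_left_mono norm_Rs_le) simp
  also have "\<dots> = M * norm x" by simp
  finally show ?thesis .
qed

lemma Rs_tendsto_0: "(\<lambda>k. Rs (of_nat k + 2) x) \<longlonglongrightarrow> 0"
proof (rule Lim_null_comparison[OF always_eventually[OF allI[OF norm_Rs_le]]])
  have "(\<lambda>k. M / (real k + 2)) \<longlonglongrightarrow> 0"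
    by (intro tendsto_divide_0[OF tendsto_const] filterlim_at_top_imp_at_infinity
      filterlim_tendsto_add_at_top[OF tendsto_const filterlim_real_sequentially, of 2, simplified add.commute])
  then show "(\<lambda>k. M / (real k + 2) * norm x) \<longlonglongrightarrow> 0" by (rule tendsto_mult_left_zero)
qed

text \<open>By the resolvent identity, read in either order, both \<open>J k (Rs 1 x)\<close> and
  \<open>Rs 1 (J k x)\<close> equal the k-th term here; the quotient is r / (r - 1).\<close>

lemma J_aux: "(\<lambda>k. ((real k + 2) / (real k + 1)) *\<^sub>R (Rs 1 x - Rs (of_nat k + 2) x)) \<longlonglongrightarrow> Rs 1 x"
proof -
  have "(\<lambda>k. 1 + inverse (real (Suc k))) \<longlonglongrightarrow> 1 + 0"
    by (intro tendsto_intros LIMSEQ_inverse_real_of_nat)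
  moreover have "1 + inverse (real (Suc k)) = (real k + 2) / (real k + 1)" for k
    by (simp add: field_simps)
  ultimately have "(\<lambda>k. (real k + 2) / (real k + 1)) \<longlonglongrightarrow> 1" by simp
  from tendsto_scaleR[OF this tendsto_diff[OF tendsto_const Rs_tendsto_0], of "Rs 1 x" x]
  show ?thesis by simp
qed

lemma scale_aux: "(real k + 2) *\<^sub>R y = ((real k + 2) / (real k + 1)) *\<^sub>R ((of_nat k + 1) *\<^sub>C (y::'x))"
proof -
  have "(of_nat k + 1) *\<^sub>C y = (real k + 1) *\<^sub>R y" by (simp add: scaleR_eq_scaleC)
  moreover have "real k + 1 \<noteq> 0" by linarith
  ultimately show ?thesis by simp
qed

lemma J_Rs_1: "(\<lambda>k. J k (Rs 1 x)) \<longlonglongrightarrow> Rs 1 x"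
proof -
  have "(of_nat k + 1) *\<^sub>C Rs (of_nat k + 2) (Rs 1 x) = Rs (of_nat k + 2) x - Rs 1 x" for k
    using resolvent[of "of_nat k + 2" 1 x] by (simp add: add.commute)
  then have "J k (Rs 1 x) = ((real k + 2) / (real k + 1)) *\<^sub>R (Rs 1 x - Rs (of_nat k + 2) x)" for k
    unfolding J_def scale_aux by (simp flip: scaleR_minus_right)
  with J_aux show ?thesis by simp
qed

lemma Rs_1_J: "(\<lambda>k. Rs 1 (J k x)) \<longlonglongrightarrow> Rs 1 x"
proof -
  have "(of_nat k + 1) *\<^sub>C Rs 1 (Rs (of_nat k + 2) x) = Rs (of_nat k + 2) x - Rs 1 x" for k
    using resolvent[of 1 "of_nat k + 2" x] scaleC_minus_one[of "(of_nat k + 1) *\<^sub>C Rs 1 (Rs (of_nat k + 2) x)"]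
    by (simp add: scaleC_scaleC algebra_simps)
  moreover have "Rs 1 (J k x) = - ((real k + 2) *\<^sub>R Rs 1 (Rs (of_nat k + 2) x))" for k
    using bounded_linear.linear[OF bounded_clinear_bounded_linear[OF bounded_clinear_one]]
    by (simp add: J_def linear_neg linear_scale)
  ultimately have "Rs 1 (J k x) = ((real k + 2) / (real k + 1)) *\<^sub>R (Rs 1 x - Rs (of_nat k + 2) x)" for k
    unfolding scale_aux by (simp flip: scaleR_minus_right)
  with J_aux show ?thesis by simp
qed

lemma J_tendsto:
  assumes x: "x \<in> Ran 1"
  shows "(\<lambda>k. J k x) \<longlonglongrightarrow> x"
proof (rule LIMSEQ_I)
  fix e :: real assume e: "e > 0"
  \<comment> \<open>The error will be at most M d + d + d.\<close>
  define d where "d = e / (M + 2)"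
  have d: "d > 0" "(M + 2) * d = e" using e M by (auto simp: d_def)
  from x d(1) obtain w where w: "norm (x - Rs 1 w) < d"
    by (auto simp: closure_approachable dist_norm norm_minus_commute)
  obtain k0 where k0: "\<And>k. k \<ge> k0 \<Longrightarrow> norm (J k (Rs 1 w) - Rs 1 w) < d"
    using LIMSEQ_D[OF J_Rs_1 d(1)] by blast
  have "norm (J k x - x) < e" if "k \<ge> k0" for k
  proof -
    have "J k x - x = J k (x - Rs 1 w) + ((J k (Rs 1 w) - Rs 1 w) + (Rs 1 w - x))" by (simp add: J_diff)
    then have "norm (J k x - x) \<le> norm (J k (x - Rs 1 w)) + (norm (J k (Rs 1 w) - Rs 1 w) + norm (Rs 1 w - x))"
      by (simp only:) (intro norm_triangle_mono order_refl)
    also have "norm (J k (x - Rs 1 w)) \<le> M * d"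
      by (rule order_trans[OF norm_J_le mult_left_mono]) (use w M in auto)
    finally show ?thesis using k0[OF that] w d(2) by (simp add: norm_minus_commute algebra_simps)
  qed
  then show "\<exists>n0. \<forall>n\<ge>n0. norm (J n x - x) < e" by blast
qed

text \<open>\<open>J n\<close> annihilates the kernel part and tends to the identity on the range
  part, so its norm bound M passes to the projection. Uniqueness of the components and closedness of
  \<open>W\<close> rest on this.\<close>

lemma norm_le_sum:
  assumes "y \<in> Ran 1" "k \<in> K 1"
  shows "norm y \<le> M * norm (y + k)"
proof (rule tendsto_upperbound[OF tendsto_norm[OF J_tendsto[OF assms(1)]]])
  have "J n y = J n (y + k)" for n
    using J_diff[of n "y + k" k] J_K[OF assms(2)] by simp
  then show "\<forall>\<^sub>F n in sequentially. norm (J n y) \<le> M * norm (y + k)"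
    using norm_J_le by simp
qed simp

section \<open>The sum of closed range and kernel exhausts the space\<close>

definition W :: "'x set" where "W = {y + k |y k. y \<in> Ran 1 \<and> k \<in> K 1}"

lemma Ran_K_mono:
  "y \<in> Ran 1 \<Longrightarrow> y \<in> W" "k \<in> K 1 \<Longrightarrow> k \<in> W"
proof -
  show "y \<in> W" if "y \<in> Ran 1"
    unfolding W_def using that csubspace_zero[OF csubspace_K[of 1]] omega_simps(1)
    by (intro CollectI exI[of _ y] exI[of _ 0]) simp
  show "k \<in> W" if "k \<in> K 1"
    unfolding W_def using that csubspace_zero[OF csubspace_Ran[of 1]] omega_simps(1)
    by (intro CollectI exI[of _ k] exI[of _ 0]) simp
qed

lemma csubspace_W: "csubspace W"
  unfolding csubspace_def
proof (intro conjI ballI allI)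
  note R = csubspaceD[OF csubspace_Ran[OF omega_simps(1)]] and K = csubspaceD[OF csubspace_K[OF omega_simps(1)]]
  show "0 \<in> W" by (intro Ran_K_mono(1) R)
  fix x assume "x \<in> W"
  then obtain a b where x: "x = a + b" "a \<in> Ran 1" "b \<in> K 1" unfolding W_def by blast
  show "c *\<^sub>C x \<in> W" for c
    unfolding W_def using R(3)[OF x(2)] K(3)[OF x(3)] x(1) scaleC_add_right by blast
  fix y assume "y \<in> W"
  then obtain a' b' where y: "y = a' + b'" "a' \<in> Ran 1" "b' \<in> K 1" unfolding W_def by blast
  have "x + y = (a + a') + (b + b')" by (simp add: x(1) y(1))
  then show "x + y \<in> W"
    unfolding W_def using R(2)[OF x(2) y(2)] K(2)[OF x(3) y(3)] by blast
qed

text \<open>By \<open>norm_le_sum\<close> the range components of a convergent sequence are Cauchy;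
  the kernel components then converge too.\<close>

lemma closed_W: "closed W"
  unfolding closed_sequential_limits
proof (intro allI impI, elim conjE)
  fix s z assume s: "\<forall>n. s n \<in> W" and lim: "s \<longlonglongrightarrow> z"
  then obtain y k where s: "\<And>n. s n = y n + k n" and y: "\<And>n. y n \<in> Ran 1" and k: "\<And>n. k n \<in> K 1"
    unfolding W_def mem_Collect_eq by metis
  have "Cauchy y"
  proof (rule CauchyI)
    fix e :: real assume "e > 0"
    then obtain N where N: "\<And>m n. m \<ge> N \<Longrightarrow> n \<ge> N \<Longrightarrow> norm (s m - s n) < e / M"
      using CauchyD[OF LIMSEQ_imp_Cauchy[OF lim], of "e / M"] M by auto
    have "norm (y m - y n) < e" if "m \<ge> N" "n \<ge> N" for m n
    proof -
      have "y m - y n \<in> Ran 1" "k m - k n \<in> K 1"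
        using csubspace_diff[OF csubspace_Ran] csubspace_diff[OF csubspace_K] y k omega_simps(1) by blast+
      from norm_le_sum[OF this] have "norm (y m - y n) \<le> M * norm (s m - s n)"
        by (simp add: s algebra_simps)
      also have "\<dots> < e" using N[OF that] M by (simp add: pos_less_divide_eq mult.commute)
      finally show ?thesis .
    qed
    then show "\<exists>N. \<forall>m\<ge>N. \<forall>n\<ge>N. norm (y m - y n) < e" by blast
  qed
  then obtain y0 where y0: "y \<longlonglongrightarrow> y0" using Cauchy_convergent convergent_def by blast
  have "y0 \<in> Ran 1" using closed_sequentially[OF closed_closure] y y0 by blast
  moreover have "z - y0 \<in> K 1"
  proof -
    have "k \<longlonglongrightarrow> z - y0" using tendsto_diff[OF lim y0] by (simp add: s)
    from bounded_linear.tendsto[OF bounded_clinear_bounded_linear[OF bounded_clinear_one] this]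
    have "(\<lambda>n. 0) \<longlonglongrightarrow> Rs 1 (z - y0)" using k by simp
    then show ?thesis using LIMSEQ_unique[OF tendsto_const] by force
  qed
  moreover have "z = y0 + (z - y0)" by simp
  ultimately show "z \<in> W" unfolding W_def by blast
qed

lemma W_UNIV: "x \<in> W"
proof -
  obtain w where w: "w \<in> W" "\<And>v. v \<in> W \<Longrightarrow> cinner v (x - w) = 0"
    using orthogonal_projection[OF csubspace_W closed_W] by blast
  define z where "z = x - w"
  let ?G = "cadjoint (Rs 1)"
  note adj = cadjoint[OF bounded_clinear_one]
  have lin: "?G (u + v) = ?G u + ?G v" "?G (c *\<^sub>C u) = c *\<^sub>C ?G u" for u v c
    by (rule cinner_eqI, simp add: cinner_simps flip: adj)+
  have "csubspace (range ?G)"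
    unfolding csubspace_def
  proof (intro conjI ballI allI)
    show "0 \<in> range ?G" using lin(2)[of 0 0] by (metis rangeI scaleC_zero_left)
  qed (auto simp flip: lin)
  from csubspace_closure[OF this] orthogonal_projection[OF _ closed_closure]
  obtain w' where w': "w' \<in> closure (range ?G)" "\<And>v. v \<in> closure (range ?G) \<Longrightarrow> cinner v (z - w') = 0"
    by blast
  \<comment> \<open>What remains of z after projecting onto the closed range of the adjoint lies in
    the kernel, hence in \<open>W\<close>; being orthogonal to both z and w', it is zero.\<close>
  have "Rs 1 (z - w') = 0"
  proof (rule cinner_eqI)
    fix u
    have "cinner (?G u) (z - w') = 0" by (rule w'(2)[OF subsetD[OF closure_subset]]) (rule rangeI)
    then show "cinner u (Rs 1 (z - w')) = cinner u 0"
      using adj[of "z - w'" u] cinner_commute[of u "Rs 1 (z - w')"] cinner_commute[of "z - w'" "?G u"] by simp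
  qed
  then have "cinner (z - w') z = 0"
    unfolding z_def by (intro w(2) Ran_K_mono(2)) (simp add: z_def)
  moreover have "cinner (z - w') w' = 0"
    using w'(2)[OF w'(1)] cinner_commute[of "z - w'" w'] by simp
  ultimately have "cinner (z - w') (z - w') = 0" by (simp add: cinner_simps)
  then have z: "z \<in> closure (range ?G)" using w'(1) cinner_eq_zero_iff[of "z - w'"] by simp
  have Jz: "cinner (J k z) z = 0" for k
    unfolding z_def by (intro w(2) Ran_K_mono(1) J_Ran)
  \<comment> \<open>Once \<open>?G u\<close> is within d of z, \<open>Jz\<close> bounds
    \<open>cinner (J k z) (?G u)\<close> by M d norm z for every k, and its limit is
    \<open>cinner z (?G u)\<close>. Replacing z by \<open>?G u\<close> costs another d norm
    z.\<close>
  have "norm z \<le> (1 + M) * d" if "d > 0" for d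
  proof -
    obtain u where u: "norm (z - ?G u) < d"
      using z \<open>d > 0\<close> by (auto simp: closure_approachable dist_norm norm_minus_commute)
    have lim: "(\<lambda>k. cinner (J k z) (?G u)) \<longlonglongrightarrow> cinner z (?G u)"
      unfolding adj[symmetric]
      by (rule bounded_bilinear.tendsto[OF bounded_bilinear_cinner Rs_1_J tendsto_const])
    have "cmod (cinner z (?G u)) \<le> M * norm z * d"
    proof (rule tendsto_upperbound[OF tendsto_norm[OF lim]])
      have "cmod (cinner (J k z) (?G u)) \<le> M * norm z * d" for k
      proof -
        have "cmod (cinner (J k z) (?G u)) = cmod (cinner (J k z) (z - ?G u))"
          by (simp add: cinner_simps Jz)
        also have "\<dots> \<le> (M * norm z) * d"
          by (rule order_trans[OF norm_cinner_le mult_mono[OF norm_J_le]]) (use u M in auto)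
        finally show ?thesis .
      qed
      then show "\<forall>\<^sub>F k in sequentially. cmod (cinner (J k z) (?G u)) \<le> M * norm z * d" by simp
    qed simp
    moreover have "cmod (cinner z (z - ?G u)) \<le> norm z * d"
      by (rule order_trans[OF norm_cinner_le mult_left_mono]) (use u in auto)
    moreover have "(norm z)\<^sup>2 = cmod (cinner z (z - ?G u) + cinner z (?G u))"
      by (simp add: cinner_simps cinner_self norm_power)
    ultimately have "norm z * norm z \<le> norm z * ((1 + M) * d)"
      using norm_triangle_ineq[of "cinner z (z - ?G u)" "cinner z (?G u)"]
      by (simp add: power2_eq_square algebra_simps)
    moreover have "(1 + M) * d \<ge> 0" using M that by simp
    ultimately show ?thesis by (cases "norm z = 0") auto
  qed
  note le = this
  have "norm z = 0"
  proof (rule ccontr)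
    assume "norm z \<noteq> 0"
    then have "norm z > 0" by simp
    then have "norm z + M * norm z > 0" using M by (simp add: add_pos_pos)
    \<comment> \<open>With this d the estimate reads norm z <= norm z / 2.\<close>
    then show False using le[of "norm z / (2 * (1 + M))"] M \<open>norm z > 0\<close> by (simp add: field_simps)
  qed
  then show ?thesis using w(1) by (simp add: z_def)
qed

lemma decomposition:
  assumes r: "Re r > \<omega>"
  shows "\<exists>!y. y \<in> Ran r \<and> x - y \<in> K r"
  unfolding Ran_eq[OF r omega_simps(1)] K_eq[OF r omega_simps(1)]
proof (rule ex_ex1I)
  obtain y k where "x = y + k" "y \<in> Ran 1" "k \<in> K 1" using W_UNIV[of x] unfolding W_def by blast
  then show "\<exists>y. y \<in> Ran 1 \<and> x - y \<in> K 1" by (intro exI[of _ y]) simp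
next
  fix y y' assume *: "y \<in> Ran 1 \<and> x - y \<in> K 1" "y' \<in> Ran 1 \<and> x - y' \<in> K 1"
  have "y - y' \<in> Ran 1" using * csubspace_diff[OF csubspace_Ran[OF omega_simps(1)]] by blast
  moreover have "y' - y \<in> K 1"
    using * csubspace_diff[OF csubspace_K[OF omega_simps(1)], of "x - y" "x - y'"] by simp
  ultimately have "norm (y - y') \<le> M * norm ((y - y') + (y' - y))" by (rule norm_le_sum)
  then show "y = y'" by simp
qed

text \<open>The same definite description as in \<open>proj_R\<close>, so that the two can be
  identified for the right resolvent.\<close>

definition P :: "complex \<Rightarrow> 'x \<Rightarrow> 'x" where
  "P r x = (THE y. y \<in> Ran r \<and> x - y \<in> K r)"

lemma P: "Re r > \<omega> \<Longrightarrow> P r x \<in> Ran r" "Re r > \<omega> \<Longrightarrow> x - P r x \<in> K r"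
  using theI'[OF decomposition[of r x]] unfolding P_def by blast+

lemma P_eqI: "Re r > \<omega> \<Longrightarrow> y \<in> Ran r \<Longrightarrow> x - y \<in> K r \<Longrightarrow> P r x = y"
  using decomposition[of r x] P[of r x] by blast

lemma P_Ran: "Re r > \<omega> \<Longrightarrow> y \<in> Ran r \<Longrightarrow> P r y = y"
  by (rule P_eqI) (simp_all add: zero)

lemma P_add: "Re r > \<omega> \<Longrightarrow> P r (x + y) = P r x + P r y"
  using csubspace_add[OF csubspace_Ran P(1,1)] csubspace_add[OF csubspace_K P(2,2)]
  by (intro P_eqI) (auto simp: algebra_simps)

lemma P_scaleC: "Re r > \<omega> \<Longrightarrow> P r (c *\<^sub>C x) = c *\<^sub>C P r x"
  using csubspace_scaleC[OF csubspace_Ran P(1)] csubspace_scaleC[OF csubspace_K P(2)]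
  by (intro P_eqI) (auto simp: scaleC_diff_right)

end

text \<open>Each identity is checked by verifying that a candidate y solves A y - r E y = E x, whose
  solution in D is unique. \<open>pencil_resolvent_set\<close> speaks of r E - A, hence the sign
  changes in the proof.\<close>

lemma pencil_pseudo_resolvent:
  fixes E :: "'x::complex_hilbert \<Rightarrow> 'z::complex_hilbert"
  assumes E: "bounded_clinear E" and D: "csubspace D" and A: "clinear_on D A"
    and "M > 0" "\<omega> < 0"
    and res: "{s. Re s > \<omega>} \<subseteq> pencil_resolvent_set E D A"
    and bound: "\<And>r x. r > \<omega> \<Longrightarrow>
      norm (right_resolvent E D A (complex_of_real r) x) \<le> M / (r - \<omega>) * norm x"
  shows "pseudo_resolvent (right_resolvent E D A) M \<omega>"
proof -
  let ?R = "right_resolvent E D A"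
  note E_simps = bounded_clinear_simps[OF E]
  have inj: "x = y" if "Re r > \<omega>" "x \<in> D" "y \<in> D" "A x - r *\<^sub>C E x = A y - r *\<^sub>C E y" for r x y
  proof -
    have "inj_on (\<lambda>x. r *\<^sub>C E x - A x) D"
      using res that(1) by (auto simp: pencil_resolvent_set_def bij_betw_def)
    moreover have "r *\<^sub>C E x - A x = r *\<^sub>C E y - A y"
      using arg_cong[OF that(4), of uminus] by simp
    ultimately show ?thesis using that(2,3) by (auto dest: inj_onD)
  qed
  have R: "?R r x \<in> D" "A (?R r x) - r *\<^sub>C E (?R r x) = E x" if "Re r > \<omega>" for r x
  proof -
    have "(\<lambda>x. r *\<^sub>C E x - A x) ` D = UNIV"
      using res that by (auto simp: pencil_resolvent_set_def bij_betw_def)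
    then obtain y where y: "y \<in> D" "r *\<^sub>C E y - A y = - E x"
      by (metis (no_types, lifting) UNIV_I image_iff)
    have "A y - r *\<^sub>C E y = - (r *\<^sub>C E y - A y)" by simp
    also have "\<dots> = E x" unfolding y(2) by simp
    finally have "A y - r *\<^sub>C E y = E x" .
    then have *: "E x \<in> (\<lambda>x. A x - r *\<^sub>C E x) ` D" using y(1) by (metis (no_types, lifting) imageI)
    show "?R r x \<in> D" "A (?R r x) - r *\<^sub>C E (?R r x) = E x"
      unfolding right_resolvent_def using inv_into_into[OF *] f_inv_into_f[OF *] by auto
  qed
  have R_eqI: "?R r x = y" if "Re r > \<omega>" "y \<in> D" "A y - r *\<^sub>C E y = E x" for r x y
    using that R[OF that(1)] by (intro inj[OF that(1)]) auto
  note A_simps = clinear_on_add[OF A] clinear_on_scaleC[OF A]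
  note D_simps = csubspace_add[OF D] csubspace_scaleC[OF D]
  show ?thesis
  proof
    fix r s x y c assume r: "Re r > \<omega>"
    have "A (?R r x + ?R r y) - r *\<^sub>C E (?R r x + ?R r y)
        = (A (?R r x) - r *\<^sub>C E (?R r x)) + (A (?R r y) - r *\<^sub>C E (?R r y))"
      using R(1)[OF r] by (simp add: A_simps E_simps scaleC_add_right)
    then show "?R r (x + y) = ?R r x + ?R r y"
      using R[OF r] by (intro R_eqI r D_simps) (auto simp: E_simps)
    have "A (c *\<^sub>C ?R r x) - r *\<^sub>C E (c *\<^sub>C ?R r x) = c *\<^sub>C (A (?R r x) - r *\<^sub>C E (?R r x))"
      using R(1)[OF r] by (simp add: A_simps E_simps scaleC_diff_right scaleC_scaleC mult.commute)
    then show "?R r (c *\<^sub>C x) = c *\<^sub>C ?R r x"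
      using R[OF r] by (intro R_eqI r D_simps) (auto simp: E_simps)
    assume s: "Re s > \<omega>"
    define u where "u = ?R s x"
    define w where "w = ?R r u"
    have u: "u \<in> D" "A u = E x + s *\<^sub>C E u"
      using R[OF s, of x] by (auto simp: u_def algebra_simps)
    have w: "w \<in> D" "A w = E u + r *\<^sub>C E w"
      using R[OF r, of u] by (auto simp: w_def algebra_simps)
    \<comment> \<open>The candidate is the resolvent identity solved for
      \<open>?R r x\<close>.\<close>
    have "?R r x = u + (r - s) *\<^sub>C w"
    proof (rule R_eqI[OF r])
      have "A (u + (r - s) *\<^sub>C w) - r *\<^sub>C E (u + (r - s) *\<^sub>C w)
        = E x + s *\<^sub>C E u - r *\<^sub>C E u + (r - s) *\<^sub>C E u"
        using u w D_simps(2)[OF w(1)]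
        by (simp add: A_simps E_simps scaleC_add_right scaleC_scaleC mult.commute)
      also have "(r - s) *\<^sub>C E u = r *\<^sub>C E u - s *\<^sub>C E u"
        using scaleC_add_left[of "r - s" s "E u"] by simp
      finally show "A (u + (r - s) *\<^sub>C w) - r *\<^sub>C E (u + (r - s) *\<^sub>C w) = E x" by simp
    qed (intro D_simps u w)
    then show "?R r x - ?R s x = (r - s) *\<^sub>C ?R r (?R s x)" by (simp add: u_def w_def)
  qed (use assms in auto)
qed

section \<open>Output map and input-output operator\<close>

text \<open>For s <= r the difference is S s applied to S (r - s) y - y. Factoring out the smaller
  time in this way, the uniform bound spreads right continuity at 0 to two-sided continuity at all
  later times.\<close>

lemma bounded_semigroup_continuous:
  assumes S: "C0_semigroup_on V S"
    and V: "csubspace V" and y: "y \<in> V"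
    and bound: "\<And>t x. t \<ge> 0 \<Longrightarrow> x \<in> V \<Longrightarrow> norm (S t x) \<le> K * norm x"
  shows "continuous_on {0..} (\<lambda>t. S t y)"
  unfolding continuous_on_iff
proof (intro ballI allI impI)
  fix t e :: real assume "t \<in> {0..}" "e > 0"
  then have t: "t \<ge> 0" and e: "e > 0" by auto
  have SV: "S r x \<in> V" if "r \<ge> 0" "x \<in> V" for r x using S that unfolding C0_semigroup_on_def by blast
  have le: "norm (S r y - S s y) \<le> \<bar>K\<bar> * norm (S (r - s) y - y)" if "0 \<le> s" "s \<le> r" for r s
  proof -
    have "S (s + (r - s)) y = S s (S (r - s) y)"
      using S y that unfolding C0_semigroup_on_def by (metis diff_ge_0_iff_ge)
    moreover have "clinear_on V (S s)" using S that unfolding C0_semigroup_on_def by blast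
    ultimately have "S r y - S s y = S s (S (r - s) y - y)"
      using clinear_on_diff[OF _ V, of "S s" "S (r - s) y" y] SV y that by simp
    also have "norm \<dots> \<le> K * norm (S (r - s) y - y)"
      by (intro bound csubspace_diff[OF V] SV y) (use that in auto)
    also have "\<dots> \<le> \<bar>K\<bar> * norm (S (r - s) y - y)" by (intro mult_right_mono) auto
    finally show ?thesis .
  qed
  have "((\<lambda>h. S h y) \<longlongrightarrow> y) (at_right 0)" using S y unfolding C0_semigroup_on_def by blast
  \<comment> \<open>Adding 1 excludes a division by zero when K = 0.\<close>
  then have "\<forall>\<^sub>F h in at_right 0. dist (S h y) y < e / (\<bar>K\<bar> + 1)"
    using e by (intro tendstoD) auto
  then obtain d where d: "d > 0" "\<And>h. 0 < h \<Longrightarrow> h < d \<Longrightarrow> norm (S h y - y) < e / (\<bar>K\<bar> + 1)"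
    unfolding eventually_at_right_field by (auto simp: dist_norm)
  have small: "\<bar>K\<bar> * norm (S h y - y) < e" if "0 < h" "h < d" for h
  proof -
    have "\<bar>K\<bar> * norm (S h y - y) \<le> (\<bar>K\<bar> + 1) * norm (S h y - y)" by (intro mult_right_mono) auto
    also have "\<dots> < e" using d(2)[OF that] by (simp add: pos_less_divide_eq mult.commute)
    finally show ?thesis .
  qed
  have "dist (S t' y) (S t y) < e" if t': "t' \<in> {0..}" "dist t' t < d" for t'
  proof -
    consider "t' = t" | "t' < t" | "t < t'" by linarith
    then show ?thesis
    proof cases
      case 2
      have "norm (S t y - S t' y) < e"
        by (rule order_le_less_trans[OF le small]) (use t' 2 in \<open>auto simp: dist_real_def\<close>)
      then show ?thesis by (simp add: dist_norm norm_minus_commute)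
    next
      case 3
      have "norm (S t' y - S t y) < e"
        by (rule order_le_less_trans[OF le small]) (use t t' 3 in \<open>auto simp: dist_real_def\<close>)
      then show ?thesis by (simp add: dist_norm)
    qed (use e in simp)
  qed
  then show "\<exists>d>0. \<forall>t'\<in>{0..}. dist t' t < d \<longrightarrow> dist (S t' y) (S t y) < e" using d(1) by blast
qed

lemma L2_continuous_bounded:
  fixes f :: "real \<Rightarrow> 'a::real_normed_vector"
  assumes f: "continuous_on {0..T} f" and le: "\<And>t. t \<in> {0..T} \<Longrightarrow> norm (f t) \<le> K" and T: "T \<ge> 0"
  shows "f \<in> L2 T" "L2_norm T f \<le> sqrt T * K"
proof -
  have le2: "(norm (f t))\<^sup>2 \<le> K\<^sup>2" if "t \<in> {0..T}" for t
    by (rule power_mono[OF le[OF that]]) simp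
  show L2: "f \<in> L2 T"
    using le2 by (intro L2I[where g = "\<lambda>t. K\<^sup>2"] continuous_strongly_measurable f AE_I2) auto
  have K: "K \<ge> 0" using order_trans[OF norm_ge_zero le[of 0]] T by simp
  have "(\<integral>t. (norm (f t))\<^sup>2 \<partial>LM T) \<le> (\<integral>t. K\<^sup>2 \<partial>LM T)"
    using le2 L2_integrable[OF L2] by (intro integral_mono_AE AE_I2) auto
  also have "\<dots> = T * K\<^sup>2" using T by (simp add: measure_restrict_space)
  finally have "sqrt (\<integral>t. (norm (f t))\<^sup>2 \<partial>LM T) \<le> sqrt (T * K\<^sup>2)" by (rule real_sqrt_le_mono)
  then show "L2_norm T f \<le> sqrt T * K" using K by (simp add: L2_norm_def real_sqrt_mult)
qed

text \<open>Exponential stability bounds \<open>S t (P r x)\<close> by a multiple of the norm of x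
  at once. As \<open>P r\<close> is the identity on its range, the same constant bounds the
  semigroup there, which gives continuity in time and hence measurability.\<close>

lemma (in pseudo_resolvent) output_map_bounded:
  fixes S :: "real \<Rightarrow> 'x \<Rightarrow> 'x" and C :: "'x \<Rightarrow> 'y::complex_hilbert"
  assumes r: "Re r > \<omega>" and C: "bounded_clinear C" and S: "C0_semigroup_on (Ran r) S"
    and stable: "exponentially_stable (\<lambda>t x. S t (P r x))" and T: "T \<ge> 0"
  defines "Psi \<equiv> \<lambda>x t. C (S t (P r x))"
  shows "\<exists>K. (\<forall>x. Psi x \<in> L2 T) \<and> (\<forall>x. L2_norm T (Psi x) \<le> K * norm x)"
proof -
  obtain KC where KC: "KC \<ge> 0" "\<And>x. norm (C x) \<le> KC * norm x" using bounded_clinearE[OF C] by blast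
  obtain M' d where M': "M' > 0" "d > 0" "\<And>t x. t \<ge> 0 \<Longrightarrow> norm (S t (P r x)) \<le> M' * exp (- d * t) * norm x"
    using stable unfolding exponentially_stable_def by blast
  have bound: "norm (S t (P r x)) \<le> M' * norm x" if "t \<ge> 0" for t x
  proof -
    have "M' * exp (- d * t) * norm x \<le> M' * 1 * norm x"
      using M' that by (intro mult_right_mono mult_left_mono) auto
    with M'(3)[OF that, of x] show ?thesis by simp
  qed
  have cont: "continuous_on {0..T} (Psi x)" for x
  proof -
    have "norm (S t y) \<le> M' * norm y" if "t \<ge> 0" "y \<in> Ran r" for t y
      using bound[OF that(1), of y] by (simp add: P_Ran[OF r that(2)])
    then have "continuous_on {0..} (\<lambda>t. S t (P r x))"
      by (rule bounded_semigroup_continuous[OF S csubspace_Ran[OF r] P(1)[OF r]])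
    then have "continuous_on {0..T} (\<lambda>t. S t (P r x))" by (rule continuous_on_subset) auto
    then show ?thesis
      unfolding Psi_def by (rule bounded_linear.continuous_on[OF bounded_clinear_bounded_linear[OF C]])
  qed
  have le: "norm (Psi x t) \<le> KC * (M' * norm x)" if "t \<in> {0..T}" for x t
    unfolding Psi_def by (rule order_trans[OF KC(2) mult_left_mono[OF bound KC(1)]]) (use that in auto)
  from L2_continuous_bounded[OF cont le T] show ?thesis
    by (intro exI[of _ "sqrt T * KC * M'"]) (auto simp: ac_simps)
qed

lemma (in pseudo_resolvent) output_map_linear:
  fixes S :: "real \<Rightarrow> 'x \<Rightarrow> 'x" and C :: "'x \<Rightarrow> 'y::complex_hilbert"
  assumes r: "Re r > \<omega>" and C: "bounded_clinear C" and S: "C0_semigroup_on (Ran r) S" and t: "t \<ge> 0"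
  shows "C (S t (P r (x + y))) = C (S t (P r x)) + C (S t (P r y))"
    and "C (S t (P r (c *\<^sub>C x))) = c *\<^sub>C C (S t (P r x))"
proof -
  have lin: "clinear_on (Ran r) (S t)" using S t unfolding C0_semigroup_on_def by blast
  show "C (S t (P r (x + y))) = C (S t (P r x)) + C (S t (P r y))"
    and "C (S t (P r (c *\<^sub>C x))) = c *\<^sub>C C (S t (P r x))"
    by (simp_all add: P_add[OF r] P_scaleC[OF r] clinear_on_add[OF lin P(1)[OF r] P(1)[OF r]]
      clinear_on_scaleC[OF lin P(1)[OF r]] bounded_clinear_simps[OF C])
qed

text \<open>If no bounded extension existed, the definition would fall back to 0, which is bounded as well.\<close>

lemma bounded_L2_op_io_operator:
  fixes E :: "'x::complex_hilbert \<Rightarrow> 'z::complex_hilbert" and C :: "'x \<Rightarrow> 'y::complex_hilbert"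
    and B :: "'u::complex_hilbert \<Rightarrow> 'z"
  shows "bounded_L2_op T (io_operator T E D A B C l S j)"
proof (cases "\<exists>F. io_extension T E D A B C l S j F")
  case True
  then have "io_extension T E D A B C l S j (io_operator T E D A B C l S j)"
    unfolding io_operator_def using someI_ex[OF True] by simp
  then show ?thesis by (simp add: io_extension_def)
next
  case False
  then show ?thesis
    by (auto simp: io_operator_def bounded_L2_op_def zero_L2 L2_norm_def intro!: exI[of _ 0])
qed

theorem proposition4p1:
  fixes E :: "'x::complex_hilbert \<Rightarrow> 'z::complex_hilbert"
    and A :: "'x \<Rightarrow> 'z" and D :: "'x set"
    and B :: "'u::complex_hilbert \<Rightarrow> 'z"
    and C :: "'x \<Rightarrow> 'y::complex_hilbert"
    and tf M \<omega> :: real and l m :: complex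
    and T\<^sub>R :: "real \<Rightarrow> 'x \<Rightarrow> 'x"
    and j :: "'x \<Rightarrow> 'w::complex_banach"
    and Q :: "real \<Rightarrow> 'y \<Rightarrow>\<^sub>L 'y" and R :: "real \<Rightarrow> 'u \<Rightarrow>\<^sub>L 'u" and N :: "real \<Rightarrow> 'y \<Rightarrow>\<^sub>L 'u"
  defines "\<Psi> \<equiv> output_map E D A C l T\<^sub>R"
    and "F \<equiv> io_operator tf E D A B C l T\<^sub>R j"
  assumes "bounded_clinear E" and "bounded_clinear B" and "bounded_clinear C"
    and "closed_densely_defined D A"
    and "tf > 0"
    and "M > 0" and "\<omega> < 0"
    and "{s. Re s > \<omega>} \<subseteq> pencil_resolvent_set E D A"
    and "\<And>r::real. r > \<omega> \<Longrightarrow>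
      (\<forall>x. norm (right_resolvent E D A (complex_of_real r) x) \<le> M / (r - \<omega>) * norm x)"
    and "Re l > \<omega>"
    and "C0_semigroup_on (X_R E D A l) T\<^sub>R"
    and "generator_graph (X_R E D A l) T\<^sub>R = A_R_graph E D A l"
    and "extrapolation_embedding (X_R E D A l) (A_R_graph E D A l) m j"
    and "exponentially_stable (degenerate_semigroup E D A l T\<^sub>R)"
    and "\<exists>K. \<forall>s. Re s > 0 \<longrightarrow> (\<forall>v. norm (transfer_function E D A B C s v) \<le> K * norm v)"
    and "Q \<in> Linf_op tf" and "AE t in lebesgue_on {0..tf}. selfadjoint (Q t)"
    and "R \<in> Linf_op tf" and "AE t in lebesgue_on {0..tf}. selfadjoint (R t)"
    and "N \<in> Linf_op tf"
    and "\<exists>\<epsilon>>0. \<forall>u\<in>L2 tf.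
      complex_of_real (\<epsilon> * (L2_norm tf u)\<^sup>2) \<le> L2_cinner tf u (popov tf Q R N F u)"
  shows "bounded_clinear (riccati tf Q R N \<Psi> F) \<and> selfadjoint (riccati tf Q R N \<Psi> F) \<and>
    (\<forall>x\<^sub>0. let u_opt = (\<lambda>t. - feedback tf Q R N \<Psi> F x\<^sub>0 t); J = (\<lambda>u. cost tf Q R N \<Psi> F u x\<^sub>0) in
       u_opt \<in> L2 tf \<and>
       (\<forall>u\<in>L2 tf. J u_opt \<le> J u) \<and>
       J u_opt = cinner x\<^sub>0 (riccati tf Q R N \<Psi> F x\<^sub>0) \<and>
       (\<forall>u\<in>L2 tf. (\<forall>v\<in>L2 tf. J u \<le> J v) \<longrightarrow> (AE t in lebesgue_on {0..tf}. u t = u_opt t)))"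
proof -
  note A = \<open>closed_densely_defined D A\<close>[unfolded closed_densely_defined_def]
  interpret pr: pseudo_resolvent "right_resolvent E D A" M \<omega>
    by (rule pencil_pseudo_resolvent) (use assms(3-11) A in auto)
  have proj: "proj_R E D A l = pr.P l"
    by (simp add: fun_eq_iff proj_R_def pr.P_def X_R_def X_K_def)
  have S: "C0_semigroup_on (closure (range (right_resolvent E D A l))) T\<^sub>R"
    using \<open>C0_semigroup_on (X_R E D A l) T\<^sub>R\<close> by (simp add: X_R_def)
  have Psi: "\<Psi> = (\<lambda>x t. C (T\<^sub>R t (pr.P l x)))"
    by (simp add: fun_eq_iff \<Psi>_def output_map_def degenerate_semigroup_def proj)
  have "exponentially_stable (\<lambda>t x. T\<^sub>R t (pr.P l x))"
    using \<open>exponentially_stable (degenerate_semigroup E D A l T\<^sub>R)\<close>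
    by (simp add: exponentially_stable_def degenerate_semigroup_def proj)
  from pr.output_map_bounded[OF \<open>Re l > \<omega>\<close> \<open>bounded_clinear C\<close> S this, of tf] \<open>tf > 0\<close>
  obtain K where K: "\<And>x. \<Psi> x \<in> L2 tf" "\<And>x. L2_norm tf (\<Psi> x) \<le> K * norm x"
    unfolding Psi by auto
  obtain \<epsilon> where \<epsilon>: "\<epsilon> > 0" "\<And>u. u \<in> L2 tf \<Longrightarrow>
      complex_of_real (\<epsilon> * (L2_norm tf u)\<^sup>2) \<le> L2_cinner tf u (popov tf Q R N F u)"
    using assms(23) by blast
  interpret lq_problem tf \<Psi> F Q R N K \<epsilon>
  proof
    show "bounded_L2_op tf F" unfolding F_def by (rule bounded_L2_op_io_operator)
    fix x y c t assume "t \<in> {0..tf}"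
    then have "t \<ge> 0" by simp
    note lin = pr.output_map_linear[OF \<open>Re l > \<omega>\<close> \<open>bounded_clinear C\<close> S this]
    show "\<Psi> (x + y) t = \<Psi> x t + \<Psi> y t" "\<Psi> (c *\<^sub>C x) t = c *\<^sub>C \<Psi> x t"
      unfolding Psi by (rule lin)+
  qed (use K \<epsilon> assms(18-22) in auto)
  show ?thesis by (rule optimal_control)
qed

end
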